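(* Let $k\ge2$ be an integer and let $(M^{2k},g)$ be a pseudo-Riemannian manifold of dimension $2k$. Define the symmetric $(0,2)$-tensor field $\Omega^{(k)}_{ij}\in\Gamma(S^2T^*M)$ by $$\bigl(\Omega^{(k)}\bigr)_i^j:=\sum_{\ell=0}^{k-1}4^{k-\ell}\frac1{\ell!\,(k-\ell)}\,\delta_{ii_1\cdots i_{k+\ell}}^{jj_1\cdots j_{k+\ell}}\,W_{j_1j_2}{}^{i_1i_2}\cdots W_{j_{2\ell-1}j_{2\ell}}{}^{i_{2\ell-1}i_{2\ell}}\,P_{j_{2\ell+1}}^{i_{2\ell+1}}\cdots P_{j_{k+\ell}}^{i_{k+\ell}},$$ where $P_{ij}$ is the Schouten tensor of $g$. Then $$2k\,\xi_i^{(k)}=\nabla^j\bigl(\operatorname{tf}\Omega^{(k)}\bigr)_{ij}+\frac1{2k}\nabla_i\mathrm{Pf}^{(k)}(\mathrm{Rm}),$$ where $(\operatorname{tf}\Omega^{(k)})_{ij}:=\Omega^{(k)}_{ij}-\frac1{2k}\operatorname{tr}\Omega^{(k)}\,g_{ij}$ is the trace-free part of $\Omega^{(k)}_{ij}$.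
   Context: Abstract index notation is used; indices are raised and lowered with the metric and repeated indices are contracted. $\nabla$ is the Levi-Civita connection, $R_{ij}{}^k{}_\ell X^\ell=\nabla_i\nabla_jX^k-\nabla_j\nabla_iX^k$, $R_{ij}=R_{ki}{}^k{}_j$, $R=R_k{}^k$, $n=\dim M$. The Schouten tensor is $P_{ij}=\frac1{n-2}(R_{ij}-Jg_{ij})$ with $J=\frac{R}{2(n-1)}$. The Weyl tensor $W_{ijkl}$ is given by $R_{ijkl}=W_{ijkl}+P_{ik}g_{jl}-P_{il}g_{jk}+P_{jl}g_{ik}-P_{jk}g_{il}$. The Cotton tensor is $C_{ijk}=\nabla_iP_{jk}-\nabla_jP_{ik}$. The generalized Kronecker delta is $\delta_{i_1\cdots i_m}^{j_1\cdots j_m}=\sum_{\sigma\in S_m}\mathrm{sgn}(\sigma)\,\delta_{i_1}^{j_{\sigma(1)}}\cdots\delta_{i_m}^{j_{\sigma(m)}}$. With $n=2k$, define $$\mathrm{Pf}^{(k)}(W)=\frac1{k!}\delta_{i_1\cdots i_{2k}}^{j_1\cdots j_{2k}}W_{j_1j_2}{}^{i_1i_2}\cdots W_{j_{2k-1}j_{2k}}{}^{i_{2k-1}i_{2k}},$$ let $\mathrm{Pf}^{(k)}(\mathrm{Rm})$ be given by the same formula with each $W_{ab}{}^{cd}$ replaced by the Riemann tensor $R_{ab}{}^{cd}$, and define $$\xi_i^{(k)}=\frac1{k!}\delta_{ii_2\cdots i_{2k}}^{jj_2\cdots j_{2k}}C_{jj_2}{}^{i_2}W_{j_3j_4}{}^{i_3i_4}\cdots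 W_{j_{2k-1}j_{2k}}{}^{i_{2k-1}i_{2k}}+\frac{1}{2nk}\nabla_i\mathrm{Pf}^{(k)}(W).$$ In the sum defining $\Omega^{(k)}$, the $\ell$-th term contains $\ell$ factors of $W$ and $k-\ell$ factors of $P$. *)

theory Defs
  imports "HOL-Analysis.Analysis" "HOL-Combinatorics.Permutations"
begin

section \<open>Smooth functions and pseudo-Riemannian manifolds\<close>

definition pderivative ::
    "'n::finite \<Rightarrow> (real^'n \<Rightarrow> 'b::real_normed_vector) \<Rightarrow> real^'n \<Rightarrow> 'b" where
  "pderivative i f x = frechet_derivative f (at x) (axis i 1)"

fun Ck_on :: "nat \<Rightarrow> (real^'n::finite) set \<Rightarrow> (real^'n \<Rightarrow> 'b::real_normed_vector) \<Rightarrow> bool" where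
  "Ck_on 0 S f \<longleftrightarrow> continuous_on S f"
| "Ck_on (Suc r) S f \<longleftrightarrow>
     (\<forall>x\<in>S. f differentiable (at x)) \<and> (\<forall>i. Ck_on r S (pderivative i f))"

text \<open>Only used for open \<open>S\<close>.\<close>

definition smooth_on :: "(real^'n::finite) set \<Rightarrow> (real^'n \<Rightarrow> 'b::real_normed_vector) \<Rightarrow> bool" where
  "smooth_on S f \<longleftrightarrow> (\<forall>r. Ck_on r S f)"

type_synonym ('a, 'n) chart = "'a set \<times> ('a \<Rightarrow> real^'n)"

definition transition :: "('a, 'n::finite) chart \<Rightarrow> ('a, 'n) chart \<Rightarrow> real^'n \<Rightarrow> real^'n" where
  "transition c d = snd d \<circ> inv_into (fst c) (snd c)"

locale smooth_manifold =
  fixes M :: "'a topology" and charts :: "('a, 'n::finite) chart set"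
  assumes Hausdorff: "Hausdorff_space M"
    and second_countable: "second_countable M"
    and charts_cover: "(\<Union>c\<in>charts. fst c) = topspace M"
    and chart_domain_open: "c \<in> charts \<Longrightarrow> openin M (fst c)"
    and chart_image_open: "c \<in> charts \<Longrightarrow> open (snd c ` fst c)"
    and chart_homeomorphism: "c \<in> charts \<Longrightarrow>
      homeomorphic_map (subtopology M (fst c)) (top_of_set (snd c ` fst c)) (snd c)"
    and transition_smooth: "c \<in> charts \<Longrightarrow> d \<in> charts \<Longrightarrow>
      smooth_on (snd c ` (fst c \<inter> fst d)) (transition c d)"

text \<open>
  A metric is given by its components in each chart: \<open>g c x $ i $ j\<close> is \<open>g\<^sub>i\<^sub>j\<close> in the chart \<open>c\<close>,
  as a function of the coordinates \<open>x\<close>; components in overlapping charts are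
  related by the transformation law of \<open>(0,2)\<close>-tensors.  The signature is arbitrary.
\<close>

locale pseudo_riemannian_manifold = smooth_manifold M charts
  for M :: "'a topology" and charts :: "('a, 'n::finite) chart set" +
  fixes g :: "('a, 'n) chart \<Rightarrow> real^'n \<Rightarrow> real^'n^'n"
  assumes metric_smooth: "c \<in> charts \<Longrightarrow> smooth_on (snd c ` fst c) (g c)"
    and metric_symmetric: "c \<in> charts \<Longrightarrow> p \<in> fst c \<Longrightarrow> transpose (g c (snd c p)) = g c (snd c p)"
    and metric_nondegenerate: "c \<in> charts \<Longrightarrow> p \<in> fst c \<Longrightarrow> invertible (g c (snd c p))"
    and metric_transform: "c \<in> charts \<Longrightarrow> d \<in> charts \<Longrightarrow> p \<in> fst c \<inter> fst d \<Longrightarrow>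
      g c (snd c p) $ i $ j =
        (\<Sum>a\<in>UNIV. \<Sum>b\<in>UNIV.
           pderivative i (transition c d) (snd c p) $ a *
           pderivative j (transition c d) (snd c p) $ b * g d (snd d p) $ a $ b)"

section \<open>Tensor calculus in a chart\<close>

text \<open>
  Below, \<open>G\<close> is the matrix of components of the metric in a chart and \<open>x\<close> a point of its image.
  A tensor field is represented by its components, with the indices in the order in which
  they are written in abstract index notation, and a derivative index always first.
\<close>

type_synonym 'n metric = "real^'n \<Rightarrow> real^'n^'n"
type_synonym 'n tensor2 = "real^'n \<Rightarrow> 'n \<Rightarrow> 'n \<Rightarrow> real"
type_synonym 'n tensor3 = "real^'n \<Rightarrow> 'n \<Rightarrow> 'n \<Rightarrow> 'n \<Rightarrow> real"
type_synonym 'n tensor4 = "real^'n \<Rightarrow> 'n \<Rightarrow> 'n \<Rightarrow> 'n \<Rightarrow> 'n \<Rightarrow> real"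

text \<open>The inverse metric \<open>g\<^sup>i\<^sup>j\<close>.\<close>

definition metric_up :: "'n::finite metric \<Rightarrow> 'n tensor2" where
  "metric_up G x i j = matrix_inv (G x) $ i $ j"

text \<open>\<open>christoffel G x k i j\<close> is the Christoffel symbol with upper index \<open>k\<close>.\<close>

definition christoffel :: "'n::finite metric \<Rightarrow> 'n tensor3" where
  "christoffel G x k i j = 1/2 * (\<Sum>m\<in>UNIV. metric_up G x k m *
     (pderivative i (\<lambda>y. G y $ j $ m) x + pderivative j (\<lambda>y. G y $ i $ m) x
      - pderivative m (\<lambda>y. G y $ i $ j) x))"

text \<open>The Levi-Civita connection on tensors of the types \<open>X\<^sup>k\<close>, \<open>T\<^sub>j\<^sup>k\<close> and \<open>T\<^sub>j\<^sub>k\<close>.\<close>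

definition nabla_vector :: "'n::finite metric \<Rightarrow> (real^'n \<Rightarrow> real^'n) \<Rightarrow> 'n tensor2" where
  "nabla_vector G X x i k =
     pderivative i (\<lambda>y. X y $ k) x + (\<Sum>m\<in>UNIV. christoffel G x k i m * X x $ m)"

definition nabla_mixed :: "'n::finite metric \<Rightarrow> 'n tensor2 \<Rightarrow> 'n tensor3" where
  "nabla_mixed G T x i j k =
     pderivative i (\<lambda>y. T y j k) x - (\<Sum>m\<in>UNIV. christoffel G x m i j * T x m k)
       + (\<Sum>m\<in>UNIV. christoffel G x k i m * T x j m)"

definition nabla_cov :: "'n::finite metric \<Rightarrow> 'n tensor2 \<Rightarrow> 'n tensor3" where
  "nabla_cov G T x i j k =
     pderivative i (\<lambda>y. T y j k) x - (\<Sum>m\<in>UNIV. christoffel G x m i j * T x m k)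
       - (\<Sum>m\<in>UNIV. christoffel G x m i k * T x j m)"

text \<open>\<open>\<nabla>\<^sup>jT\<^sub>i\<^sub>j\<close>\<close>

definition divergence :: "'n::finite metric \<Rightarrow> 'n tensor2 \<Rightarrow> real^'n \<Rightarrow> 'n \<Rightarrow> real" where
  "divergence G T x i = (\<Sum>j\<in>UNIV. \<Sum>m\<in>UNIV. metric_up G x j m * nabla_cov G T x m i j)"

section \<open>Curvature\<close>

text \<open>
  The mixed curvature tensor with lower indices \<open>i\<close>, \<open>j\<close>, upper index \<open>k\<close> and lower index \<open>l\<close>
  is the component \<open>k\<close> of \<open>\<nabla>\<^sub>i\<nabla>\<^sub>jX - \<nabla>\<^sub>j\<nabla>\<^sub>iX\<close> for the coordinate vector field \<open>X = \<partial>\<^sub>l\<close>.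
\<close>

definition riem_mixed :: "'n::finite metric \<Rightarrow> 'n tensor4" where
  "riem_mixed G x i j k l =
     nabla_mixed G (nabla_vector G (\<lambda>y. axis l 1)) x i j k
     - nabla_mixed G (nabla_vector G (\<lambda>y. axis l 1)) x j i k"

definition riem :: "'n::finite metric \<Rightarrow> 'n tensor4" where
  "riem G x i j k l = (\<Sum>m\<in>UNIV. G x $ k $ m * riem_mixed G x i j m l)"

definition ricci :: "'n::finite metric \<Rightarrow> 'n tensor2" where
  "ricci G x i j = (\<Sum>k\<in>UNIV. riem_mixed G x k i k j)"

definition scalar_curv :: "'n::finite metric \<Rightarrow> real^'n \<Rightarrow> real" where
  "scalar_curv G x = (\<Sum>k\<in>UNIV. \<Sum>m\<in>UNIV. metric_up G x k m * ricci G x k m)"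

definition schouten_trace :: "'n::finite metric \<Rightarrow> real^'n \<Rightarrow> real" where
  "schouten_trace G x = scalar_curv G x / (2 * (real CARD('n) - 1))"

definition schouten :: "'n::finite metric \<Rightarrow> 'n tensor2" where
  "schouten G x i j =
     1 / (real CARD('n) - 2) * (ricci G x i j - schouten_trace G x * G x $ i $ j)"

definition weyl :: "'n::finite metric \<Rightarrow> 'n tensor4" where
  "weyl G x i j k l = riem G x i j k l -
     (schouten G x i k * G x $ j $ l - schouten G x i l * G x $ j $ k
      + schouten G x j l * G x $ i $ k - schouten G x j k * G x $ i $ l)"

definition cotton :: "'n::finite metric \<Rightarrow> 'n tensor3" where
  "cotton G x i j k =
     nabla_cov G (schouten G) x i j k - nabla_cov G (schouten G) x j i k"

text \<open>\<open>raise_last\<close> turns \<open>T\<^sub>a\<^sub>c\<close> into \<open>T\<^sub>a\<^sup>c\<close>; \<open>raise_last_two\<close> turns \<open>T\<^sub>a\<^sub>b\<^sub>c\<^sub>d\<close> into \<open>T\<^sub>a\<^sub>b\<^sup>c\<^sup>d\<close>.\<close>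

definition raise_last :: "'n::finite metric \<Rightarrow> 'n tensor2 \<Rightarrow> 'n tensor2" where
  "raise_last G T x a c = (\<Sum>m\<in>UNIV. metric_up G x c m * T x a m)"

definition raise_last_two :: "'n::finite metric \<Rightarrow> 'n tensor4 \<Rightarrow> 'n tensor4" where
  "raise_last_two G T x a b c d =
     (\<Sum>p\<in>UNIV. \<Sum>q\<in>UNIV. metric_up G x c p * metric_up G x d q * T x a b p q)"

section \<open>The Pfaffians, \<open>\<xi>\<close> and \<open>\<Omega>\<close>\<close>

text \<open>
  Multi-indices are functions \<open>I\<close>, \<open>J\<close> from a finite set \<open>A\<close> of positions to the index type;
  \<open>I\<close> collects the lower indices of the generalized Kronecker delta and \<open>J\<close> the upper ones.
\<close>

definition gdelta :: "nat set \<Rightarrow> (nat \<Rightarrow> 'n) \<Rightarrow> (nat \<Rightarrow> 'n) \<Rightarrow> real" where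
  "gdelta A I J = (\<Sum>\<sigma> | \<sigma> permutes A.
     of_int (sign \<sigma>) * (\<Prod>s\<in>A. if I s = J (\<sigma> s) then 1 else 0))"

abbreviation multi_indices :: "nat set \<Rightarrow> (nat \<Rightarrow> 'n) set" where
  "multi_indices A \<equiv> A \<rightarrow>\<^sub>E UNIV"

text \<open>\<open>S x a b c d\<close> stands for \<open>S\<^sub>a\<^sub>b\<^sup>c\<^sup>d\<close>.\<close>

definition pfaffian :: "nat \<Rightarrow> 'n::finite tensor4 \<Rightarrow> real^'n \<Rightarrow> real" where
  "pfaffian k S x = 1 / fact k *
     (\<Sum>I\<in>multi_indices {1..2 * k}. \<Sum>J\<in>multi_indices {1..2 * k}.
        gdelta {1..2 * k} I J *
        (\<Prod>s=1..k. S x (J (2 * s - 1)) (J (2 * s)) (I (2 * s - 1)) (I (2 * s))))"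

definition pf_weyl :: "nat \<Rightarrow> 'n::finite metric \<Rightarrow> real^'n \<Rightarrow> real" where
  "pf_weyl k G = pfaffian k (raise_last_two G (weyl G))"

definition pf_riem :: "nat \<Rightarrow> 'n::finite metric \<Rightarrow> real^'n \<Rightarrow> real" where
  "pf_riem k G = pfaffian k (raise_last_two G (riem G))"

text \<open>\<open>cotton_up G x a b c\<close> is \<open>C\<^sub>a\<^sub>b\<^sup>c\<close>.\<close>

definition cotton_up :: "'n::finite metric \<Rightarrow> 'n tensor3" where
  "cotton_up G x a b c = (\<Sum>m\<in>UNIV. metric_up G x c m * cotton G x a b m)"

text \<open>Position 1 carries the free lower index \<open>i\<close> and the summed upper index \<open>j\<close>.\<close>

definition xi :: "nat \<Rightarrow> 'n::finite metric \<Rightarrow> real^'n \<Rightarrow> 'n \<Rightarrow> real" where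
  "xi k G x i = 1 / fact k *
     (\<Sum>j\<in>UNIV. \<Sum>I\<in>multi_indices {2..2 * k}. \<Sum>J\<in>multi_indices {2..2 * k}.
        gdelta {1..2 * k} (I(1 := i)) (J(1 := j)) *
        cotton_up G x j (J 2) (I 2) *
        (\<Prod>s=2..k. raise_last_two G (weyl G) x (J (2 * s - 1)) (J (2 * s)) (I (2 * s - 1)) (I (2 * s))))
     + 1 / (2 * real CARD('n) * real k) * pderivative i (pf_weyl k G) x"

text \<open>\<open>Omega_mixed k G x i j\<close> is \<open>\<Omega>\<^sub>i\<^sup>j\<close>; position 0 carries its free indices \<open>i\<close> and \<open>j\<close>.\<close>

definition Omega_mixed :: "nat \<Rightarrow> 'n::finite metric \<Rightarrow> 'n tensor2" where
  "Omega_mixed k G x i j =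
     (\<Sum>l=0..k-1. 4^(k-l) * (1 / (fact l * real (k-l))) *
        (\<Sum>I\<in>multi_indices {1..k+l}. \<Sum>J\<in>multi_indices {1..k+l}.
           gdelta {0..k+l} (I(0 := i)) (J(0 := j)) *
           (\<Prod>s=1..l. raise_last_two G (weyl G) x (J (2 * s - 1)) (J (2 * s)) (I (2 * s - 1)) (I (2 * s))) *
           (\<Prod>s=2 * l+1..k+l. raise_last G (schouten G) x (J s) (I s))))"

definition Omega :: "nat \<Rightarrow> 'n::finite metric \<Rightarrow> 'n tensor2" where
  "Omega k G x i j = (\<Sum>m\<in>UNIV. G x $ j $ m * Omega_mixed k G x i m)"

text \<open>The trace-free part in dimension \<open>2k\<close>.\<close>

definition tf_Omega :: "nat \<Rightarrow> 'n::finite metric \<Rightarrow> 'n tensor2" where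
  "tf_Omega k G x i j =
     Omega k G x i j - 1 / (2 * real k) * (\<Sum>a\<in>UNIV. Omega_mixed k G x a a) * G x $ i $ j"

end

theory Submission
  imports Defs
begin

text \<open>
  Write \<open>R = W + N\<close> for the decomposition that defines the Weyl tensor, where \<open>N\<close> is the
  Kulkarni--Nomizu product of \<open>P\<close> and \<open>g\<close>.  Contracting pairs of indices of a generalized
  Kronecker delta yields numerical factors only, so in dimension \<open>n = 2k\<close>
  every term of \<open>\<Omega>\<close> can be written with the full delta on \<open>2k\<close> positions, by inserting identities.
  The term of index \<open>l\<close> then becomes a value of the polarized Pfaffian \<open>pol_pf\<close>, a symmetric \<open>k\<close>-linear
  form in tensors \<open>X\<^sub>a\<^sub>b\<^sup>c\<^sup>d\<close>, namely \<open>4\<^sup>k\<^sup>-\<^sup>l / (l! (k - l)!)\<close> times its value on one argument \<open>E \<otimes> P\<close>, where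
  \<open>E\<close> is the elementary endomorphism carrying the free indices, \<open>l\<close> arguments \<open>W\<close> and \<open>k - l - 1\<close>
  arguments \<open>P \<otimes> \<delta>\<close> (\<open>Omega_mixed_eq\<close>).

  Since \<open>N\<close> and \<open>4 P \<otimes> \<delta>\<close> have the same antisymmetrization, the binomial expansion of
  \<open>Pf(W + N)\<close> gives \<open>tr \<Omega> = Pf(Rm) - Pf(W)\<close> (\<open>trace_Omega_mixed\<close>).  The assertion thereby
  reduces to the formula for \<open>\<nabla>\<^sub>j\<Omega>\<^sub>i\<^sup>j\<close> in \<open>divergence_Omega_mixed\<close>.

  For that formula, the delta is invariant under endomorphisms, so \<open>pol_pf\<close> obeys the Leibniz rule for
  the Levi-Civita connection (\<open>cov2_pol_pf_Omega_slots\<close>).  Antisymmetrization turns \<open>\<nabla>P\<close> into half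
  the Cotton tensor and, by the second Bianchi identity, \<open>\<nabla>W\<close> into \<open>- \<nabla>N\<close>, which is again a
  multiple of the Cotton tensor.  The contributions of consecutive \<open>l\<close> cancel, and only the one with \<open>k - 1\<close>
  factors \<open>W\<close> survives (\<open>divergence_telescope\<close>); it is the first term of \<open>2k \<xi>\<close>.

  Finally, \<open>\<Omega>\<close> is symmetric because \<open>P\<close> is symmetric, \<open>W\<close> has the pair symmetry of the Riemann
  tensor, and the delta is unchanged when its two multi-indices are exchanged
  (\<open>pol_pf_pair_symmetric\<close>).

  All computations take place in a single chart, where the curvature is handled through the
  connection matrices \<open>\<Gamma>\<^sub>a\<close>; the Bianchi identities and symmetries of the Riemann tensor are derived
  from \<open>R\<^sub>a\<^sub>b = \<partial>\<^sub>a\<Gamma>\<^sub>b - \<partial>\<^sub>b\<Gamma>\<^sub>a + [\<Gamma>\<^sub>a, \<Gamma>\<^sub>b]\<close>, metric compatibility and the symmetry of second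
  derivatives.
\<close>

text \<open>Multi-indices, and the components of tensors with two and four indices at a point.\<close>

type_synonym 'n multi_index = "nat \<Rightarrow> 'n"
type_synonym 'n array2 = "'n \<Rightarrow> 'n \<Rightarrow> real"
type_synonym 'n array4 = "'n \<Rightarrow> 'n \<Rightarrow> 'n \<Rightarrow> 'n \<Rightarrow> real"

text \<open>The name \<open>transpose\<close> alone denotes the transpose of a matrix.\<close>

abbreviation "transposition \<equiv> Transposition.transpose"

section \<open>Contractions with the generalized Kronecker delta\<close>

lemma gdelta_cong:
  assumes "\<And>s. s \<in> A \<Longrightarrow> I s = I' s" "\<And>s. s \<in> A \<Longrightarrow> J s = J' s"
  shows "gdelta A I J = gdelta A I' J'"
  unfolding gdelta_def
  by (intro sum.cong arg_cong2[where f="(*)"] refl prod.cong)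
     (auto simp: assms permutes_in_image)

lemma gdelta_permute_upper:
  assumes "finite A" "\<pi> permutes A"
  shows "gdelta A I (J \<circ> \<pi>) = of_int (sign \<pi>) * gdelta A I J"
proof -
  have p: "permutation \<pi>" using assms permutation_permutes by blast
  have "gdelta A I J = (\<Sum>\<sigma> | \<sigma> permutes A.
     of_int (sign (\<pi> \<circ> \<sigma>)) * (\<Prod>s\<in>A. if I s = J ((\<pi> \<circ> \<sigma>) s) then 1 else 0))"
    unfolding gdelta_def by (rule setum_permutations_compose_left[OF assms(2)])
  also have "\<dots> = (\<Sum>\<sigma> | \<sigma> permutes A. of_int (sign \<pi>) *
     (of_int (sign \<sigma>) * (\<Prod>s\<in>A. if I s = (J \<circ> \<pi>) (\<sigma> s) then 1 else 0)))"
  proof (intro sum.cong refl)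
    fix \<sigma> assume "\<sigma> \<in> {\<sigma>. \<sigma> permutes A}"
    then have "permutation \<sigma>" using assms permutation_permutes by blast
    then have "sign (\<pi> \<circ> \<sigma>) = sign \<pi> * sign \<sigma>" using p sign_compose by blast
    then show "of_int (sign (\<pi> \<circ> \<sigma>)) * (\<Prod>s\<in>A. if I s = J ((\<pi> \<circ> \<sigma>) s) then 1 else (0::real)) =
      of_int (sign \<pi>) * (of_int (sign \<sigma>) * (\<Prod>s\<in>A. if I s = (J \<circ> \<pi>) (\<sigma> s) then 1 else 0))"
      by simp
  qed
  also have "\<dots> = of_int (sign \<pi>) * gdelta A I (J \<circ> \<pi>)"
    by (simp add: gdelta_def sum_distrib_left)
  finally have e: "gdelta A I J = of_int (sign \<pi>) * gdelta A I (J \<circ> \<pi>)" .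
  have "of_int (sign \<pi>) * of_int (sign \<pi>) = (1::real)"
    by (metis of_int_1 of_int_mult sign_idempotent)
  then show ?thesis unfolding e by (simp flip: mult.assoc)
qed

lemma gdelta_commute:
  assumes "finite A"
  shows "gdelta A I J = gdelta A J I"
proof -
  have "gdelta A I J = (\<Sum>\<sigma> | \<sigma> permutes A.
     of_int (sign (inv \<sigma>)) * (\<Prod>s\<in>A. if I s = J (inv \<sigma> s) then 1 else 0))"
    unfolding gdelta_def by (rule sum_permutations_inverse)
  also have "\<dots> = gdelta A J I"
    unfolding gdelta_def
  proof (intro sum.cong refl arg_cong2[where f="(*)"])
    fix \<sigma> assume "\<sigma> \<in> {\<sigma>. \<sigma> permutes A}"
    then have s: "\<sigma> permutes A" by simp
    show "real_of_int (sign (inv \<sigma>)) = real_of_int (sign \<sigma>)"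
      using s assms permutation_permutes sign_inverse by metis
    have "(\<Prod>s\<in>A. if I s = J (inv \<sigma> s) then 1 else 0) =
          (\<Prod>s\<in>A. if I (\<sigma> s) = J (inv \<sigma> (\<sigma> s)) then 1 else (0::real))"
      by (rule prod.permute[OF s, unfolded o_def])
    also have "\<dots> = (\<Prod>s\<in>A. if J s = I (\<sigma> s) then 1 else 0)"
      using s by (intro prod.cong) (auto simp: permutes_inverses)
    finally show "(\<Prod>s\<in>A. if I s = J (inv \<sigma> s) then 1 else 0) =
       (\<Prod>s\<in>A. if J s = I (\<sigma> s) then 1 else (0::real))" .
  qed
  finally show ?thesis .
qed

text \<open>
  The delta does not depend on how its positions are labelled.
\<close>

lemma gdelta_reindex:
  assumes "finite B" "bij_betw \<rho> B A"
  shows "gdelta B (I \<circ> \<rho>) (J \<circ> \<rho>) = gdelta A I J"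
proof -
  have fA: "finite A" using assms bij_betw_finite by blast
  have inj: "inj_on \<rho> B" and im: "\<rho> ` B = A" using assms by (auto simp: bij_betw_def)
  let ?m = "map_permutation B \<rho>"
  have bij: "bij_betw ?m {\<sigma>. \<sigma> permutes B} {\<sigma>. \<sigma> permutes A}"
  proof (rule bij_betw_byWitness[where f'="map_permutation A (inv_into B \<rho>)"])
    have bi: "bij_betw (inv_into B \<rho>) A B" using assms bij_betw_inv_into by blast
    show "\<forall>a\<in>{\<sigma>. \<sigma> permutes B}. map_permutation A (inv_into B \<rho>) (?m a) = a"
      using assms inj by (auto intro!: map_permutation_compose_inv)
    show "\<forall>a'\<in>{\<sigma>. \<sigma> permutes A}. ?m (map_permutation A (inv_into B \<rho>) a') = a'"
      using bi im by (auto intro!: map_permutation_compose_inv simp: f_inv_into_f)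
    show "?m ` {\<sigma>. \<sigma> permutes B} \<subseteq> {\<sigma>. \<sigma> permutes A}"
      using assms map_permutation_permutes by blast
    show "map_permutation A (inv_into B \<rho>) ` {\<sigma>. \<sigma> permutes A} \<subseteq> {\<sigma>. \<sigma> permutes B}"
      using bi map_permutation_permutes by blast
  qed
  have "gdelta A I J = (\<Sum>\<sigma> | \<sigma> permutes B.
     of_int (sign (?m \<sigma>)) * (\<Prod>s\<in>A. if I s = J (?m \<sigma> s) then 1 else 0))"
    unfolding gdelta_def by (rule sum.reindex_bij_betw[OF bij, symmetric])
  also have "\<dots> = gdelta B (I \<circ> \<rho>) (J \<circ> \<rho>)"
    unfolding gdelta_def
  proof (intro sum.cong refl arg_cong2[where f="(*)"])
    fix \<sigma> assume "\<sigma> \<in> {\<sigma>. \<sigma> permutes B}"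
    then have s: "\<sigma> permutes B" by simp
    show "real_of_int (sign (?m \<sigma>)) = real_of_int (sign \<sigma>)"
      using sign_map_permutation[OF inj s assms(1)] by simp
    have "(\<Prod>s\<in>A. if I s = J (?m \<sigma> s) then 1 else (0::real)) =
          (\<Prod>s\<in>B. if I (\<rho> s) = J (?m \<sigma> (\<rho> s)) then 1 else 0)"
      by (rule prod.reindex_bij_betw[OF assms(2), symmetric])
    also have "\<dots> = (\<Prod>s\<in>B. if (I \<circ> \<rho>) s = (J \<circ> \<rho>) (\<sigma> s) then 1 else 0)"
      using inj by (intro prod.cong) (auto simp: map_permutation_apply)
    finally show "(\<Prod>s\<in>A. if I s = J (?m \<sigma> s) then 1 else (0::real)) =
       (\<Prod>s\<in>B. if (I \<circ> \<rho>) s = (J \<circ> \<rho>) (\<sigma> s) then 1 else 0)" .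
  qed
  finally show ?thesis by simp
qed

text \<open>
  Contracting one pair of indices of a delta with \<open>m + 1\<close> pairs, where \<open>m\<close> is the cardinality of
  \<open>A\<close>, gives \<open>n - m\<close> times the delta with \<open>m\<close> pairs.
\<close>

lemma gdelta_contract:
  fixes I J :: "'n::finite multi_index"
  assumes "finite A" "r \<notin> A"
  shows "(\<Sum>a\<in>UNIV. gdelta (insert r A) (I(r := a)) (J(r := a))) =
           (real CARD('n) - real (card A)) * gdelta A I J"
proof -
  let ?f = "\<lambda>a b q s. if (I(r := a)) s = (J(r := a)) ((transposition r b \<circ> q) s) then 1 else (0::real)"
  let ?k = "\<lambda>q s. if I s = J (q s) then 1 else (0::real)"
  define h where "h b q = (\<Sum>a\<in>UNIV. \<Prod>s\<in>insert r A. ?f a b q s)" for b q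
  \<comment> \<open>The permutations of \<open>insert r A\<close> are the \<open>transposition r b \<circ> q\<close> with \<open>q\<close> a permutation of \<open>A\<close>.  For
    \<open>b = r\<close> the sum over \<open>a\<close> is free; for \<open>b \<in> A\<close> it only joins two factors.\<close>
  have hr: "h r q = real CARD('n) * (\<Prod>s\<in>A. ?k q s)"
    if q: "q permutes A" for q
  proof -
    have "(\<Prod>s\<in>insert r A. ?f a r q s) = (\<Prod>s\<in>A. ?k q s)" for a
    proof -
      have "q r = r" using q assms(2) permutes_not_in by metis
      then show ?thesis using assms q
        by (simp, intro prod.cong) (auto simp: permutes_in_image)
    qed
    then show ?thesis by (simp add: h_def)
  qed
  have hb: "h b q = (\<Prod>s\<in>A. ?k q s)"
    if q: "q permutes A" and b: "b \<in> A" for b q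
  proof -
    define s0 where "s0 = inv q b"
    have s0: "s0 \<in> A" "q s0 = b" using q b
      by (auto simp: s0_def permutes_inverses permutes_in_image[OF permutes_inv[OF q]])
    have qr: "q r = r" using q assms(2) permutes_not_in by metis
    have rb: "r \<noteq> b" "r \<noteq> s0" using assms b s0 by auto
    have "(\<Prod>s\<in>insert r A. ?f a b q s)
      = (if a = J b then (if I s0 = a then 1 else 0) else 0) *
         (\<Prod>s\<in>A - {s0}. ?k q s)" for a
    proof -
      have "(\<Prod>s\<in>A - {s0}. ?f a b q s) = (\<Prod>s\<in>A - {s0}. ?k q s)"
      proof (intro prod.cong refl)
        fix s assume s: "s \<in> A - {s0}"
        then have "q s \<noteq> b" "q s \<noteq> r" "s \<noteq> r"
          using s0 q assms(2) by (auto simp: s0_def permutes_inverses permutes_in_image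
              dest: permutes_in_image[OF q, THEN iffD2])
        then show "?f a b q s = ?k q s" by simp
      qed
      then show ?thesis using assms s0 qr rb
        by (simp add: prod.remove[OF assms(1) s0(1)])
    qed
    then have "h b q = (if I s0 = J b then 1 else 0) *
         (\<Prod>s\<in>A - {s0}. ?k q s)"
      unfolding h_def by (simp flip: sum_distrib_right)
    also have "\<dots> = (\<Prod>s\<in>A. ?k q s)"
      using s0 by (simp add: prod.remove[OF assms(1) s0(1)])
    finally show ?thesis .
  qed
  have sg: "sign (transposition r b \<circ> q) = (if b = r then 1 else -1) * sign q"
    if "q permutes A" for b q
    using that assms(1) permutation_permutes[of q]
    by (auto simp: sign_compose permutation_swap_id sign_swap_id)
  have "(\<Sum>a\<in>UNIV. gdelta (insert r A) (I(r := a)) (J(r := a))) =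
     (\<Sum>a\<in>UNIV. \<Sum>b\<in>insert r A. \<Sum>q | q permutes A. of_int (sign (transposition r b \<circ> q)) *
        (\<Prod>s\<in>insert r A. ?f a b q s))"
    unfolding gdelta_def sum_over_permutations_insert[OF assms] ..
  also have "\<dots> = (\<Sum>b\<in>insert r A. \<Sum>q | q permutes A. of_int (sign (transposition r b \<circ> q)) * h b q)"
    unfolding h_def sum_distrib_left
    by (subst sum.swap, rule sum.cong[OF refl], rule sum.swap)
  also have "\<dots> = (\<Sum>b\<in>insert r A. (if b = r then real CARD('n) else -1) * gdelta A I J)"
  proof (intro sum.cong refl)
    fix b assume "b \<in> insert r A"
    then show "(\<Sum>q | q permutes A. of_int (sign (transposition r b \<circ> q)) * h b q) =
       (if b = r then real CARD('n) else -1) * gdelta A I J"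
      using hr hb sg by (auto simp: gdelta_def sum_distrib_left sum_negf[symmetric] intro!: sum.cong)
  qed
  also have "\<dots> = (real CARD('n) - real (card A)) * gdelta A I J"
  proof -
    have "(\<Sum>b\<in>A. if b = r then real CARD('n) else -1) = (\<Sum>b\<in>A. -1)"
      using assms by (intro sum.cong) auto
    then show ?thesis using assms by (simp flip: sum_distrib_right)
  qed
  finally show ?thesis .
qed

text \<open>
  The full contraction of the generalized Kronecker delta on the positions \<open>A\<close> with a family
  \<open>\<Phi>\<close> of components; as in \<open>gdelta\<close>, \<open>I\<close> collects the lower and \<open>J\<close> the upper indices of the delta.
\<close>

definition contraction :: "nat set \<Rightarrow> ('n::finite multi_index \<Rightarrow> 'n multi_index \<Rightarrow> real) \<Rightarrow> real" where
  "contraction A \<Phi> = (\<Sum>I\<in>multi_indices A. \<Sum>J\<in>multi_indices A. gdelta A I J * \<Phi> I J)"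

lemma contraction_cong:
  assumes "\<And>I J. I \<in> multi_indices A \<Longrightarrow> J \<in> multi_indices A \<Longrightarrow> \<Phi> I J = \<Psi> I J"
  shows "contraction A \<Phi> = contraction A \<Psi>"
  unfolding contraction_def using assms by (intro sum.cong) auto

lemma contraction_add: "contraction A (\<lambda>I J. \<Phi> I J + \<Psi> I J) = contraction A \<Phi> + contraction A \<Psi>"
  by (simp add: contraction_def sum.distrib algebra_simps)

lemma contraction_scale: "contraction A (\<lambda>I J. c * \<Phi> I J) = c * contraction A \<Phi>"
  by (simp add: contraction_def sum_distrib_left algebra_simps)

lemma contraction_sum: "contraction A (\<lambda>I J. \<Sum>e\<in>E. \<Phi> e I J) = (\<Sum>e\<in>E. contraction A (\<Phi> e))"
proof (induction E rule: infinite_finite_induct)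
  case (insert x F) then show ?case by (simp add: contraction_add)
qed (simp_all add: contraction_def)

lemma comp_multi_indices:
  "\<pi> permutes A \<Longrightarrow> J \<in> multi_indices A \<Longrightarrow> J \<circ> \<pi> \<in> multi_indices A"
  by (auto simp: PiE_def extensional_def permutes_not_in)

lemma sum_multi_indices_permute:
  assumes "\<pi> permutes A"
  shows "(\<Sum>J\<in>multi_indices A. f (J \<circ> \<pi>)) = (\<Sum>J\<in>multi_indices A. f J)"
proof (rule sum.reindex_bij_betw[OF bij_betw_byWitness[where f'="\<lambda>J. J \<circ> inv \<pi>"]])
  show "(\<lambda>J. J \<circ> inv \<pi>) ` multi_indices A \<subseteq> multi_indices A"
    using comp_multi_indices[OF permutes_inv[OF assms]] by blast
  show "(\<lambda>J. J \<circ> \<pi>) ` multi_indices A \<subseteq> multi_indices A"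
    using comp_multi_indices[OF assms] by blast
qed (use assms in \<open>simp_all add: fun_eq_iff permutes_inverses\<close>)

lemma sign_real_cancel: "real_of_int (sign \<pi>) * (real_of_int (sign \<pi>) * c) = c"
  by (metis mult.assoc mult_1 of_int_1 of_int_mult sign_idempotent)

lemma contraction_permute_upper:
  assumes "finite A" "\<pi> permutes A"
  shows "contraction A (\<lambda>I J. \<Phi> I (J \<circ> \<pi>)) = of_int (sign \<pi>) * contraction A \<Phi>"
proof -
  let ?M = "multi_indices A :: (nat \<Rightarrow> 'a) set"
  have "contraction A (\<lambda>I J. \<Phi> I (J \<circ> \<pi>)) =
     (\<Sum>I\<in>?M. \<Sum>J\<in>?M. of_int (sign \<pi>) * (gdelta A I (J \<circ> \<pi>) * \<Phi> I (J \<circ> \<pi>)))"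
    unfolding contraction_def gdelta_permute_upper[OF assms]
    by (simp only: mult.assoc sign_real_cancel)
  also have "\<dots> = (\<Sum>I\<in>?M. \<Sum>J\<in>?M. of_int (sign \<pi>) * (gdelta A I J * \<Phi> I J))"
    by (intro sum.cong refl sum_multi_indices_permute[OF assms(2), where f="\<lambda>J. _ * (gdelta A _ J * \<Phi> _ J)"])
  finally show ?thesis by (simp add: contraction_def sum_distrib_left)
qed

lemma contraction_commute:
  assumes "finite A"
  shows "contraction A \<Phi> = contraction A (\<lambda>I J. \<Phi> J I)"
  unfolding contraction_def
  by (subst sum.swap) (simp add: gdelta_commute[OF assms])

lemma contraction_permute_lower:
  assumes "finite A" "\<pi> permutes A"
  shows "contraction A (\<lambda>I J. \<Phi> (I \<circ> \<pi>) J) = of_int (sign \<pi>) * contraction A \<Phi>"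
proof -
  have "contraction A (\<lambda>I J. \<Phi> (I \<circ> \<pi>) J) = contraction A (\<lambda>I J. \<Phi> (J \<circ> \<pi>) I)"
    by (rule contraction_commute[OF assms(1)])
  also have "\<dots> = of_int (sign \<pi>) * contraction A (\<lambda>I J. \<Phi> J I)"
    by (rule contraction_permute_upper[OF assms])
  also have "contraction A (\<lambda>I J. \<Phi> J I) = contraction A \<Phi>"
    by (rule contraction_commute[OF assms(1), symmetric])
  finally show ?thesis .
qed

lemma contraction_permute:
  assumes "finite A" "\<pi> permutes A"
  shows "contraction A (\<lambda>I J. \<Phi> (I \<circ> \<pi>) (J \<circ> \<pi>)) = contraction A \<Phi>"
  using contraction_permute_upper[OF assms, of "\<lambda>I J. \<Phi> (I \<circ> \<pi>) J"]
   contraction_permute_lower[OF assms, of \<Phi>] by (simp only: sign_real_cancel)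

lemma contraction_reindex:
  fixes \<Phi> :: "'n::finite multi_index \<Rightarrow> 'n multi_index \<Rightarrow> real"
  assumes "finite B" "bij_betw \<rho> B A"
    and dep: "\<And>I J I' J'. (\<And>s. s \<in> B \<Longrightarrow> I s = I' s) \<Longrightarrow> (\<And>s. s \<in> B \<Longrightarrow> J s = J' s) \<Longrightarrow> \<Phi> I J = \<Phi> I' J'"
  shows "contraction A (\<lambda>I J. \<Phi> (I \<circ> \<rho>) (J \<circ> \<rho>)) = contraction B \<Phi>"
proof -
  let ?f = "\<lambda>I. restrict (I \<circ> \<rho>) B"
  let ?g = "\<lambda>I. restrict (I \<circ> inv_into B \<rho>) A"
  have bij: "bij_betw ?f (multi_indices A) (multi_indices B)"
  proof (rule bij_betw_byWitness[where f'="?g"])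
    show "\<forall>I\<in>multi_indices A. ?g (?f I) = I"
      using assms(2) by (auto simp: fun_eq_iff bij_betw_def inv_into_into f_inv_into_f PiE_def extensional_def)
    show "\<forall>I\<in>multi_indices B. ?f (?g I) = I"
      using assms(2) by (auto simp: fun_eq_iff bij_betw_def  PiE_def extensional_def)
  qed auto
  have "contraction B \<Phi> = (\<Sum>I\<in>multi_indices A. \<Sum>J\<in>multi_indices A. gdelta B (?f I) (?f J) * \<Phi> (?f I) (?f J))"
    unfolding contraction_def
    by (subst sum.reindex_bij_betw[OF bij, symmetric], rule sum.cong[OF refl],
        subst sum.reindex_bij_betw[OF bij, symmetric], rule refl)
  also have "\<dots> = (\<Sum>I\<in>multi_indices A. \<Sum>J\<in>multi_indices A. gdelta A I J * \<Phi> (I \<circ> \<rho>) (J \<circ> \<rho>))"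
  proof (intro sum.cong refl)
    fix I J :: "'n multi_index"
    have "gdelta B (?f I) (?f J) = gdelta B (I \<circ> \<rho>) (J \<circ> \<rho>)" by (rule gdelta_cong) auto
    moreover have "\<Phi> (?f I) (?f J) = \<Phi> (I \<circ> \<rho>) (J \<circ> \<rho>)" by (rule dep) auto
    ultimately show "gdelta B (?f I) (?f J) * \<Phi> (?f I) (?f J) = gdelta A I J * \<Phi> (I \<circ> \<rho>) (J \<circ> \<rho>)"
      using gdelta_reindex[OF assms(1,2), of I J] by simp
  qed
  finally show ?thesis by (simp add: contraction_def)
qed

lemma sum_multi_indices_update:
  fixes f :: "'n::finite multi_index \<Rightarrow> 'n \<Rightarrow> real"
  assumes "s \<in> A"
  shows "(\<Sum>I\<in>multi_indices A. \<Sum>e\<in>UNIV. f I e) = (\<Sum>I\<in>multi_indices A. \<Sum>e\<in>UNIV. f (I(s := e)) (I s))"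
  unfolding sum.cartesian_product
  by (rule sum.reindex_bij_witness[where i="\<lambda>(I, e). (I(s := e), I s)" and j="\<lambda>(I, e). (I(s := e), I s)"])
     (use assms in \<open>auto simp: PiE_def extensional_def\<close>)

text \<open>
  The generalized Kronecker delta is invariant under the general linear group; this is the
  infinitesimal form of the invariance, for the endomorphism with matrix \<open>B\<close>.
\<close>

lemma gdelta_derivation:
  fixes I J :: "'n::finite multi_index" and B :: "'n array2"
  assumes "finite A"
  shows "(\<Sum>s\<in>A. \<Sum>e\<in>UNIV. B e (I s) * gdelta A (I(s := e)) J) =
         (\<Sum>s\<in>A. \<Sum>e\<in>UNIV. B (J s) e * gdelta A I (J(s := e)))"
proof -
  let ?p = "\<lambda>\<sigma> s e. \<Prod>t\<in>A. if I t = (J(s := e)) (\<sigma> t) then 1 else (0::real)"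
  define h where "h \<sigma> s = B (J (\<sigma> s)) (I s) * (\<Prod>t\<in>A-{s}. if I t = J (\<sigma> t) then 1 else 0)" for \<sigma> s
  have L: "(\<Sum>e\<in>UNIV. B e (I s) * (\<Prod>t\<in>A. if (I(s := e)) t = J (\<sigma> t) then 1 else 0)) = h \<sigma> s"
    if "s \<in> A" for s \<sigma>
  proof -
    have "(\<Prod>t\<in>A. if (I(s := e)) t = J (\<sigma> t) then 1 else 0) =
       (if e = J (\<sigma> s) then 1 else 0) * (\<Prod>t\<in>A-{s}. if I t = J (\<sigma> t) then 1 else (0::real))" for e
      by (simp add: prod.remove[OF assms that])
    then have "(\<Sum>e\<in>UNIV. B e (I s) * (\<Prod>t\<in>A. if (I(s := e)) t = J (\<sigma> t) then 1 else 0)) =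
       (\<Sum>e\<in>UNIV. if e = J (\<sigma> s) then h \<sigma> s else 0)"
      by (intro sum.cong) (auto simp: h_def)
    then show ?thesis by simp
  qed
  have R: "(\<Sum>e\<in>UNIV. B (J (\<sigma> u)) e * ?p \<sigma> (\<sigma> u) e) = h \<sigma> u"
    if "u \<in> A" and s: "\<sigma> permutes A" for u \<sigma>
  proof -
    have inj: "\<sigma> t = \<sigma> u \<longleftrightarrow> t = u" for t using permutes_inj[OF s] by (auto dest: injD)
    have "?p \<sigma> (\<sigma> u) e =
       (if e = I u then 1 else 0) * (\<Prod>t\<in>A-{u}. if I t = J (\<sigma> t) then 1 else (0::real))" for e
      by (auto simp: prod.remove[OF assms that(1)] inj)
    then have "(\<Sum>e\<in>UNIV. B (J (\<sigma> u)) e * ?p \<sigma> (\<sigma> u) e) =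
       (\<Sum>e\<in>UNIV. if e = I u then h \<sigma> u else 0)"
      by (intro sum.cong) (auto simp: h_def)
    then show ?thesis by simp
  qed
  have "(\<Sum>s\<in>A. \<Sum>e\<in>UNIV. B e (I s) * gdelta A (I(s := e)) J) =
     (\<Sum>s\<in>A. \<Sum>\<sigma> | \<sigma> permutes A. of_int (sign \<sigma>) *
        (\<Sum>e\<in>UNIV. B e (I s) * (\<Prod>t\<in>A. if (I(s := e)) t = J (\<sigma> t) then 1 else 0)))"
    unfolding gdelta_def sum_distrib_left
    by (rule sum.cong[OF refl], subst sum.swap) (simp add: algebra_simps)
  also have "\<dots> = (\<Sum>s\<in>A. \<Sum>\<sigma> | \<sigma> permutes A. of_int (sign \<sigma>) * h \<sigma> s)"
    by (intro sum.cong refl) (simp only: L)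
  also have "\<dots> = (\<Sum>\<sigma> | \<sigma> permutes A. \<Sum>u\<in>A. of_int (sign \<sigma>) *
      (\<Sum>e\<in>UNIV. B (J (\<sigma> u)) e * ?p \<sigma> (\<sigma> u) e))"
    by (subst sum.swap, intro sum.cong refl) (simp only: R mem_Collect_eq)
  also have "\<dots> = (\<Sum>\<sigma> | \<sigma> permutes A. \<Sum>s\<in>A. of_int (sign \<sigma>) *
      (\<Sum>e\<in>UNIV. B (J s) e * ?p \<sigma> s e))"
  proof (rule sum.cong[OF refl])
    fix \<sigma> assume "\<sigma> \<in> {\<sigma>. \<sigma> permutes A}"
    then have "bij_betw \<sigma> A A" by (simp add: permutes_imp_bij)
    from sum.reindex_bij_betw[OF this, of "\<lambda>s. of_int (sign \<sigma>) *
      (\<Sum>e\<in>UNIV. B (J s) e * ?p \<sigma> s e)"]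
    show "(\<Sum>u\<in>A. of_int (sign \<sigma>) *
      (\<Sum>e\<in>UNIV. B (J (\<sigma> u)) e * ?p \<sigma> (\<sigma> u) e)) =
      (\<Sum>s\<in>A. of_int (sign \<sigma>) *
      (\<Sum>e\<in>UNIV. B (J s) e * ?p \<sigma> s e))" .
  qed
  also have "\<dots> = (\<Sum>s\<in>A. \<Sum>e\<in>UNIV. B (J s) e * gdelta A I (J(s := e)))"
    unfolding gdelta_def sum_distrib_left
    by (subst sum.swap, rule sum.cong[OF refl], subst sum.swap) (simp add: algebra_simps)
  finally show ?thesis .
qed

lemma contraction_lower_action:
  fixes B :: "'n::finite array2"
  shows "contraction A (\<lambda>I J. \<Sum>s\<in>A. \<Sum>e\<in>UNIV. B (I s) e * \<Phi> (I(s := e)) J) =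
     (\<Sum>I\<in>multi_indices A. \<Sum>J\<in>multi_indices A.
        (\<Sum>s\<in>A. \<Sum>e\<in>UNIV. B e (I s) * gdelta A (I(s := e)) J) * \<Phi> I J)"
proof -
  let ?M = "multi_indices A :: 'n multi_index set"
  have 1: "contraction A (\<lambda>I J. \<Sum>e\<in>UNIV. B (I s) e * \<Phi> (I(s := e)) J) =
     (\<Sum>I\<in>?M. \<Sum>J\<in>?M. (\<Sum>e\<in>UNIV. B e (I s) * gdelta A (I(s := e)) J) * \<Phi> I J)" if "s \<in> A" for s
  proof -
    have "contraction A (\<lambda>I J. \<Sum>e\<in>UNIV. B (I s) e * \<Phi> (I(s := e)) J) =
       (\<Sum>J\<in>?M. \<Sum>I\<in>?M. \<Sum>e\<in>UNIV. gdelta A I J * (B (I s) e * \<Phi> (I(s := e)) J))"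
      unfolding contraction_def sum_distrib_left by (rule sum.swap)
    also have "\<dots> = (\<Sum>J\<in>?M. \<Sum>I\<in>?M. \<Sum>e\<in>UNIV. gdelta A (I(s := e)) J * (B e (I s) * \<Phi> I J))"
      by (rule sum.cong[OF refl], subst sum_multi_indices_update[OF that]) simp
    also have "\<dots> = (\<Sum>I\<in>?M. \<Sum>J\<in>?M. \<Sum>e\<in>UNIV. gdelta A (I(s := e)) J * (B e (I s) * \<Phi> I J))"
      by (rule sum.swap)
    finally show ?thesis by (simp only: sum_distrib_right mult.assoc mult.left_commute[of "B _ _"])
  qed
  have "contraction A (\<lambda>I J. \<Sum>s\<in>A. \<Sum>e\<in>UNIV. B (I s) e * \<Phi> (I(s := e)) J) =
     (\<Sum>s\<in>A. \<Sum>I\<in>?M. \<Sum>J\<in>?M. (\<Sum>e\<in>UNIV. B e (I s) * gdelta A (I(s := e)) J) * \<Phi> I J)"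
    by (subst contraction_sum) (rule sum.cong[OF refl 1])
  also have "\<dots> = (\<Sum>I\<in>?M. \<Sum>J\<in>?M. \<Sum>s\<in>A. (\<Sum>e\<in>UNIV. B e (I s) * gdelta A (I(s := e)) J) * \<Phi> I J)"
    by (subst sum.swap, rule sum.cong[OF refl], rule sum.swap)
  finally show ?thesis by (simp only: sum_distrib_right)
qed

lemma contraction_diff: "contraction A (\<lambda>I J. \<Phi> I J - \<Psi> I J) = contraction A \<Phi> - contraction A \<Psi>"
  by (simp add: contraction_def sum_subtractf algebra_simps)

text \<open>
  Moving the endomorphism \<open>B\<close> from the delta to \<open>\<Phi>\<close>: a full contraction of the natural action
  of \<open>B\<close> on \<open>\<Phi>\<close> vanishes.
\<close>

lemma contraction_derivation:
  fixes B :: "'n::finite array2"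
  assumes "finite A"
  shows "contraction A (\<lambda>I J. \<Sum>s\<in>A. \<Sum>e\<in>UNIV. B (I s) e * \<Phi> (I(s := e)) J - B e (J s) * \<Phi> I (J(s := e))) = 0"
proof -
  let ?M = "multi_indices A :: 'n multi_index set"
  have "contraction A (\<lambda>I J. \<Sum>s\<in>A. \<Sum>e\<in>UNIV. B e (J s) * \<Phi> I (J(s := e))) =
     contraction A (\<lambda>I J. \<Sum>s\<in>A. \<Sum>e\<in>UNIV. B e (I s) * \<Phi> J (I(s := e)))"
    by (rule contraction_commute[OF assms])
  also have "\<dots> = (\<Sum>I\<in>?M. \<Sum>J\<in>?M.
        (\<Sum>s\<in>A. \<Sum>e\<in>UNIV. B (I s) e * gdelta A (I(s := e)) J) * \<Phi> J I)"
    by (rule contraction_lower_action)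
  also have "\<dots> = (\<Sum>I\<in>?M. \<Sum>J\<in>?M.
        (\<Sum>s\<in>A. \<Sum>e\<in>UNIV. B (J s) e * gdelta A I (J(s := e))) * \<Phi> I J)"
    by (subst sum.swap, subst gdelta_commute[OF assms], rule refl)
  also have "\<dots> = contraction A (\<lambda>I J. \<Sum>s\<in>A. \<Sum>e\<in>UNIV. B (I s) e * \<Phi> (I(s := e)) J)"
    unfolding contraction_lower_action gdelta_derivation[OF assms] ..
  finally show ?thesis
    by (simp add: sum_subtractf contraction_diff)
qed

section \<open>The polarized Pfaffian\<close>

text \<open>The component of \<open>T\<close> at the indices of slot \<open>s\<close>, which occupies the positions \<open>2s - 1\<close> and \<open>2s\<close>.\<close>

abbreviation slot_at :: "nat \<Rightarrow> 'n array4 \<Rightarrow> 'n multi_index \<Rightarrow> 'n multi_index \<Rightarrow> real" where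
  "slot_at s T I J \<equiv> T (J (2 * s - 1)) (J (2 * s)) (I (2 * s - 1)) (I (2 * s))"

text \<open>
  The polarization of \<open>k!\<close> times the Pfaffian: a form that is linear in each of the \<open>k\<close> slots,
  whose arguments are tensors \<open>X\<^sub>a\<^sub>b\<^sup>c\<^sup>d\<close> (components \<open>X s a b c d\<close> in slot \<open>s\<close>).
\<close>

definition pol_pf :: "nat \<Rightarrow> (nat \<Rightarrow> 'n::finite array4) \<Rightarrow> real" where
  "pol_pf k X = contraction {1..2 * k} (\<lambda>I J. \<Prod>s=1..k.
     slot_at s (X s) I J)"

lemma pol_pf_cong: "(\<And>s. s \<in> {1..k} \<Longrightarrow> X s = Y s) \<Longrightarrow> pol_pf k X = pol_pf k Y"
  unfolding pol_pf_def by (intro contraction_cong prod.cong) auto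

text \<open>
  The product of the components of the tensors in the slots \<open>S\<close>.
\<close>

definition slots_off ::
    "nat set \<Rightarrow> (nat \<Rightarrow> 'n::finite array4) \<Rightarrow> 'n multi_index \<Rightarrow> 'n multi_index \<Rightarrow> real" where
  "slots_off S X I J = (\<Prod>s\<in>S. slot_at s (X s) I J)"

lemma slots_off_update: "s \<notin> S \<Longrightarrow> slots_off S (X(s := T)) = slots_off S X"
  unfolding slots_off_def fun_eq_iff by (intro allI prod.cong) auto

lemma slots_off_cong:
  assumes "\<And>s. s \<in> S \<Longrightarrow> X s = Y s"
    "\<And>s. s \<in> S \<Longrightarrow> I (2 * s - 1) = I' (2 * s - 1) \<and> I (2 * s) = I' (2 * s)"
    "\<And>s. s \<in> S \<Longrightarrow> J (2 * s - 1) = J' (2 * s - 1) \<and> J (2 * s) = J' (2 * s)"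
  shows "slots_off S X I J = slots_off S Y I' J'"
  unfolding slots_off_def using assms by (intro prod.cong) auto

lemma pol_pf_slot:
  assumes "s \<in> {1..k}"
  shows "pol_pf k X = contraction {1..2 * k} (\<lambda>I J.
     slot_at s (X s) I J * slots_off ({1..k} - {s}) X I J)"
  unfolding pol_pf_def slots_off_def by (subst prod.remove[OF finite_atLeastAtMost assms]) (rule refl)

lemma pol_pf_update:
  assumes "s \<in> {1..k}"
  shows "pol_pf k (X(s := T)) = contraction {1..2 * k} (\<lambda>I J.
     slot_at s T I J * slots_off ({1..k} - {s}) X I J)"
  using pol_pf_slot[OF assms, of "X(s := T)"] by (simp add: slots_off_update)

lemma pol_pf_update2:
  assumes "s \<in> {1..k}" "t \<in> {1..k}" "s \<noteq> t"
  shows "pol_pf k (X(s := T, t := U)) = contraction {1..2 * k} (\<lambda>I J.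
     slot_at s T I J *
     slot_at t U I J * slots_off ({1..k} - {s, t}) X I J)"
proof -
  have "slots_off ({1..k} - {t}) (X(s := T)) I J =
     slot_at s T I J * slots_off ({1..k} - {s, t}) X I J" for I J
  proof -
    have s: "s \<in> {1..k} - {t}" "{1..k} - {t} - {s} = {1..k} - {s, t}" using assms by auto
    have "slots_off ({1..k} - {t}) (X(s := T)) I J =
       slot_at s T I J * slots_off ({1..k} - {t} - {s}) (X(s := T)) I J"
      unfolding slots_off_def by (subst prod.remove[OF _ s(1)]) auto
    then show ?thesis unfolding s(2) by (simp add: slots_off_update)
  qed
  then show ?thesis unfolding pol_pf_update[OF assms(2)] by (simp add: mult.commute mult.left_commute)
qed

lemma pol_pf_sum:
  assumes "s \<in> {1..k}"
  shows "pol_pf k (X(s := \<lambda>a b c d. \<Sum>e\<in>E. T e a b c d)) = (\<Sum>e\<in>E. pol_pf k (X(s := T e)))"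
  unfolding pol_pf_update[OF assms] sum_distrib_right contraction_sum ..

lemma pol_pf_add:
  assumes "s \<in> {1..k}"
  shows "pol_pf k (X(s := \<lambda>a b c d. T a b c d + U a b c d)) = pol_pf k (X(s := T)) + pol_pf k (X(s := U))"
  unfolding pol_pf_update[OF assms] distrib_right contraction_add ..

lemma pol_pf_diff:
  assumes "s \<in> {1..k}"
  shows "pol_pf k (X(s := \<lambda>a b c d. T a b c d - U a b c d)) = pol_pf k (X(s := T)) - pol_pf k (X(s := U))"
  unfolding pol_pf_update[OF assms] left_diff_distrib contraction_diff ..

lemma pol_pf_scale:
  assumes "s \<in> {1..k}"
  shows "pol_pf k (X(s := \<lambda>a b c d. r * T a b c d)) = r * pol_pf k (X(s := T))"
  unfolding pol_pf_update[OF assms] mult.assoc contraction_scale ..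

lemma slots_off_comp_transpose:
  assumes "s \<in> {1..k}" "t \<in> {1..k}" "S \<subseteq> {1..k} - {s, t}"
    "a \<in> {2 * s - 1, 2 * s}" "b \<in> {2 * t - 1, 2 * t}"
  shows "slots_off S X I (J \<circ> transposition a b) = slots_off S X I J"
    "slots_off S X (I \<circ> transposition a b) J = slots_off S X I J"
proof -
  have *: "2 * r - 1 \<noteq> a" "2 * r \<noteq> a" "2 * r - 1 \<noteq> b" "2 * r \<noteq> b" if "r \<in> S" for r
  proof -
    have "r \<noteq> s" "r \<noteq> t" "1 \<le> r" "1 \<le> s" "1 \<le> t" using that assms by auto
    then show "2 * r - 1 \<noteq> a" "2 * r \<noteq> a" "2 * r - 1 \<noteq> b" "2 * r \<noteq> b"
      using assms(4,5) by auto
  qed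
  show "slots_off S X I (J \<circ> transposition a b) = slots_off S X I J"
    "slots_off S X (I \<circ> transposition a b) J = slots_off S X I J"
    using * by (auto intro!: slots_off_cong)
qed

lemma pol_pf_swap_first:
  assumes "s \<in> {1..k}"
  shows "pol_pf k (X(s := \<lambda>a b c d. T b a c d)) = - pol_pf k (X(s := T))"
proof -
  let ?\<pi> = "transposition (2 * s - 1) (2 * s)"
  have p: "?\<pi> permutes {1..2 * k}" using assms by (intro permutes_swap_id) auto
  have n: "2 * s - 1 \<noteq> 2 * s" using assms by auto
  have "pol_pf k (X(s := \<lambda>a b c d. T b a c d)) = contraction {1..2 * k} (\<lambda>I J.
     slot_at s T I (J \<circ> ?\<pi>) *
     slots_off ({1..k} - {s}) X I (J \<circ> ?\<pi>))"
    unfolding pol_pf_update[OF assms]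
    by (simp add: slots_off_comp_transpose[OF assms assms])
  also have "\<dots> = of_int (sign ?\<pi>) * pol_pf k (X(s := T))"
    unfolding pol_pf_update[OF assms] by (rule contraction_permute_upper[OF finite_atLeastAtMost p])
  also have "\<dots> = - pol_pf k (X(s := T))" using n by (simp add: sign_swap_id)
  finally show ?thesis .
qed

lemma pol_pf_swap_last:
  assumes "s \<in> {1..k}"
  shows "pol_pf k (X(s := \<lambda>a b c d. T a b d c)) = - pol_pf k (X(s := T))"
proof -
  let ?\<pi> = "transposition (2 * s - 1) (2 * s)"
  have p: "?\<pi> permutes {1..2 * k}" using assms by (intro permutes_swap_id) auto
  have n: "2 * s - 1 \<noteq> 2 * s" using assms by auto
  have "pol_pf k (X(s := \<lambda>a b c d. T a b d c)) = contraction {1..2 * k} (\<lambda>I J.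
     slot_at s T (I \<circ> ?\<pi>) J *
     slots_off ({1..k} - {s}) X (I \<circ> ?\<pi>) J)"
    unfolding pol_pf_update[OF assms]
    by (simp add: slots_off_comp_transpose[OF assms assms])
  also have "\<dots> = of_int (sign ?\<pi>) * pol_pf k (X(s := T))"
    unfolding pol_pf_update[OF assms] by (rule contraction_permute_lower[OF finite_atLeastAtMost p])
  also have "\<dots> = - pol_pf k (X(s := T))" using n by (simp add: sign_swap_id)
  finally show ?thesis .
qed

text \<open>
  The tensor \<open>U\<^sub>a\<^sup>c V\<^sub>b\<^sup>d\<close>.
\<close>

definition otimes :: "'n array2 \<Rightarrow> 'n array2 \<Rightarrow> 'n array4" where
  "otimes U V a b c d = U a c * V b d"

lemma pol_pf_flip:
  assumes "s \<in> {1..k}"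
  shows "pol_pf k (X(s := otimes V U)) = pol_pf k (X(s := otimes U V))"
proof -
  have "pol_pf k (X(s := otimes V U)) = pol_pf k (X(s := \<lambda>a b c d. otimes U V b a d c))"
    by (simp add: otimes_def[abs_def] mult.commute)
  also have "\<dots> = pol_pf k (X(s := otimes U V))"
    using pol_pf_swap_first[OF assms, of X "\<lambda>a b c d. otimes U V a b d c"]
      pol_pf_swap_last[OF assms, of X "otimes U V"] by simp
  finally show ?thesis .
qed

text \<open>
  The four factors of two decomposable slots may be interchanged, since a simultaneous permutation
  of the upper and lower indices leaves the delta unchanged.
\<close>

lemma pol_pf_exchange:
  assumes "s \<in> {1..k}" "t \<in> {1..k}" "s \<noteq> t"
  shows "pol_pf k (X(s := otimes U V, t := otimes Y Z)) = pol_pf k (X(s := otimes U Y, t := otimes V Z))"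
proof -
  let ?\<pi> = "transposition (2 * s) (2 * t - 1)"
  have p: "?\<pi> permutes {1..2 * k}" using assms by (intro permutes_swap_id) auto
  have n: "2 * s - 1 \<noteq> 2 * s" "2 * t - 1 \<noteq> 2 * t" "2 * s \<noteq> 2 * t - 1" "2 * s - 1 \<noteq> 2 * t - 1" "2 * s \<noteq> 2 * t"
    using assms by auto
  have "pol_pf k (X(s := otimes U V, t := otimes Y Z)) = contraction {1..2 * k} (\<lambda>I J.
     slot_at s (otimes U Y) (I \<circ> ?\<pi>) (J \<circ> ?\<pi>) *
     slot_at t (otimes V Z) (I \<circ> ?\<pi>) (J \<circ> ?\<pi>) *
     slots_off ({1..k} - {s, t}) X (I \<circ> ?\<pi>) (J \<circ> ?\<pi>))"
    unfolding pol_pf_update2[OF assms]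

    using n by (simp add: slots_off_comp_transpose[OF assms(1,2)] otimes_def mult_ac)
  also have "\<dots> = pol_pf k (X(s := otimes U Y, t := otimes V Z))"
    unfolding pol_pf_update2[OF assms] by (rule contraction_permute[OF finite_atLeastAtMost p])
  finally show ?thesis .
qed

text \<open>
  If the cyclic sum of \<open>\<Phi>\<close> over three upper positions vanishes, so does the contraction, since the
  delta is invariant under cyclic permutations of three positions.
\<close>

lemma contraction_cyclic:
  assumes "finite A" "{p, q, r} \<subseteq> A" "p \<noteq> q" "q \<noteq> r" "p \<noteq> r"
    and cyc: "\<And>I J. \<Phi> I J + \<Phi> I (J(p := J q, q := J r, r := J p)) + \<Phi> I (J(p := J r, q := J p, r := J q)) = 0"
  shows "contraction A \<Phi> = 0"
proof -
  let ?\<pi> = "transposition p q \<circ> transposition q r"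
  have pp: "?\<pi> permutes A" using assms by (intro permutes_compose permutes_swap_id) auto
  have sg: "sign ?\<pi> = 1" using assms by (simp add: sign_compose permutation_swap_id sign_swap_id)
  have e: "J \<circ> ?\<pi> = J(p := J q, q := J r, r := J p)" for J :: "'a multi_index"
    using assms by (auto simp: fun_eq_iff Transposition.transpose_def)
  have ee: "(J \<circ> ?\<pi>) \<circ> ?\<pi> = J(p := J r, q := J p, r := J q)" for J :: "'a multi_index"
    unfolding e using assms by (auto simp: fun_eq_iff)
  have 1: "contraction A (\<lambda>I J. \<Phi> I (J \<circ> ?\<pi>)) = contraction A \<Phi>"
    using contraction_permute_upper[OF assms(1) pp, of \<Phi>] sg by simp
  have 2: "contraction A (\<lambda>I J. \<Phi> I ((J \<circ> ?\<pi>) \<circ> ?\<pi>)) = contraction A (\<lambda>I J. \<Phi> I (J \<circ> ?\<pi>))"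
    using contraction_permute_upper[OF assms(1) pp, of "\<lambda>I J. \<Phi> I (J \<circ> ?\<pi>)"] sg by simp
  have "contraction A \<Phi> + contraction A (\<lambda>I J. \<Phi> I (J \<circ> ?\<pi>)) + contraction A (\<lambda>I J. \<Phi> I ((J \<circ> ?\<pi>) \<circ> ?\<pi>)) = 0"
    unfolding contraction_add[symmetric] ee unfolding e cyc by (simp add: contraction_def)
  then show ?thesis unfolding 2 1 by simp
qed

text \<open>
  The elementary endomorphism with components \<open>\<delta>\<^sub>a\<^sup>j\<delta>\<^sub>i\<^sup>c\<close>.  Inserting it into a full contraction
  frees a lower index \<open>i\<close> and an upper index \<open>j\<close>.
\<close>

definition elem2 :: "'n \<Rightarrow> 'n \<Rightarrow> 'n array2" where
  "elem2 i j a c = (if a = j \<and> c = i then 1 else 0)"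

text \<open>
  With the free index \<open>j\<close> of the elementary endomorphism contracted into the additional index of
  \<open>T\<close>, only the part of \<open>T\<close> that is antisymmetric in three indices contributes.  For \<open>T = \<nabla>R\<close>
  this part vanishes by the second Bianchi identity.
\<close>

lemma pol_pf_cyclic:
  fixes T :: "'n::finite \<Rightarrow> 'n array4"
  assumes "s \<in> {1..k}" "t \<in> {1..k}" "s \<noteq> t"
    and cyc: "\<And>m a b c d. T m a b c d + T a b m c d + T b m a c d = 0"
  shows "(\<Sum>j\<in>UNIV. pol_pf k (X(s := otimes (elem2 i j) V, t := T j))) = 0"
proof -
  define \<Phi> where "\<Phi> I J = (if I (2 * s - 1) = i then 1 else 0) * V (J (2 * s)) (I (2 * s)) *
      T (J (2 * s - 1)) (J (2 * t - 1)) (J (2 * t)) (I (2 * t - 1)) (I (2 * t)) *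
      slots_off ({1..k} - {s, t}) X I J" for I J
  let ?p = "2 * s - 1" and ?q = "2 * t - 1" and ?r = "2 * t"
  have n: "2 * s - 1 \<noteq> 2 * s" "2 * t - 1 \<noteq> 2 * t" "2 * s \<noteq> 2 * t - 1" "2 * s - 1 \<noteq> 2 * t - 1" "2 * s \<noteq> 2 * t"
     "2 * s - 1 \<noteq> 2 * t"
    using assms by auto
  have r: "slots_off ({1..k} - {s, t}) X I (J(?p := x, ?q := y, ?r := z)) = slots_off ({1..k} - {s, t}) X I J"
    for I J x y z
  proof (rule slots_off_cong)
    fix u assume "u \<in> {1..k} - {s, t}"
    then have "u \<noteq> s" "u \<noteq> t" "1 \<le> u" "1 \<le> s" "1 \<le> t" using assms by auto
    then have "2 * u - 1 \<noteq> ?p" "2 * u \<noteq> ?p" "2 * u - 1 \<noteq> ?q" "2 * u \<noteq> ?q" "2 * u - 1 \<noteq> ?r" "2 * u \<noteq> ?r"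
      by auto
    then show "(J(?p := x, ?q := y, ?r := z)) (2 * u - 1) = J (2 * u - 1) \<and>
       (J(?p := x, ?q := y, ?r := z)) (2 * u) = J (2 * u)" by simp
  qed auto
  let ?s = "\<lambda>I J. \<Sum>j\<in>UNIV. slot_at s (otimes (elem2 i j) V) I J *
      slot_at t (T j) I J * slots_off ({1..k} - {s, t}) X I J"
  have "(\<Sum>j\<in>UNIV. pol_pf k (X(s := otimes (elem2 i j) V, t := T j))) = contraction {1..2 * k} \<Phi>"
    unfolding pol_pf_update2[OF assms(1-3)] contraction_sum[symmetric]
  proof (rule contraction_cong)
    fix I J :: "'n multi_index"
    have "?s I J
       = (\<Sum>j\<in>UNIV. if j = J (2 * s - 1) then \<Phi> I J else 0)"
      by (intro sum.cong refl) (auto simp: otimes_def elem2_def \<Phi>_def)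
    then show "?s I J = \<Phi> I J"
      by simp
  qed
  also have "\<dots> = 0"
  proof (rule contraction_cyclic[of _ ?p ?q ?r])
    fix I J :: "'n multi_index"
    let ?c = "(if I (2 * s - 1) = i then 1 else 0) * V (J (2 * s)) (I (2 * s)) * slots_off ({1..k} - {s, t}) X I J"
    let ?T = "\<lambda>a b c. T a b c (I (2 * t - 1)) (I (2 * t))"
    have "\<Phi> I J + \<Phi> I (J(?p := J ?q, ?q := J ?r, ?r := J ?p)) + \<Phi> I (J(?p := J ?r, ?q := J ?p, ?r := J ?q))
      = ?c * (?T (J ?p) (J ?q) (J ?r) + ?T (J ?q) (J ?r) (J ?p) + ?T (J ?r) (J ?p) (J ?q))"
      unfolding \<Phi>_def r using n by (simp add: algebra_simps)
    then show "\<Phi> I J + \<Phi> I (J(?p := J ?q, ?q := J ?r, ?r := J ?p)) + \<Phi> I (J(?p := J ?r, ?q := J ?p, ?r := J ?q)) = 0"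
      unfolding cyc by simp
  qed (use assms n in auto)
  finally show ?thesis .
qed

lemma slot_of_position:
  fixes p :: nat
  assumes "p \<in> {1..2 * k}"
  obtains s where "s \<in> {1..k}" "p = 2 * s - 1 \<or> p = 2 * s"
proof
  show "(p + 1) div 2 \<in> {1..k}" "p = 2 * ((p + 1) div 2) - 1 \<or> p = 2 * ((p + 1) div 2)"
    using assms by auto
qed

lemma pol_pf_permute:
  assumes "f permutes {1..k}"
  shows "pol_pf k (\<lambda>s. X (f s)) = pol_pf k X"
proof -
  define \<phi> where "\<phi> f p = (if p \<in> {1..2 * k} then 2 * f ((p + 1) div 2) - p mod 2 else p)" for f :: "nat \<Rightarrow> nat" and p
  have im: "f s \<in> {1..k}" if "f permutes {1..k}" "s \<in> {1..k}" for f s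
    using permutes_in_image[OF that(1)] that(2) by blast
  have \<phi>: "\<phi> f (2 * s - 1) = 2 * f s - 1" "\<phi> f (2 * s) = 2 * f s"
    if "f permutes {1..k}" "s \<in> {1..k}" for f s
  proof -
    have "s \<ge> 1" "s \<le> k" using that by auto
    moreover have "(2 * s - 1) mod 2 = 1" using \<open>s \<ge> 1\<close> by presburger
    ultimately have "(2 * s - 1) mod 2 = 1" "2 * s - 1 \<in> {1..2*k}" "2 * s \<in> {1..2*k}" "(2 * s - 1 + 1) div 2 = s"
      by auto
    then show "\<phi> f (2 * s - 1) = 2 * f s - 1" "\<phi> f (2 * s) = 2 * f s"
      unfolding \<phi>_def by auto
  qed
  have inv: "\<phi> g (\<phi> f p) = p" if f: "f permutes {1..k}" and g: "g permutes {1..k}"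
    and gf: "\<And>s. g (f s) = s" and p: "p \<in> {1..2 * k}" for f g p
    using slot_of_position[OF p] by (metis \<phi> f g gf im)
  have range: "\<phi> f p \<in> {1..2 * k}" if f: "f permutes {1..k}" and p: "p \<in> {1..2 * k}" for f p
  proof -
    obtain s where s: "s \<in> {1..k}" "p = 2 * s - 1 \<or> p = 2 * s" using slot_of_position[OF p] .
    then show ?thesis using im[OF f s(1)] \<phi>[OF f s(1)] by auto
  qed
  note f = assms permutes_inv[OF assms]
  have "bij_betw (\<phi> f) {1..2 * k} {1..2 * k}"
    using inv[OF f(1,2)] inv[OF f(2,1)] range[OF f(1)] range[OF f(2)] permutes_inverses[OF f(1)]
    by (intro bij_betw_byWitness[where f'="\<phi> (inv f)"]) blast+
  then have p: "\<phi> f permutes {1..2 * k}"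
    by (rule bij_imp_permutes) (unfold \<phi>_def, rule if_not_P)
  have "pol_pf k X = contraction {1..2 * k} (\<lambda>I J. \<Prod>s=1..k. slot_at s (X (f s)) (I \<circ> \<phi> f) (J \<circ> \<phi> f))"
    unfolding pol_pf_def
  proof (rule contraction_cong)
    fix I J :: "'a multi_index"
    have "(\<Prod>s=1..k. slot_at s (X s) I J) =
      (\<Prod>s=1..k. X (f s) (J (2 * f s - 1)) (J (2 * f s)) (I (2 * f s - 1)) (I (2 * f s)))"
      by (rule prod.permute[OF assms, unfolded o_def])
    also have "\<dots> = (\<Prod>s=1..k. slot_at s (X (f s)) (I \<circ> \<phi> f) (J \<circ> \<phi> f))"
      by (rule prod.cong[OF refl]) (simp only: o_def \<phi>[OF assms])
    finally show "(\<Prod>s=1..k. slot_at s (X s) I J) = \<dots>" .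
  qed
  also have "\<dots> = pol_pf k (\<lambda>s. X (f s))"
    unfolding pol_pf_def
    by (rule contraction_permute[OF finite_atLeastAtMost p, where \<Phi>="\<lambda>I J. \<Prod>s=1..k. slot_at s (X (f s)) I J"])
  finally show ?thesis ..
qed

lemma permutes_between_subsets:
  assumes "finite B" "T \<subseteq> B" "T' \<subseteq> B" "card T = card T'"
  obtains f where "f permutes B" "\<And>s. s \<in> B \<Longrightarrow> f s \<in> T' \<longleftrightarrow> s \<in> T"
proof -
  have fin: "finite T" "finite T'" using assms finite_subset by auto
  obtain g where g: "bij_betw g T T'"
    using finite_same_card_bij[OF fin assms(4)] by blast
  have "card (B - T) = card (B - T')" using assms fin by (simp add: card_Diff_subset)
  then obtain h where h: "bij_betw h (B - T) (B - T')"
    using finite_same_card_bij assms(1) by (metis finite_Diff)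
  let ?f = "\<lambda>s. if s \<in> B then (if s \<in> T then g s else h s) else s"
  have "bij_betw (\<lambda>s. if s \<in> T then g s else h s) (T \<union> (B - T)) (T' \<union> (B - T'))"
    by (rule bij_betw_disjoint_Un[OF g h]) auto
  then have "bij_betw (\<lambda>s. if s \<in> T then g s else h s) B B"
    using assms by (simp add: Un_absorb1 Un_Diff_cancel)
  then have "bij_betw ?f B B" by (rule bij_betw_cong[THEN iffD1, rotated]) auto
  then have "?f permutes B" by (rule bij_imp_permutes) auto
  moreover have "?f s \<in> T' \<longleftrightarrow> s \<in> T" if "s \<in> B" for s
    using that g h by (auto dest: bij_betwE)
  ultimately show ?thesis by (rule that)
qed

text \<open>
  By symmetry in the slots, the value depends only on the number of slots of \<open>B\<close> that are filled
  with \<open>W\<close>.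
\<close>

lemma pol_pf_choice:
  assumes "B \<subseteq> {1..k}" "T \<subseteq> B" "T' \<subseteq> B" "card T = card T'"
  shows "pol_pf k (\<lambda>s. if s \<in> T then W else if s \<in> B then P else X s) =
         pol_pf k (\<lambda>s. if s \<in> T' then W else if s \<in> B then P else X s)"
proof -
  obtain f where f: "f permutes B" "\<And>s. s \<in> B \<Longrightarrow> f s \<in> T' \<longleftrightarrow> s \<in> T"
    using permutes_between_subsets[OF finite_subset[OF assms(1) finite_atLeastAtMost] assms(2-4)] by blast
  have fk: "f permutes {1..k}" using f(1) assms(1) permutes_subset by blast
  have "(\<lambda>s. if f s \<in> T' then W else if f s \<in> B then P else X (f s)) =
    (\<lambda>s. if s \<in> T then W else if s \<in> B then P else X s)"
    using f assms by (auto simp: fun_eq_iff permutes_in_image permutes_not_in)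
  then show ?thesis using pol_pf_permute[OF fk, of "\<lambda>s. if s \<in> T' then W else if s \<in> B then P else X s"]
    by simp
qed

section \<open>Invariance under endomorphisms\<close>

text \<open>
  The action of the endomorphism \<open>B\<close> on tensors \<open>U\<^sub>a\<^sup>c\<close>, where \<open>B c e\<close> has upper index \<open>c\<close> and lower
  index \<open>e\<close>.  For the Christoffel symbols this is the algebraic part of the covariant derivative.
\<close>

definition act2 :: "'n::finite array2 \<Rightarrow> 'n array2 \<Rightarrow> 'n array2" where
  "act2 B U a c = (\<Sum>e\<in>UNIV. B c e * U a e - B e a * U e c)"

text \<open>
  The same action on tensors \<open>T\<^sub>a\<^sub>b\<^sup>c\<^sup>d\<close>.
\<close>

definition act4 :: "'n::finite array2 \<Rightarrow> 'n array4 \<Rightarrow>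
    'n array4" where
  "act4 B T a b c d = (\<Sum>e\<in>UNIV. B c e * T a b e d - B e a * T e b c d)
     + (\<Sum>e\<in>UNIV. B d e * T a b c e - B e b * T a e c d)"

lemma act4_otimes:
  "act4 B (otimes U V) a b c d = otimes (act2 B U) V a b c d + otimes U (act2 B V) a b c d"
  by (simp add: act4_def act2_def otimes_def sum_distrib_left sum_distrib_right algebra_simps)

lemma sum_positions:
  fixes g :: "nat \<Rightarrow> real"
  shows "(\<Sum>p\<in>{1..2 * k}. g p) = (\<Sum>s=1..k. g (2 * s - 1) + g (2 * s))"
  by (induction k) simp_all

lemma pol_pf_derivation:
  "(\<Sum>s=1..k. pol_pf k (X(s := act4 B (X s)))) = 0"
proof -
  define \<Phi> where "\<Phi> I J = (\<Prod>s=1..k. slot_at s (X s) I J)" for I J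
  define g where "g p I J = (\<Sum>e\<in>UNIV. B (I p) e * \<Phi> (I(p := e)) J - B e (J p) * \<Phi> I (J(p := e)))" for p I J
  have "contraction {1..2 * k} (\<lambda>I J. g (2 * s - 1) I J + g (2 * s) I J) = pol_pf k (X(s := act4 B (X s)))"
    if s: "s \<in> {1..k}" for s
  proof -
    have split: "\<Phi> I J = slot_at s (X s) I J * slots_off ({1..k} - {s}) X I J" for I J
      unfolding \<Phi>_def slots_off_def by (subst prod.remove[OF _ s]) auto
    have u: "slots_off ({1..k} - {s}) X (I(p := e)) J = slots_off ({1..k} - {s}) X I J"
         "slots_off ({1..k} - {s}) X I (J(p := e)) = slots_off ({1..k} - {s}) X I J"
      if "p = 2 * s - 1 \<or> p = 2 * s" for p I J e
    proof -
      have "2 * r - 1 \<noteq> p \<and> 2 * r \<noteq> p" if "r \<in> {1..k} - {s}" for r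
      proof -
        have "r \<noteq> s" "1 \<le> r" "1 \<le> s" using that s by auto
        then show ?thesis using \<open>p = 2 * s - 1 \<or> p = 2 * s\<close> by auto
      qed
      then show "slots_off ({1..k} - {s}) X (I(p := e)) J = slots_off ({1..k} - {s}) X I J"
         "slots_off ({1..k} - {s}) X I (J(p := e)) = slots_off ({1..k} - {s}) X I J"
        by (auto intro!: slots_off_cong)
    qed
    have n: "2 * s - 1 \<noteq> 2 * s" using s by auto
    have "g (2 * s - 1) I J + g (2 * s) I J =
       slot_at s (act4 B (X s)) I J * slots_off ({1..k} - {s}) X I J" for I J
      using n unfolding g_def split act4_def
      by (simp add: u distrib_right sum_distrib_right left_diff_distrib mult.assoc del: One_nat_def)
    then show ?thesis unfolding pol_pf_update[OF s] by simp
  qed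
  then have "(\<Sum>s=1..k. pol_pf k (X(s := act4 B (X s)))) =
      contraction {1..2 * k} (\<lambda>I J. \<Sum>s=1..k. g (2 * s - 1) I J + g (2 * s) I J)"
    unfolding contraction_sum by (intro sum.cong) auto
  also have "\<dots> = contraction {1..2 * k} (\<lambda>I J. \<Sum>p\<in>{1..2 * k}. g p I J)"
    unfolding sum_positions ..
  also have "\<dots> = 0" unfolding g_def by (rule contraction_derivation) simp
  finally show ?thesis .
qed

text \<open>
  The identity \<open>\<delta>\<^sub>a\<^sup>c\<close>.
\<close>

definition kron :: "'n array2" where
  "kron a c = (if a = c then 1 else 0)"

text \<open>
  The mixed form of the Kulkarni--Nomizu product of \<open>U\<close> with the metric; with the Schouten tensor
  for \<open>U\<close> it is the difference of the Riemann and Weyl tensors.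
\<close>

definition kn_id :: "'n array2 \<Rightarrow> 'n array4" where
  "kn_id U a b c d = U a c * kron b d - U a d * kron b c + U b d * kron a c - U b c * kron a d"

text \<open>
  After antisymmetrization the four terms of the Kulkarni--Nomizu product agree.
\<close>

lemma pol_pf_kn_id:
  assumes "s \<in> {1..k}"
  shows "pol_pf k (X(s := kn_id U)) = 4 * pol_pf k (X(s := otimes U kron))"
proof -
  let ?T = "otimes U kron"
  have e: "kn_id U = (\<lambda>a b c d. (?T a b c d - ?T a b d c) + (?T b a d c - ?T b a c d))"
    by (simp add: fun_eq_iff kn_id_def otimes_def)
  show ?thesis unfolding e
    using pol_pf_swap_last[OF assms, of X ?T] pol_pf_swap_first[OF assms, of X ?T]
      pol_pf_swap_first[OF assms, of X "\<lambda>a b c d. ?T a b d c"]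
    by (simp add: pol_pf_add[OF assms] pol_pf_diff[OF assms])
qed

lemma sum_multi_indices_insert:
  fixes f :: "'n::finite multi_index \<Rightarrow> real"
  assumes "r \<notin> A"
  shows "(\<Sum>I\<in>multi_indices (insert r A). f I) = (\<Sum>I\<in>multi_indices A. \<Sum>e\<in>UNIV. f (I(r := e)))"
proof -
  have "(\<Sum>I\<in>multi_indices (insert r A). f I) = (\<Sum>(y, I)\<in>UNIV \<times> multi_indices A. f (I(r := y)))"
    unfolding PiE_insert_eq using inj_combinator[OF assms, of "\<lambda>_. UNIV"]
    by (subst sum.reindex) (auto simp: case_prod_unfold)
  also have "\<dots> = (\<Sum>y\<in>UNIV. \<Sum>I\<in>multi_indices A. f (I(r := y)))"
    by (simp add: sum.cartesian_product)
  also have "\<dots> = (\<Sum>I\<in>multi_indices A. \<Sum>e\<in>UNIV. f (I(r := e)))" by (rule sum.swap)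
  finally show ?thesis .
qed

section \<open>Exchange of index pairs\<close>

lemma sum_multi_indices_slots:
  fixes f :: "nat \<Rightarrow> 'n::finite array2"
  shows "(\<Sum>K\<in>multi_indices {1..2 * k}. \<Prod>s=1..k. f s (K (2 * s - 1)) (K (2 * s))) =
    (\<Prod>s=1..k. \<Sum>p\<in>UNIV. \<Sum>q\<in>UNIV. f s p q)"
proof (induction k)
  case (Suc k)
  let ?M = "multi_indices {1..2 * k} :: 'n multi_index set"
  have ins: "{1..2 * Suc k} = insert (2 * k + 2) (insert (2 * k + 1) {1..2 * k})" by auto
  have "(\<Sum>K\<in>multi_indices {1..2 * Suc k}. \<Prod>s=1..Suc k. f s (K (2 * s - 1)) (K (2 * s))) =
     (\<Sum>K\<in>?M. \<Sum>p\<in>UNIV. \<Sum>q\<in>UNIV. \<Prod>s=1..Suc k. f s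
        ((K(2 * k + 1 := p, 2 * k + 2 := q)) (2 * s - 1)) ((K(2 * k + 1 := p, 2 * k + 2 := q)) (2 * s)))"
    unfolding ins
    by (subst sum_multi_indices_insert, simp, subst sum_multi_indices_insert, simp, rule refl)
  also have "\<dots> = (\<Sum>K\<in>?M. \<Sum>p\<in>UNIV. \<Sum>q\<in>UNIV. (\<Prod>s=1..k. f s (K (2 * s - 1)) (K (2 * s))) * f (Suc k) p q)"
  proof (intro sum.cong refl)
    fix K :: "'n multi_index" and p q
    have "(\<Prod>s=1..k. f s ((K(2 * k + 1 := p, 2 * k + 2 := q)) (2 * s - 1)) ((K(2 * k + 1 := p, 2 * k + 2 := q)) (2 * s)))
      = (\<Prod>s=1..k. f s (K (2 * s - 1)) (K (2 * s)))"
      by (intro prod.cong) auto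
    then show "(\<Prod>s=1..Suc k. f s
        ((K(2 * k + 1 := p, 2 * k + 2 := q)) (2 * s - 1)) ((K(2 * k + 1 := p, 2 * k + 2 := q)) (2 * s)))
       = (\<Prod>s=1..k. f s (K (2 * s - 1)) (K (2 * s))) * f (Suc k) p q" by simp
  qed
  also have "\<dots> = (\<Prod>s=1..Suc k. \<Sum>p\<in>UNIV. \<Sum>q\<in>UNIV. f s p q)"
    unfolding sum_distrib_left[symmetric] sum_distrib_right[symmetric] Suc.IH by simp
  finally show ?case .
qed simp

lemma prod_positions:
  fixes g :: "nat \<Rightarrow> real"
  shows "(\<Prod>p\<in>{1..2 * k}. g p) = (\<Prod>s=1..k. g (2 * s - 1) * g (2 * s))"
  by (induction k) simp_all

text \<open>
  Contracting the lower indices of the delta with a symmetric form gives an array that is symmetric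
  under the exchange of its two multi-indices.
\<close>

lemma gdelta_form_symmetric:
  fixes h :: "'n::finite array2"
  assumes "finite A" and h: "\<And>a b. h a b = h b a"
  shows "(\<Sum>I\<in>multi_indices A. gdelta A I J * (\<Prod>s\<in>A. h (I s) (K s))) =
         (\<Sum>I\<in>multi_indices A. gdelta A I K * (\<Prod>s\<in>A. h (I s) (J s)))"
proof -
  have D: "(\<Sum>I\<in>multi_indices A. gdelta A I J * (\<Prod>s\<in>A. h (I s) (K s))) =
      (\<Sum>\<sigma> | \<sigma> permutes A. of_int (sign \<sigma>) * (\<Prod>s\<in>A. h (J (\<sigma> s)) (K s)))" for J K
  proof -
    have "(\<Sum>I\<in>multi_indices A. gdelta A I J * (\<Prod>s\<in>A. h (I s) (K s))) =
      (\<Sum>\<sigma> | \<sigma> permutes A. of_int (sign \<sigma>) * (\<Sum>I\<in>multi_indices A. \<Prod>s\<in>A.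
          (if I s = J (\<sigma> s) then 1 else 0) * h (I s) (K s)))"
      unfolding gdelta_def sum_distrib_left sum_distrib_right prod.distrib mult.assoc by (rule sum.swap)
    also have "\<dots> = (\<Sum>\<sigma> | \<sigma> permutes A. of_int (sign \<sigma>) * (\<Prod>s\<in>A. h (J (\<sigma> s)) (K s)))"
    proof (intro sum.cong refl arg_cong2[where f="(*)"])
      fix \<sigma> :: "nat \<Rightarrow> nat"
      have "(\<Sum>I\<in>multi_indices A. \<Prod>s\<in>A. (if I s = J (\<sigma> s) then 1 else 0) * h (I s) (K s)) =
         (\<Prod>s\<in>A. \<Sum>e\<in>UNIV. (if e = J (\<sigma> s) then 1 else 0) * h e (K s))"
        by (rule prod_sum_PiE[symmetric]) (use assms in auto)
      also have "\<dots> = (\<Prod>s\<in>A. h (J (\<sigma> s)) (K s))"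
        by (intro prod.cong refl) (simp add: if_distrib[of "\<lambda>x. x * _"] cong: if_cong)
      finally show "(\<Sum>I\<in>multi_indices A. \<Prod>s\<in>A. (if I s = J (\<sigma> s) then 1 else 0) * h (I s) (K s)) =
         (\<Prod>s\<in>A. h (J (\<sigma> s)) (K s))" .
    qed
    finally show ?thesis .
  qed
  have "(\<Sum>\<sigma> | \<sigma> permutes A. of_int (sign \<sigma>) * (\<Prod>s\<in>A. h (J (\<sigma> s)) (K s))) =
     (\<Sum>\<sigma> | \<sigma> permutes A. of_int (sign (inv \<sigma>)) * (\<Prod>s\<in>A. h (J (inv \<sigma> s)) (K s)))"
    by (rule sum_permutations_inverse)
  also have "\<dots> = (\<Sum>\<sigma> | \<sigma> permutes A. of_int (sign \<sigma>) * (\<Prod>s\<in>A. h (K (\<sigma> s)) (J s)))"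
  proof (intro sum.cong refl arg_cong2[where f="(*)"])
    fix \<sigma> assume "\<sigma> \<in> {\<sigma>. \<sigma> permutes A}"
    then have s: "\<sigma> permutes A" by simp
    show "real_of_int (sign (inv \<sigma>)) = real_of_int (sign \<sigma>)"
      using s assms permutation_permutes sign_inverse by metis
    have "(\<Prod>s\<in>A. h (J (inv \<sigma> s)) (K s)) = (\<Prod>s\<in>A. h (J (inv \<sigma> (\<sigma> s))) (K (\<sigma> s)))"
      by (rule prod.permute[OF s, unfolded o_def])
    also have "\<dots> = (\<Prod>s\<in>A. h (K (\<sigma> s)) (J s))"
      using s h by (intro prod.cong) (auto simp: permutes_inverses)
    finally show "(\<Prod>s\<in>A. h (J (inv \<sigma> s)) (K s)) = (\<Prod>s\<in>A. h (K (\<sigma> s)) (J s))" .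
  qed
  finally show ?thesis unfolding D .
qed

text \<open>
  If all slots arise by raising the last two indices with a symmetric form \<open>h\<close>, the first and last
  index pairs of all slots may be exchanged simultaneously.
\<close>

lemma pol_pf_pair_symmetric:
  fixes h :: "'n::finite array2"
  assumes h: "\<And>a b. h a b = h b a"
  defines "up \<equiv> \<lambda>T a b c d. \<Sum>p\<in>UNIV. \<Sum>q\<in>UNIV. h c p * h d q * T a b p q"
  shows "pol_pf k (\<lambda>s. up (L s)) = pol_pf k (\<lambda>s. up (\<lambda>a b c d. L s c d a b))"
proof -
  let ?A = "{1..2 * k}"
  let ?M = "multi_indices ?A :: 'n multi_index set"
  define D where "D J K = (\<Sum>I\<in>?M. gdelta ?A I J * (\<Prod>s\<in>?A. h (I s) (K s)))" for J K
  have D: "D J K = D K J" for J K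
    unfolding D_def by (rule gdelta_form_symmetric[OF finite_atLeastAtMost h])
  have *: "pol_pf k (\<lambda>s. up (L s)) = (\<Sum>J\<in>?M. \<Sum>K\<in>?M. D J K *
      (\<Prod>s=1..k. slot_at s (L s) K J))" for L
  proof -
    have "(\<Prod>s=1..k. slot_at s (up (L s)) I J) =
      (\<Sum>K\<in>?M. (\<Prod>s\<in>?A. h (I s) (K s)) * (\<Prod>s=1..k. slot_at s (L s) K J))"
      for I J
      unfolding up_def sum_multi_indices_slots[symmetric] prod_positions prod.distrib ..
    then have "pol_pf k (\<lambda>s. up (L s)) = (\<Sum>I\<in>?M. \<Sum>J\<in>?M. \<Sum>K\<in>?M. gdelta ?A I J * (\<Prod>s\<in>?A. h (I s) (K s)) *
      (\<Prod>s=1..k. slot_at s (L s) K J))"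
      unfolding pol_pf_def contraction_def by (simp only: sum_distrib_left mult.assoc)
    also have "\<dots> = (\<Sum>J\<in>?M. \<Sum>K\<in>?M. \<Sum>I\<in>?M. gdelta ?A I J * (\<Prod>s\<in>?A. h (I s) (K s)) *
      (\<Prod>s=1..k. slot_at s (L s) K J))"
      by (subst sum.swap, rule sum.cong[OF refl], rule sum.swap)
    finally show ?thesis unfolding D_def sum_distrib_right .
  qed
  show ?thesis unfolding * by (subst sum.swap) (simp only: D)
qed

section \<open>Contraction with identities\<close>

lemma contraction_trace:
  fixes \<Phi> :: "'n::finite multi_index \<Rightarrow> 'n multi_index \<Rightarrow> real"
  assumes "finite A" "r \<notin> A" and dep: "\<And>I J a b. \<Phi> (I(r := a)) (J(r := b)) = \<Phi> I J"
  shows "contraction (insert r A) (\<lambda>I J. kron (J r) (I r) * \<Phi> I J) =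
    (real CARD('n) - real (card A)) * contraction A \<Phi>"
proof -
  let ?M = "multi_indices A :: (nat \<Rightarrow> 'n) set"
  have "contraction (insert r A) (\<lambda>I J. kron (J r) (I r) * \<Phi> I J) =
    (\<Sum>I\<in>?M. \<Sum>a\<in>UNIV. \<Sum>J\<in>?M. \<Sum>b\<in>UNIV.
       gdelta (insert r A) (I(r := a)) (J(r := b)) * (kron b a * \<Phi> I J))"
    unfolding contraction_def sum_multi_indices_insert[OF assms(2)] by (simp add: dep)
  also have "\<dots> = (\<Sum>I\<in>?M. \<Sum>a\<in>UNIV. \<Sum>J\<in>?M.
       gdelta (insert r A) (I(r := a)) (J(r := a)) * \<Phi> I J)"
    by (simp add: kron_def if_distrib[of "\<lambda>x. _ * x"] if_distrib[of "\<lambda>x. x * _"] cong: if_cong)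
  also have "\<dots> = (\<Sum>I\<in>?M. \<Sum>J\<in>?M.
       (\<Sum>a\<in>UNIV. gdelta (insert r A) (I(r := a)) (J(r := a))) * \<Phi> I J)"
    unfolding sum_distrib_right by (rule sum.cong[OF refl], rule sum.swap)
  finally show ?thesis
    unfolding gdelta_contract[OF assms(1,2)] by (simp add: contraction_def sum_distrib_left mult.assoc)
qed

lemma contraction_traces:
  fixes \<Phi> :: "'n::finite multi_index \<Rightarrow> 'n multi_index \<Rightarrow> real"
  assumes "finite A" "finite D" "A \<inter> D = {}"
    and dep: "\<And>I J a b r. r \<in> D \<Longrightarrow> \<Phi> (I(r := a)) (J(r := b)) = \<Phi> I J"
  shows "contraction (A \<union> D) (\<lambda>I J. (\<Prod>r\<in>D. kron (J r) (I r)) * \<Phi> I J) =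
    (\<Prod>i=0..<card D. real CARD('n) - real (card A) - real i) * contraction A \<Phi>"
  using assms(2-4)
proof (induction D rule: finite_induct)
  case (insert r D)
  have "contraction (A \<union> insert r D) (\<lambda>I J. (\<Prod>r\<in>insert r D. kron (J r) (I r)) * \<Phi> I J) =
     contraction (insert r (A \<union> D)) (\<lambda>I J. kron (J r) (I r) * ((\<Prod>r\<in>D. kron (J r) (I r)) * \<Phi> I J))"
    using insert.hyps by (simp add: mult.assoc)
  also have "\<dots> = (real CARD('n) - real (card (A \<union> D))) * contraction (A \<union> D) (\<lambda>I J. (\<Prod>r\<in>D. kron (J r) (I r)) * \<Phi> I J)"
  proof (rule contraction_trace)
    show "finite (A \<union> D)" "r \<notin> A \<union> D" using assms insert by auto
    fix I J :: "'n multi_index" and a b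
    have "(\<Prod>u\<in>D. kron ((J(r := b)) u) ((I(r := a)) u)) = (\<Prod>u\<in>D. kron (J u) (I u))"
      using insert.hyps by (intro prod.cong) auto
    then show "(\<Prod>u\<in>D. kron ((J(r := b)) u) ((I(r := a)) u)) * \<Phi> (I(r := a)) (J(r := b)) =
      (\<Prod>u\<in>D. kron (J u) (I u)) * \<Phi> I J"
      by (simp only: insert.prems(2)[OF insertI1])
  qed
  also have "contraction (A \<union> D) (\<lambda>I J. (\<Prod>r\<in>D. kron (J r) (I r)) * \<Phi> I J) =
      (\<Prod>i=0..<card D. real CARD('n) - real (card A) - real i) * contraction A \<Phi>"
    using insert by auto
  also have "card (A \<union> D) = card A + card D"
    using assms insert by (intro card_Un_disjoint) auto
  finally show ?case using insert.hyps by (simp add: algebra_simps)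
qed simp

text \<open>
  A delta on fewer than \<open>n\<close> positions can be extended to one on \<open>n\<close> positions by inserting
  identities on the additional positions \<open>D\<close>; their contraction gives the factor \<open>(card D)!\<close>.
\<close>

lemma contraction_full:
  fixes \<Phi> :: "'n::finite multi_index \<Rightarrow> 'n multi_index \<Rightarrow> real"
  assumes "finite A" "finite D" "A \<inter> D = {}" "card A + card D = CARD('n)"
    and dep: "\<And>I J a b r. r \<in> D \<Longrightarrow> \<Phi> (I(r := a)) (J(r := b)) = \<Phi> I J"
  shows "contraction (A \<union> D) (\<lambda>I J. (\<Prod>r\<in>D. kron (J r) (I r)) * \<Phi> I J) = fact (card D) * contraction A \<Phi>"
proof -
  have "real CARD('n) - real (card A) = real (card D)" using assms(4) by linarith
  moreover have "(\<Prod>i=0..<card D. real (card D) - real i) = fact (card D)"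
    unfolding fact_prod_rev of_nat_prod by (intro prod.cong) auto
  ultimately show ?thesis using contraction_traces[OF assms(1-3), of \<Phi>] dep by simp
qed

text \<open>
  Inserting the elementary endomorphism at a position fixes both multi-indices there.
\<close>

lemma contraction_elem2:
  fixes \<Phi> :: "'n::finite multi_index \<Rightarrow> 'n multi_index \<Rightarrow> real"
  assumes "r \<notin> A" and dep: "\<And>I J a b. \<Phi> (I(r := a)) (J(r := b)) = \<Phi> I J"
  shows "contraction (insert r A) (\<lambda>I J. elem2 i j (J r) (I r) * \<Phi> I J) =
    (\<Sum>I\<in>multi_indices A. \<Sum>J\<in>multi_indices A. gdelta (insert r A) (I(r := i)) (J(r := j)) * \<Phi> I J)"
proof -
  have "contraction (insert r A) (\<lambda>I J. elem2 i j (J r) (I r) * \<Phi> I J) =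
    (\<Sum>I\<in>multi_indices A. \<Sum>a\<in>UNIV. \<Sum>J\<in>multi_indices A. \<Sum>b\<in>UNIV.
       gdelta (insert r A) (I(r := a)) (J(r := b)) * (elem2 i j b a * \<Phi> I J))"
    unfolding contraction_def sum_multi_indices_insert[OF assms(1)] by (simp add: dep)
  also have "\<dots> = (\<Sum>I\<in>multi_indices A. \<Sum>J\<in>multi_indices A. gdelta (insert r A) (I(r := i)) (J(r := j)) * \<Phi> I J)"
  proof (rule sum.cong[OF refl])
    fix I :: "'n multi_index"
    let ?g = "\<lambda>J a b. gdelta (insert r A) (I(r := a)) (J(r := b))"
    have "?g J a b * (elem2 i j b a * \<Phi> I J) =
       (if b = j then if a = i then ?g J a b * \<Phi> I J else 0 else 0)" for J a b
      by (simp add: elem2_def)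
    then have "(\<Sum>a\<in>UNIV. \<Sum>b\<in>UNIV. ?g J a b * (elem2 i j b a * \<Phi> I J)) = ?g J i j * \<Phi> I J" for J
      by simp
    then show "(\<Sum>a\<in>UNIV. \<Sum>J\<in>multi_indices A. \<Sum>b\<in>UNIV. ?g J a b * (elem2 i j b a * \<Phi> I J)) =
      (\<Sum>J\<in>multi_indices A. ?g J i j * \<Phi> I J)"
      by (subst sum.swap) simp
  qed
  finally show ?thesis .
qed

section \<open>The terms of \<open>\<Omega>\<close> as mixed Pfaffians\<close>

text \<open>
  The polarized Pfaffian with \<open>Z\<close> in the first slot, \<open>W\<close> in the next \<open>l\<close> slots and \<open>Q\<close> in the
  remaining ones.
\<close>

definition mixed_pf ::
    "nat \<Rightarrow> nat \<Rightarrow> 'n::finite array4 \<Rightarrow> 'n array4 \<Rightarrow>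
     'n array4 \<Rightarrow> real" where
  "mixed_pf k l Z W Q = pol_pf k (\<lambda>s. if s \<in> {2..l + 1} then W else if s \<in> {2..k} then Q else Z)"

text \<open>
  The term of index \<open>l\<close> in \<open>\<Omega>\<close> has its free indices at position 0, the Weyl tensors at positions
  \<open>1..2l\<close> and the Schouten tensors at \<open>2l + 1..k + l\<close>; the positions \<open>k + l + 1..2k - 1\<close> are added to it
  and filled with identities.  The function \<open>flat_position\<close> assigns to each of the \<open>2k\<close> positions of
  \<open>mixed_pf\<close> its place in this list: the first slot pairs the free position with a Schouten tensor,
  and the last \<open>k - l - 1\<close> slots pair a Schouten tensor with an identity.
\<close>

definition flat_position :: "nat \<Rightarrow> nat \<Rightarrow> nat \<Rightarrow> nat" where
  "flat_position k l p = (if p = 1 then 0 else if p = 2 then 2 * l + 1 else if p \<le> 2 * l + 2 then p - 2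
     else if odd p then l + (p + 1) div 2 else k + p div 2 - 1)"

lemma bij_flat_position:
  assumes "l < k"
  shows "bij_betw (flat_position k l) {1..2 * k} {0..2 * k - 1}"
proof -
  have 1: "flat_position k l ` {1..2 * k} \<subseteq> {0..2 * k - 1}"
    using assms by (auto simp: flat_position_def)
  have 2: "inj_on (flat_position k l) {1..2 * k}"
  proof (rule inj_on_inverseI)
    let ?u = "\<lambda>q. if q = 0 then 1 else if q = 2 * l + 1 then 2 else if q \<le> 2 * l then q + 2
       else if q \<le> k + l then 2 * (q - l) - 1 else 2 * (q + 1 - k)"
    fix p assume p: "p \<in> {1..2 * k}"
    consider "p \<le> 2 * l + 2" | m where "p > 2 * l + 2" "p = 2 * m + 1" | m where "p > 2 * l + 2" "p = 2 * m"
      by (metis not_less evenE oddE)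
    then show "?u (flat_position k l p) = p"
    proof cases
      case 1
      then show ?thesis using p by (auto simp: flat_position_def)
    next
      case (2 m)
      then have "flat_position k l p = l + m + 1" "2 * l < l + m + 1" "l + m + 1 \<noteq> 2 * l + 1" "l + m + 1 \<le> k + l"
        using p by (auto simp: flat_position_def)
      then show ?thesis using 2 by simp
    next
      case (3 m)
      then have "flat_position k l p = k + m - 1" "k + l < k + m - 1" using p assms by (auto simp: flat_position_def)
      then show ?thesis using 3 assms by auto
    qed
  qed
  have "card (flat_position k l ` {1..2 * k}) = card {0..2 * k - 1}"
    using card_image[OF 2] assms by simp
  then have "flat_position k l ` {1..2 * k} = {0..2 * k - 1}"
    using 1 by (intro card_subset_eq) auto
  then show ?thesis using 2 by (simp add: bij_betw_def)
qed

text \<open>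
  In dimension \<open>2k\<close> every term of \<open>\<Omega>\<close> is a value of the polarized Pfaffian.
\<close>

lemma Omega_term_eq_mixed_pf:
  fixes W :: "'n::finite array4"
  assumes "l < k" "CARD('n) = 2 * k"
  shows "mixed_pf k l (otimes (elem2 i j) P) W (otimes P kron) = fact (k - l - 1) *
    (\<Sum>I\<in>multi_indices {1..k+l}. \<Sum>J\<in>multi_indices {1..k+l}.
       gdelta {0..k+l} (I(0 := i)) (J(0 := j)) *
       (\<Prod>s=1..l. slot_at s W I J) *
       (\<Prod>s=2*l+1..k+l. P (J s) (I s)))"
proof -
  define \<Psi> where "\<Psi> I J = (\<Prod>s=1..l. slot_at s W I J) *
       (\<Prod>s=2*l+1..k+l. P (J s) (I s))" for I J :: "'n multi_index"
  define X where "X s = (if s \<in> {2..l + 1} then W else if s \<in> {2..k} then otimes P kron else otimes (elem2 i j) P)"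
    for s :: nat
  define \<Phi> where "\<Phi> I J = (\<Prod>s=1..k. slot_at s (X s) I J)"
    for I J
  let ?\<rho> = "flat_position k l" and ?D = "{k+l+1..2*k-1}"
  have \<Psi>_dep: "\<Psi> (I(r := a)) (J(r := b)) = \<Psi> I J" if "r = 0 \<or> k + l < r" for I J r a b
  proof -
    have "(\<Prod>s=1..l. slot_at s W (I(r := a)) (J(r := b)))
      = (\<Prod>s=1..l. slot_at s W I J)"
    proof (rule prod.cong[OF refl])
      fix s assume "s \<in> {1..l}"
      then have "2 * s \<noteq> r" "2 * s - 1 \<noteq> r" using that assms by auto
      then show "slot_at s W (I(r := a)) (J(r := b))
        = slot_at s W I J" by simp
    qed
    moreover have "(\<Prod>s=2*l+1..k+l. P ((J(r := b)) s) ((I(r := a)) s)) = (\<Prod>s=2*l+1..k+l. P (J s) (I s))"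
      using that by (intro prod.cong) auto
    ultimately show ?thesis unfolding \<Psi>_def by simp
  qed
  have "(\<Sum>I\<in>multi_indices {1..k+l}. \<Sum>J\<in>multi_indices {1..k+l}.
       gdelta {0..k+l} (I(0 := i)) (J(0 := j)) * \<Psi> I J) =
     contraction {0..k+l} (\<lambda>I J. elem2 i j (J 0) (I 0) * \<Psi> I J)"
  proof -
    have "{0..k+l} = insert 0 {1..k+l}" by auto
    then show ?thesis using contraction_elem2[of 0 "{1..k+l}" \<Psi> i j] \<Psi>_dep by simp
  qed
  also have "fact (k - l - 1) * \<dots> =
      contraction ({0..k+l} \<union> ?D) (\<lambda>I J. (\<Prod>r\<in>?D. kron (J r) (I r)) * (elem2 i j (J 0) (I 0) * \<Psi> I J))"
  proof -
    have "card ?D = k - l - 1" using assms by simp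
    moreover have "elem2 i j ((J(r := b)) 0) ((I(r := a)) 0) * \<Psi> (I(r := a)) (J(r := b)) = elem2 i j (J 0) (I 0) * \<Psi> I J"
      if "r \<in> ?D" for I J r a b
      using that \<Psi>_dep[of r I a J b] by auto
    ultimately show ?thesis using assms
      by (subst contraction_full) auto
  qed
  also have "{0..k+l} \<union> ?D = {0..2*k-1}" using assms by auto
  also have "contraction {0..2*k-1} (\<lambda>I J. (\<Prod>r\<in>?D. kron (J r) (I r)) * (elem2 i j (J 0) (I 0) * \<Psi> I J)) =
     contraction {0..2*k-1} (\<lambda>I J. \<Phi> (I \<circ> ?\<rho>) (J \<circ> ?\<rho>))"
  proof (rule contraction_cong)
    fix I J :: "'n multi_index"
    let ?F = "\<lambda>s. X s (J (?\<rho> (2 * s - 1))) (J (?\<rho> (2 * s))) (I (?\<rho> (2 * s - 1))) (I (?\<rho> (2 * s)))"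
    have split: "{1..k} = {1} \<union> ({2..l+1} \<union> {l+2..k})" using assms by auto
    have "prod ?F {1..k} = ?F 1 * (prod ?F {2..l+1} * prod ?F {l+2..k})"
      unfolding split by (subst prod.union_disjoint, simp, simp, simp, subst prod.union_disjoint) auto
    also have "?F 1 = elem2 i j (J 0) (I 0) * P (J (2 * l + 1)) (I (2 * l + 1))"
      by (simp add: X_def otimes_def flat_position_def)
    also have "prod ?F {2..l+1} = (\<Prod>s=1..l. slot_at s W I J)"
    proof -
      have "?F (s + 1) = slot_at s W I J" if "s \<in> {1..l}" for s
      proof -
        have "?\<rho> (2 * (s + 1) - 1) = 2 * s - 1" "?\<rho> (2 * (s + 1)) = 2 * s" "X (s + 1) = W"
          using that by (auto simp: flat_position_def X_def)
        then show ?thesis by (simp only:)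
      qed
      then have "prod (\<lambda>s. ?F (s + 1)) {1..l} = (\<Prod>s=1..l. slot_at s W I J)"
        by (rule prod.cong[OF refl])
      then show ?thesis using prod.shift_bounds_cl_nat_ivl[of ?F 1 1 l] by (simp only: one_add_one)
    qed
    also have "prod ?F {l+2..k} = (\<Prod>s=l+2..k. P (J (l + s)) (I (l + s)) * kron (J (k + s - 1)) (I (k + s - 1)))"
      by (rule prod.cong[OF refl]) (auto simp: X_def flat_position_def otimes_def)
    also have "\<dots> = (\<Prod>s=l+2..k. P (J (l + s)) (I (l + s))) * (\<Prod>s=l+2..k. kron (J (k + s - 1)) (I (k + s - 1)))"
      by (rule prod.distrib)
    also have "(\<Prod>s=l+2..k. P (J (l + s)) (I (l + s))) = (\<Prod>s=2*l+2..k+l. P (J s) (I s))"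
      by (rule prod.reindex_bij_witness[where i="\<lambda>s. s - l" and j="\<lambda>s. s + l"]) (auto simp: add.commute)
    also have "(\<Prod>s=l+2..k. kron (J (k + s - 1)) (I (k + s - 1))) = (\<Prod>r\<in>?D. kron (J r) (I r))"
      by (rule prod.reindex_bij_witness[where i="\<lambda>r. r + 1 - k" and j="\<lambda>s. k + s - 1"]) auto
    finally have "\<Phi> (I \<circ> ?\<rho>) (J \<circ> ?\<rho>) = elem2 i j (J 0) (I 0) * P (J (2 * l + 1)) (I (2 * l + 1)) *
       ((\<Prod>s=1..l. slot_at s W I J) *
        ((\<Prod>s=2*l+2..k+l. P (J s) (I s)) * (\<Prod>r\<in>?D. kron (J r) (I r))))"
      by (simp add: \<Phi>_def)
    moreover have "(\<Prod>s=2*l+1..k+l. P (J s) (I s)) = P (J (2 * l + 1)) (I (2 * l + 1)) * (\<Prod>s=2*l+2..k+l. P (J s) (I s))"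
      using assms by (subst prod.atLeast_Suc_atMost) auto
    ultimately show "(\<Prod>r\<in>?D. kron (J r) (I r)) * (elem2 i j (J 0) (I 0) * \<Psi> I J) = \<Phi> (I \<circ> ?\<rho>) (J \<circ> ?\<rho>)"
      by (simp add: \<Psi>_def)
  qed
  also have "\<dots> = contraction {1..2 * k} \<Phi>"
  proof (rule contraction_reindex[OF finite_atLeastAtMost bij_flat_position[OF assms(1)]])
    fix I J I' J' :: "'n multi_index"
    assume *: "\<And>s. s \<in> {1..2 * k} \<Longrightarrow> I s = I' s" "\<And>s. s \<in> {1..2 * k} \<Longrightarrow> J s = J' s"
    show "\<Phi> I J = \<Phi> I' J'" unfolding \<Phi>_def
    proof (rule prod.cong[OF refl])
      fix s assume "s \<in> {1..k}"
      then have "2 * s - 1 \<in> {1..2 * k}" "2 * s \<in> {1..2 * k}" by auto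
      then show "slot_at s (X s) I J =
        slot_at s (X s) I' J'" using * by simp
    qed
  qed
  also have "\<dots> = mixed_pf k l (otimes (elem2 i j) P) W (otimes P kron)"
    by (simp only: \<Phi>_def[abs_def] pol_pf_def mixed_pf_def X_def[abs_def])
  finally show ?thesis unfolding \<Psi>_def mult.assoc[symmetric] ..
qed

section \<open>Divergence and trace of sums of mixed Pfaffians\<close>

lemma mixed_pf_insert_first:
  assumes "1 \<le> k"
  shows "mixed_pf k l Z W Q = pol_pf k ((\<lambda>s. if s \<in> {2..l + 1} then W else Q)(1 := Z))"
  unfolding mixed_pf_def using assms by (intro pol_pf_cong) auto

text \<open>
  In the applications \<open>D\<close> is the covariant derivative of the Schouten tensor, and
  \<open>D a b d - D b a d\<close> is the Cotton tensor.
\<close>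

lemma sum_pol_pf_elem2:
  fixes D :: "'n::finite \<Rightarrow> 'n array2"
  assumes "s \<in> {1..k}"
  shows "(\<Sum>j\<in>UNIV. pol_pf k (X(s := otimes (elem2 i j) (D j)))) =
    1 / 2 * pol_pf k (X(s := \<lambda>a b c d. (if c = i then 1 else 0) * (D a b d - D b a d)))"
proof -
  let ?T = "\<lambda>a b c d. (if c = i then 1 else 0) * D a b d"
  have "(\<Sum>j\<in>UNIV. otimes (elem2 i j) (D j) a b c d) = ?T a b c d" for a b c d
  proof -
    have "(\<Sum>j\<in>UNIV. otimes (elem2 i j) (D j) a b c d) = (\<Sum>j\<in>UNIV. if j = a then ?T a b c d else 0)"
      by (intro sum.cong refl) (auto simp: otimes_def elem2_def)
    then show ?thesis by simp
  qed
  then have "(\<Sum>j\<in>UNIV. pol_pf k (X(s := otimes (elem2 i j) (D j)))) = pol_pf k (X(s := ?T))"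
    unfolding pol_pf_sum[OF assms, symmetric] by simp
  moreover have "pol_pf k (X(s := \<lambda>a b c d. (if c = i then 1 else 0) * (D a b d - D b a d))) =
      pol_pf k (X(s := \<lambda>a b c d. ?T a b c d - ?T b a c d))"
    by (simp add: right_diff_distrib)
  ultimately show ?thesis
    using pol_pf_swap_first[OF assms, of X ?T] pol_pf_diff[OF assms, of X ?T "\<lambda>a b c d. ?T b a c d"] by simp
qed

text \<open>
  The heart of the argument.  In the sum over \<open>s\<close>, the Leibniz rule differentiates one slot of each
  term of \<open>\<Omega>\<close> at a time.  A derivative of a Schouten tensor contributes half a Cotton tensor to the
  first slot.  A derivative of a Weyl tensor is, by the Bianchi identity, minus the derivative of the
  Kulkarni--Nomizu part, hence contributes minus two Cotton tensors to the first slot and replaces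
  the Weyl tensor by \<open>P\<close> paired with an identity.  The resulting sum over \<open>l\<close> telescopes.
\<close>

lemma divergence_telescope:
  fixes W :: "'n::finite array4" and P :: "'n array2"
    and DW :: "'n \<Rightarrow> 'n array4" and DP :: "'n \<Rightarrow> 'n array2"
  assumes k: "1 \<le> k"
  assumes bianchi: "\<And>m a b c d. (DW m a b c d + kn_id (DP m) a b c d) + (DW a b m c d + kn_id (DP a) b m c d)
      + (DW b m a c d + kn_id (DP b) m a c d) = 0"
  defines "X \<equiv> \<lambda>l i j s. if s \<in> {2..l + 1} then W else if s \<in> {2..k} then otimes P kron else otimes (elem2 i j) P"
    and "DX \<equiv> \<lambda>l i j m s. if s \<in> {2..l + 1} then DW m else if s \<in> {2..k} then otimes (DP m) kron
       else otimes (elem2 i j) (DP m)"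
    and "Z \<equiv> \<lambda>i a b c d. (if c = i then 1 else 0) * (DP a b d - DP b a d)"
  shows "(\<Sum>l=0..k-1. 4^(k-l) / (fact l * fact (k-l)) *
      (\<Sum>j\<in>UNIV. \<Sum>s=1..k. pol_pf k ((X l i j)(s := DX l i j j s)))) =
    2 / fact (k - 1) * mixed_pf k (k - 1) (Z i) W (otimes P kron)"
proof -
  let ?p = "otimes P kron"
  \<comment> \<open>With a Cotton tensor in the first slot, \<open>M l\<close> has \<open>l\<close> Weyl tensors.\<close>
  define M where "M l = mixed_pf k l (Z i) W ?p" for l
  define Y where "Y l s = (if s \<in> {2..l + 1} then W else ?p)" for l s :: nat
  let ?E = "\<lambda>j. otimes (elem2 i j) P"
  have X: "pol_pf k ((X l i j)(s := T)) = pol_pf k ((Y l)(1 := ?E j, s := T))" for l j s T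
    unfolding X_def Y_def by (intro pol_pf_cong) auto
  have M: "M l = pol_pf k ((Y l)(1 := Z i))" for l
    unfolding M_def mixed_pf_insert_first[OF k] Y_def[abs_def] ..
  have one: "1 \<in> {1..k}" using k by simp
  have first: "(\<Sum>j\<in>UNIV. pol_pf k (V(1 := otimes (elem2 i j) (DP j)))) = 1 / 2 * pol_pf k (V(1 := Z i))" for V
    unfolding Z_def by (rule sum_pol_pf_elem2[OF one])
  have exch: "(\<Sum>j\<in>UNIV. pol_pf k (V(1 := ?E j, s := otimes (DP j) kron))) =
      1 / 2 * pol_pf k (V(1 := Z i, s := ?p))" if s: "s \<in> {2..k}" for V s
  proof -
    have s': "s \<in> {1..k}" "1 \<noteq> s" using s by auto
    have "(\<Sum>j\<in>UNIV. pol_pf k (V(1 := ?E j, s := otimes (DP j) kron))) =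
       (\<Sum>j\<in>UNIV. pol_pf k ((V(s := ?p))(1 := otimes (elem2 i j) (DP j))))"
      by (rule sum.cong[OF refl], subst pol_pf_exchange[OF one s']) (simp only: fun_upd_twist[OF s'(2)])
    also have "\<dots> = 1 / 2 * pol_pf k (V(1 := Z i, s := ?p))"
      unfolding first by (simp only: fun_upd_twist[OF s'(2)])
    finally show ?thesis .
  qed
  have slot1: "(\<Sum>j\<in>UNIV. pol_pf k ((X l i j)(1 := DX l i j j 1))) = 1 / 2 * M l" for l
  proof -
    have "(\<Sum>j\<in>UNIV. pol_pf k ((X l i j)(1 := DX l i j j 1))) =
       (\<Sum>j\<in>UNIV. pol_pf k ((Y l)(1 := otimes (elem2 i j) (DP j))))"
      unfolding X by (simp add: DX_def)
    then show ?thesis unfolding first M .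
  qed
  \<comment> \<open>The pairing with \<open>elem2\<close> moves to the differentiated factor; the Cotton tensor appears in slot 1.\<close>
  have slotP: "(\<Sum>j\<in>UNIV. pol_pf k ((X l i j)(s := DX l i j j s))) = 1 / 2 * M l" if s: "s \<in> {l+2..k}" for l s
  proof -
    have "(\<Sum>j\<in>UNIV. pol_pf k ((X l i j)(s := DX l i j j s))) = 1 / 2 * pol_pf k ((Y l)(1 := Z i, s := ?p))"
      unfolding X using exch[of s "Y l"] s by (simp add: DX_def)
    also have "(Y l)(1 := Z i, s := ?p) = (Y l)(1 := Z i)"
      using s by (auto simp: fun_eq_iff Y_def)
    finally show ?thesis unfolding M .
  qed
  \<comment> \<open>One Weyl tensor is lost, hence \<open>M (l - 1)\<close>; such slots exist only for \<open>l > 0\<close>.\<close>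
  have slotW: "(\<Sum>j\<in>UNIV. pol_pf k ((X l i j)(s := DX l i j j s))) = - 2 * M (l - 1)"
    if s: "s \<in> {2..l+1}" and l: "l < k" for l s
  proof -
    have s': "s \<in> {1..k}" "1 \<noteq> s" "s \<in> {2..k}" using s l by auto
    have "(\<Sum>j\<in>UNIV. pol_pf k ((Y l)(1 := ?E j, s := \<lambda>a b c d. DW j a b c d + kn_id (DP j) a b c d))) = 0"
      by (rule pol_pf_cyclic[OF one s'(1,2)]) (rule bianchi)
    then have "(\<Sum>j\<in>UNIV. pol_pf k ((Y l)(1 := ?E j, s := DW j))) =
       - 4 * (\<Sum>j\<in>UNIV. pol_pf k ((Y l)(1 := ?E j, s := otimes (DP j) kron)))"
      unfolding pol_pf_add[OF s'(1)] pol_pf_kn_id[OF s'(1)] sum.distrib sum_distrib_left[symmetric]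
      by linarith
    also have "\<dots> = - 2 * pol_pf k ((Y l)(1 := Z i, s := ?p))"
      unfolding exch[OF s'(3)] by simp
    also have "pol_pf k ((Y l)(1 := Z i, s := ?p)) =
       pol_pf k (\<lambda>r. if r \<in> {2..l+1} - {s} then W else if r \<in> {2..k} then ?p else Z i)"
      using s' by (intro pol_pf_cong) (auto simp: Y_def)
    also have "\<dots> = pol_pf k (\<lambda>r. if r \<in> {2..(l-1)+1} then W else if r \<in> {2..k} then ?p else Z i)"
      by (rule pol_pf_choice[where X="\<lambda>_. Z i"]) (use s l in auto)
    also have "\<dots> = M (l - 1)" by (simp add: M_def mixed_pf_def)
    finally have "(\<Sum>j\<in>UNIV. pol_pf k ((Y l)(1 := ?E j, s := DW j))) = - 2 * M (l - 1)" .
    moreover have "DX l i j j s = DW j" for j using s by (simp add: DX_def)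
    ultimately show ?thesis unfolding X by (simp only:)
  qed
  have total: "(\<Sum>j\<in>UNIV. \<Sum>s=1..k. pol_pf k ((X l i j)(s := DX l i j j s))) =
     real (k - l) / 2 * M l - 2 * real l * M (l - 1)" if l: "l < k" for l
  proof -
    let ?f = "\<lambda>s. \<Sum>j\<in>UNIV. pol_pf k ((X l i j)(s := DX l i j j s))"
    have split: "{1..k} = {1} \<union> ({2..l+1} \<union> {l+2..k})" using l by auto
    have "(\<Sum>j\<in>UNIV. \<Sum>s=1..k. pol_pf k ((X l i j)(s := DX l i j j s))) = sum ?f {1..k}" by (rule sum.swap)
    also have "\<dots> = ?f 1 + (sum ?f {2..l+1} + sum ?f {l+2..k})"
      unfolding split by (subst sum.union_disjoint, simp, simp, simp, subst sum.union_disjoint) auto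
    also have "sum ?f {2..l+1} = (\<Sum>s=2..l+1. - 2 * M (l - 1))"
      by (rule sum.cong[OF refl slotW]) (use l in auto)
    also have "sum ?f {l+2..k} = (\<Sum>s=l+2..k. 1 / 2 * M l)"
      by (rule sum.cong[OF refl slotP])
    also have "?f 1 = 1 / 2 * M l" by (rule slot1)
    also have "1 / 2 * M l + ((\<Sum>s=2..l+1. - 2 * M (l - 1)) + (\<Sum>s=l+2..k. 1 / 2 * M l)) =
      1 / 2 * M l + (real l * (- 2 * M (l - 1)) + real (k - l - 1) * (1 / 2 * M l))" by simp
    also have "real (k - l - 1) = real (k - l) - 1" using l by simp
    also have "1 / 2 * M l + (real l * (- 2 * M (l - 1)) + (real (k - l) - 1) * (1 / 2 * M l)) =
      real (k - l) / 2 * M l - 2 * real l * M (l - 1)" by (simp add: field_simps)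
    finally show ?thesis .
  qed
  \<comment> \<open>The weight that makes the contribution of \<open>l\<close> equal to \<open>U l - U (l - 1)\<close>.\<close>
  define U where "U l = 4^(k-l) / (2 * fact l * fact (k-l-1)) * M l" for l
  have step: "4^(k-l) / (fact l * fact (k-l)) *
      (\<Sum>j\<in>UNIV. \<Sum>s=1..k. pol_pf k ((X l i j)(s := DX l i j j s))) = U l - (if l = 0 then 0 else U (l - 1))"
    if l: "l < k" for l
  proof -
    have f1: "fact (k - l) = real (k - l) * fact (k - l - 1)" using l by (subst fact_reduce) auto
    have kl: "real (k - l) \<noteq> 0" using l by simp
    have a: "4^(k-l) / (fact l * fact (k-l)) * (real (k - l) / 2 * M l) = U l"
      unfolding U_def f1 using kl by (simp add: field_simps)
    have b: "4^(k-l) / (fact l * fact (k-l)) * (2 * real l * M (l - 1)) = U (l - 1)" if "l \<noteq> 0"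
    proof -
      have f2: "fact l = real l * fact (l - 1)" using that by (subst fact_reduce) auto
      have e: "k - (l - 1) = Suc (k - l)" using l that by simp
      show ?thesis unfolding U_def f2 e using that by (simp add: field_simps)
    qed
    show ?thesis unfolding total[OF l] right_diff_distrib a using b by auto
  qed
  have "(\<Sum>l=0..n. U l - (if l = 0 then 0 else U (l - 1))) = U n" for n
    by (induction n) auto
  then have "(\<Sum>l=0..k-1. U l - (if l = 0 then 0 else U (l - 1))) = U (k - 1)" .
  moreover have "(\<Sum>l=0..k-1. 4^(k-l) / (fact l * fact (k-l)) *
      (\<Sum>j\<in>UNIV. \<Sum>s=1..k. pol_pf k ((X l i j)(s := DX l i j j s)))) =
    (\<Sum>l=0..k-1. U l - (if l = 0 then 0 else U (l - 1)))"
    by (rule sum.cong[OF refl step]) (use k in auto)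
  moreover have "U (k - 1) = 2 / fact (k - 1) * M (k - 1)" using k by (simp add: U_def)
  ultimately show ?thesis by (simp add: M_def)
qed

text \<open>
  Arguments that are interchangeable in each single slot are interchangeable in all slots at once.
\<close>

lemma pol_pf_replace:
  assumes "\<And>s V. s \<in> {1..k} \<Longrightarrow> pol_pf k (V(s := A s)) = pol_pf k (V(s := B s))"
  shows "pol_pf k A = pol_pf k B"
proof -
  have "pol_pf k (\<lambda>s. if s \<in> S then B s else A s) = pol_pf k A" if "finite S" "S \<subseteq> {1..k}" for S
    using that
  proof (induction S rule: finite_induct)
    case (insert r S)
    let ?V = "\<lambda>s. if s \<in> S then B s else A s"
    have "(\<lambda>s. if s \<in> insert r S then B s else A s) = ?V(r := B r)" "?V = ?V(r := A r)"
      using insert.hyps by auto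
    then show ?case using assms[of r ?V] insert by simp
  qed simp
  from this[of "{1..k}"] have "pol_pf k (\<lambda>s. if s \<in> {1..k} then B s else A s) = pol_pf k A" by simp
  moreover have "pol_pf k (\<lambda>s. if s \<in> {1..k} then B s else A s) = pol_pf k B"
    by (rule pol_pf_cong) simp
  ultimately show ?thesis by simp
qed

lemma sum_Pow_card:
  fixes f :: "nat \<Rightarrow> real"
  assumes "finite A"
  shows "(\<Sum>T\<in>Pow A. f (card T)) = (\<Sum>l\<le>card A. real (card A choose l) * f l)"
proof -
  have "(\<Sum>T\<in>Pow A. f (card T)) = (\<Sum>l\<in>{..card A}. \<Sum>T | T \<in> Pow A \<and> card T = l. f (card T))"
    by (rule sum.group[symmetric]) (use assms in \<open>auto intro: card_mono\<close>)
  also have "\<dots> = (\<Sum>l\<le>card A. real (card A choose l) * f l)"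
  proof (rule sum.cong[OF refl])
    fix l
    have "(\<Sum>T | T \<in> Pow A \<and> card T = l. f (card T)) = (\<Sum>T | T \<subseteq> A \<and> card T = l. f l)"
      by (rule sum.cong) auto
    then show "(\<Sum>T | T \<in> Pow A \<and> card T = l. f (card T)) = real (card A choose l) * f l"
      using n_subsets[OF assms, of l] by simp
  qed
  finally show ?thesis .
qed

lemma pol_pf_binomial:
  fixes W :: "'n::finite array4"
  shows "pol_pf k (\<lambda>s a b c d. W a b c d + r * Q a b c d) =
    (\<Sum>l\<le>k. real (k choose l) * (r ^ (k - l) * pol_pf k (\<lambda>s. if s \<in> {1..l} then W else Q)))"
proof -
  let ?N = "\<lambda>l. pol_pf k (\<lambda>s. if s \<in> {1..l} then W else Q)"
  have "pol_pf k (\<lambda>s a b c d. W a b c d + r * Q a b c d) =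
    (\<Sum>T\<in>Pow {1..k}. r ^ (k - card T) * pol_pf k (\<lambda>s. if s \<in> T then W else Q))"
    unfolding pol_pf_def contraction_scale[symmetric] contraction_sum[symmetric]
  proof (rule contraction_cong)
    fix I J :: "'n multi_index"
    let ?e = "\<lambda>X s. slot_at s X I J :: real"
    have "(\<Prod>s=1..k. ?e W s + r * ?e Q s) = (\<Sum>T\<in>Pow {1..k}. (\<Prod>s\<in>T. ?e W s) * (\<Prod>s\<in>{1..k}-T. r * ?e Q s))"
      by (rule prod_add) simp
    also have "\<dots> = (\<Sum>T\<in>Pow {1..k}. r ^ (k - card T) * (\<Prod>s=1..k. ?e (if s \<in> T then W else Q) s))"
    proof (rule sum.cong[OF refl])
      fix T assume T: "T \<in> Pow {1..k}"
      then have fin: "finite T" using finite_subset by auto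
      have "card ({1..k} - T) = k - card T" using T fin by (simp add: card_Diff_subset)
      moreover have "(\<Prod>s=1..k. ?e (if s \<in> T then W else Q) s) = (\<Prod>s\<in>{1..k}-T. ?e Q s) * (\<Prod>s\<in>T. ?e W s)"
        using T by (subst prod.subset_diff[of T]) auto
      ultimately show "(\<Prod>s\<in>T. ?e W s) * (\<Prod>s\<in>{1..k}-T. r * ?e Q s) =
         r ^ (k - card T) * (\<Prod>s=1..k. ?e (if s \<in> T then W else Q) s)"
        by (simp add: prod.distrib)
    qed
    finally show "(\<Prod>s=1..k. ?e W s + r * ?e Q s) =
       (\<Sum>T\<in>Pow {1..k}. r ^ (k - card T) * (\<Prod>s=1..k. ?e (if s \<in> T then W else Q) s))" .
  qed
  also have "\<dots> = (\<Sum>T\<in>Pow {1..k}. r ^ (k - card T) * ?N (card T))"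
  proof (intro sum.cong refl arg_cong2[where f="(*)"])
    fix T assume "T \<in> Pow {1..k}"
    then have T: "T \<subseteq> {1..k}" "card T \<le> k" using card_mono[of "{1..k}" T] by auto
    have c: "pol_pf k (\<lambda>s. if s \<in> T' then W else Q) = pol_pf k (\<lambda>s. if s \<in> T' then W else if s \<in> {1..k} then Q else Q)" for T'
      by (rule pol_pf_cong) auto
    show "pol_pf k (\<lambda>s. if s \<in> T then W else Q) = ?N (card T)"
      unfolding c[of T] c[of "{1..card T}"]
      by (rule pol_pf_choice[where X="\<lambda>_. Q"]) (use T in auto)
  qed
  also have "\<dots> = (\<Sum>l\<le>k. real (k choose l) * (r ^ (k - l) * ?N l))"
    using sum_Pow_card[of "{1..k}" "\<lambda>l. r ^ (k - l) * ?N l"] by simp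
  finally show ?thesis .
qed

text \<open>
  The left-hand side is the trace of \<open>\<Omega>\<close>.  On the right, the binomial expansion of the Pfaffian of
  \<open>W + kn_id P\<close> produces the same terms together with the one for \<open>l = k\<close>, the Pfaffian of \<open>W\<close>.
\<close>

lemma trace_mixed_pf:
  fixes W :: "'n::finite array4"
  assumes "1 \<le> k"
  shows "(\<Sum>i\<in>UNIV. \<Sum>l=0..k-1. 4^(k-l) / (fact l * fact (k-l)) *
       mixed_pf k l (otimes (elem2 i i) P) W (otimes P kron)) =
    1 / fact k * pol_pf k (\<lambda>s a b c d. W a b c d + kn_id P a b c d) - 1 / fact k * pol_pf k (\<lambda>s. W)"
proof -
  let ?p = "otimes P kron"
  let ?N = "\<lambda>l. pol_pf k (\<lambda>s. if s \<in> {1..l} then W else ?p)"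
  have one: "1 \<in> {1..k}" using assms by simp
  have tr: "(\<Sum>i\<in>UNIV. mixed_pf k l (otimes (elem2 i i) P) W ?p) = ?N l" if l: "l < k" for l
  proof -
    have e: "(\<Sum>i\<in>UNIV. otimes (elem2 i i) P a b c d) = otimes kron P a b c d" for a b c d :: 'n
    proof -
      have "(\<Sum>i\<in>UNIV. otimes (elem2 i i) P a b c d) = (\<Sum>i\<in>UNIV. if i = a then otimes kron P a b c d else 0)"
        by (intro sum.cong refl) (auto simp: otimes_def elem2_def kron_def)
      then show ?thesis by simp
    qed
    have "(\<Sum>i\<in>UNIV. mixed_pf k l (otimes (elem2 i i) P) W ?p) =
       pol_pf k ((\<lambda>s. if s \<in> {2..l + 1} then W else ?p)(1 := \<lambda>a b c d. otimes kron P a b c d))"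
      unfolding mixed_pf_insert_first[OF assms] pol_pf_sum[OF one, symmetric] e ..
    also have "\<dots> = pol_pf k ((\<lambda>s. if s \<in> {2..l + 1} then W else ?p)(1 := ?p))"
      using pol_pf_flip[OF one] by simp
    also have "\<dots> = pol_pf k (\<lambda>s. if s \<in> {2..l + 1} then W else if s \<in> {1..k} then ?p else ?p)"
      by (rule pol_pf_cong) auto
    also have "\<dots> = pol_pf k (\<lambda>s. if s \<in> {1..l} then W else if s \<in> {1..k} then ?p else ?p)"
      by (rule pol_pf_choice[where X="\<lambda>_. ?p"]) (use l in auto)
    also have "\<dots> = ?N l" by (rule pol_pf_cong) auto
    finally show ?thesis .
  qed
  have "pol_pf k (\<lambda>s a b c d. W a b c d + kn_id P a b c d) = pol_pf k (\<lambda>s a b c d. W a b c d + 4 * ?p a b c d)"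
    by (rule pol_pf_replace) (simp add: pol_pf_add pol_pf_kn_id pol_pf_scale)
  also have "1 / fact k * \<dots> = (\<Sum>l\<le>k. 4 ^ (k - l) / (fact l * fact (k - l)) * ?N l)"
    unfolding pol_pf_binomial sum_distrib_left
    by (rule sum.cong[OF refl]) (simp add: binomial_fact)
  also have "{..k} = insert k {0..k-1}" using assms by auto
  also have "(\<Sum>l\<in>insert k {0..k-1}. 4 ^ (k - l) / (fact l * fact (k - l)) * ?N l) =
     1 / fact k * ?N k + (\<Sum>l=0..k-1. 4 ^ (k - l) / (fact l * fact (k - l)) * ?N l)"
    using assms by (subst sum.insert) auto
  also have "?N k = pol_pf k (\<lambda>s. W)" by (rule pol_pf_cong) simp
  also have "(\<Sum>l=0..k-1. 4 ^ (k - l) / (fact l * fact (k - l)) * ?N l) =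
     (\<Sum>l=0..k-1. 4^(k-l) / (fact l * fact (k-l)) * (\<Sum>i\<in>UNIV. mixed_pf k l (otimes (elem2 i i) P) W ?p))"
    by (rule sum.cong[OF refl], subst tr) (use assms in auto)
  also have "\<dots> = (\<Sum>i\<in>UNIV. \<Sum>l=0..k-1. 4^(k-l) / (fact l * fact (k-l)) *
       mixed_pf k l (otimes (elem2 i i) P) W ?p)"
    unfolding sum_distrib_left by (rule sum.swap)
  finally show ?thesis by simp
qed

section \<open>Smooth functions and their partial derivatives\<close>

lemma pderivative_eq:
  assumes "(f has_derivative f') (at x)"
  shows "pderivative i f x = f' (axis i 1)"
  using frechet_derivative_at[OF assms] by (simp add: pderivative_def)

lemma pderivative_cong:
  assumes "open S" "x \<in> S" "\<And>y. y \<in> S \<Longrightarrow> f y = g y"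
  shows "pderivative i f x = pderivative i g x"
proof -
  have "(f has_derivative f') (at x) \<longleftrightarrow> (g has_derivative f') (at x)" for f'
    using assms has_derivative_transform_within_open[OF _ assms(1,2)] by metis
  then show ?thesis by (simp add: pderivative_def frechet_derivative_def)
qed

lemma differentiable_cong_open:
  assumes "open S" "x \<in> S" "\<And>y. y \<in> S \<Longrightarrow> f y = g y" "f differentiable (at x)"
  shows "g differentiable (at x)"
  using assms has_derivative_transform_within_open unfolding differentiable_def by (metis (no_types, lifting))

lemma pderivative_const [simp]: "pderivative i (\<lambda>y. c) x = 0"
  by (rule pderivative_eq[OF has_derivative_const])

lemma pderivative_add:
  assumes "f differentiable (at x)" "g differentiable (at x)"
  shows "pderivative i (\<lambda>y. f y + g y) x = pderivative i f x + pderivative i g x"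
  using pderivative_eq[OF has_derivative_add[OF assms[unfolded frechet_derivative_works]]]
  by (simp add: pderivative_def)

lemma pderivative_diff:
  assumes "f differentiable (at x)" "g differentiable (at x)"
  shows "pderivative i (\<lambda>y. f y - g y) x = pderivative i f x - pderivative i g x"
  using pderivative_eq[OF has_derivative_diff[OF assms[unfolded frechet_derivative_works]]]
  by (simp add: pderivative_def)

lemma pderivative_mult:
  fixes f g :: "real^'n::finite \<Rightarrow> real"
  assumes "f differentiable (at x)" "g differentiable (at x)"
  shows "pderivative i (\<lambda>y. f y * g y) x = pderivative i f x * g x + f x * pderivative i g x"
  using pderivative_eq[OF has_derivative_mult[OF assms[unfolded frechet_derivative_works]]]
  by (simp add: pderivative_def)

lemma pderivative_cmult:
  fixes f :: "real^'n::finite \<Rightarrow> real"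
  assumes "f differentiable (at x)"
  shows "pderivative i (\<lambda>y. c * f y) x = c * pderivative i f x"
  using pderivative_mult[of "\<lambda>_. c" x f i] assms by simp

lemma pderivative_sum:
  assumes "\<And>a. a \<in> A \<Longrightarrow> f a differentiable (at x)"
  shows "pderivative i (\<lambda>y. \<Sum>a\<in>A. f a y) x = (\<Sum>a\<in>A. pderivative i (f a) x)"
  using pderivative_eq[OF has_derivative_sum[of A f "\<lambda>a. frechet_derivative (f a) (at x)"]]
    assms[unfolded frechet_derivative_works] by (simp add: pderivative_def)

lemma pderivative_inverse:
  fixes f :: "real^'n::finite \<Rightarrow> real"
  assumes "f differentiable (at x)" "f x \<noteq> 0"
  shows "pderivative i (\<lambda>y. inverse (f y)) x = - (pderivative i f x) * (inverse (f x) * inverse (f x))"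
  using pderivative_eq[OF Deriv.has_derivative_inverse[OF assms(2) assms(1)[unfolded frechet_derivative_works]]]
  by (simp add: pderivative_def)

lemma pderivative_bounded_linear:
  assumes "bounded_linear L" "f differentiable (at x)"
  shows "pderivative i (\<lambda>y. L (f y)) x = L (pderivative i f x)"
  using pderivative_eq[OF bounded_linear.has_derivative[OF assms(1) assms(2)[unfolded frechet_derivative_works]]]
  by (simp add: pderivative_def)

lemma Ck_on_cong:
  assumes "open S" "\<And>y. y \<in> S \<Longrightarrow> f y = g y" "Ck_on r S f"
  shows "Ck_on r S g"
  using assms(2,3)
proof (induction r arbitrary: f g)
  case 0 then show ?case using continuous_on_cong by (metis Ck_on.simps(1))
next
  case (Suc r)
  have "Ck_on r S (pderivative i g)" for i
    by (rule Suc.IH[of "pderivative i f"])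
       (use Suc.prems pderivative_cong[OF assms(1) _ Suc.prems(1)] in auto)
  then show ?case using Suc.prems differentiable_cong_open[OF assms(1) _ Suc.prems(1)] by auto
qed

lemma Ck_on_Suc_imp: "Ck_on (Suc r) S f \<Longrightarrow> Ck_on r S f"
proof (induction r arbitrary: f)
  case 0 then show ?case
    by (auto intro!: continuous_at_imp_continuous_on differentiable_imp_continuous_within)
next
  case (Suc r) then show ?case using Ck_on.simps(2) by blast
qed

lemma Ck_on_const: "Ck_on r S (\<lambda>x::real^'n::finite. c)"
proof (induction r arbitrary: c)
  case (Suc r)
  have "pderivative i (\<lambda>x::real^'n. c) = (\<lambda>x. 0)" for i by (simp add: fun_eq_iff)
  then show ?case using Suc by simp
qed simp

lemma Ck_on_add:
  assumes "open S" "Ck_on r S f" "Ck_on r S g"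
  shows "Ck_on r S (\<lambda>x. f x + g x)"
  using assms(2,3)
proof (induction r arbitrary: f g)
  case (Suc r)
  have "Ck_on r S (pderivative i (\<lambda>x. f x + g x))" for i
    by (rule Ck_on_cong[OF assms(1), of "\<lambda>x. pderivative i f x + pderivative i g x"])
       (use Suc in \<open>auto simp: pderivative_add\<close>)
  then show ?case using Suc.prems by auto
qed (auto intro: continuous_intros)

lemma Ck_on_mult:
  fixes f g :: "real^'n::finite \<Rightarrow> real"
  assumes "open S" "Ck_on r S f" "Ck_on r S g"
  shows "Ck_on r S (\<lambda>x. f x * g x)"
  using assms(2,3)
proof (induction r arbitrary: f g)
  case (Suc r)
  have "Ck_on r S (pderivative i (\<lambda>x. f x * g x))" for i
  proof (rule Ck_on_cong[OF assms(1), of "\<lambda>x. pderivative i f x * g x + f x * pderivative i g x"])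
    show "Ck_on r S (\<lambda>x. pderivative i f x * g x + f x * pderivative i g x)"
      using Suc.prems Ck_on_Suc_imp[OF Suc.prems(1)] Ck_on_Suc_imp[OF Suc.prems(2)]
      by (intro Ck_on_add[OF assms(1)] Suc.IH) auto
  qed (use Suc.prems in \<open>auto simp: pderivative_mult\<close>)
  then show ?case using Suc.prems by auto
qed (auto intro: continuous_intros)

lemma Ck_on_inverse:
  fixes f :: "real^'n::finite \<Rightarrow> real"
  assumes "open S" "Ck_on r S f" "\<And>x. x \<in> S \<Longrightarrow> f x \<noteq> 0"
  shows "Ck_on r S (\<lambda>x. inverse (f x))"
  using assms(2)
proof (induction r)
  case (Suc r)
  note IH = Suc.IH[OF Ck_on_Suc_imp[OF Suc.prems]]
  have "Ck_on r S (pderivative i (\<lambda>x. inverse (f x)))" for i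
  proof (rule Ck_on_cong[OF assms(1)])
    show "Ck_on r S (\<lambda>x. ((-1) * pderivative i f x) * (inverse (f x) * inverse (f x)))"
      using Suc.prems IH by (intro Ck_on_mult[OF assms(1)] Ck_on_const) auto
    show "((-1) * pderivative i f y) * (inverse (f y) * inverse (f y)) = pderivative i (\<lambda>x. inverse (f x)) y"
      if "y \<in> S" for y
      using that Suc.prems assms(3) by (subst pderivative_inverse) auto
  qed
  moreover have "(\<lambda>x. inverse (f x)) differentiable (at x)" if "x \<in> S" for x
    using that Suc.prems assms(3) by (intro differentiable_inverse) auto
  ultimately show ?case by simp
qed (use assms(3) in \<open>auto intro!: continuous_intros\<close>)

lemma Ck_on_bounded_linear:
  assumes "open S" "bounded_linear L" "Ck_on r S f"
  shows "Ck_on r S (\<lambda>x. L (f x))"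
  using assms(3)
proof (induction r arbitrary: f)
  case 0
  then have "continuous_on S f" by simp
  from bounded_linear.continuous_on[OF assms(2) this] show ?case by simp
next
  case (Suc r)
  have "Ck_on r S (pderivative i (\<lambda>x. L (f x)))" for i
  proof (rule Ck_on_cong[OF assms(1)])
    show "Ck_on r S (\<lambda>x. L (pderivative i f x))" by (rule Suc.IH) (use Suc.prems in simp)
    show "L (pderivative i f y) = pderivative i (\<lambda>x. L (f x)) y" if "y \<in> S" for y
      using that Suc.prems by (intro pderivative_bounded_linear[OF assms(2), symmetric]) simp
  qed
  moreover have "(\<lambda>x. L (f x)) differentiable (at x)" if x: "x \<in> S" for x
  proof -
    have "f differentiable (at x)" using Suc.prems x by simp
    then obtain f' where "(f has_derivative f') (at x)" unfolding differentiable_def by blast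
    from bounded_linear.has_derivative[OF assms(2) this] show ?thesis unfolding differentiable_def by blast
  qed
  ultimately show ?case by simp
qed

lemma smooth_on_cong:
  "open S \<Longrightarrow> (\<And>y. y \<in> S \<Longrightarrow> f y = g y) \<Longrightarrow> smooth_on S f \<Longrightarrow> smooth_on S g"
  unfolding smooth_on_def using Ck_on_cong by blast

lemma smooth_on_differentiable: "smooth_on S f \<Longrightarrow> x \<in> S \<Longrightarrow> f differentiable (at x)"
  unfolding smooth_on_def using Ck_on.simps(2) by blast

lemma smooth_on_pderivative: "smooth_on S f \<Longrightarrow> smooth_on S (\<lambda>x. pderivative i f x)"
  unfolding smooth_on_def using Ck_on.simps(2) by blast

lemma smooth_on_continuous: "smooth_on S f \<Longrightarrow> continuous_on S f"
  unfolding smooth_on_def using Ck_on.simps(1) by blast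

lemma smooth_on_const: "smooth_on S (\<lambda>x. c)"
  by (simp add: smooth_on_def Ck_on_const)

lemma smooth_on_add: "open S \<Longrightarrow> smooth_on S f \<Longrightarrow> smooth_on S g \<Longrightarrow> smooth_on S (\<lambda>x. f x + g x)"
  by (simp add: smooth_on_def Ck_on_add)

lemma smooth_on_mult:
  fixes f g :: "real^'n::finite \<Rightarrow> real"
  shows "open S \<Longrightarrow> smooth_on S f \<Longrightarrow> smooth_on S g \<Longrightarrow> smooth_on S (\<lambda>x. f x * g x)"
  by (simp add: smooth_on_def Ck_on_mult)

lemma smooth_on_diff:
  fixes f g :: "real^'n::finite \<Rightarrow> real"
  assumes "open S" "smooth_on S f" "smooth_on S g"
  shows "smooth_on S (\<lambda>x. f x - g x)"
  using smooth_on_add[OF assms(1,2) smooth_on_mult[OF assms(1) smooth_on_const[of S "-1"] assms(3)]] by simp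

lemma smooth_on_inverse:
  fixes f :: "real^'n::finite \<Rightarrow> real"
  shows "open S \<Longrightarrow> smooth_on S f \<Longrightarrow> (\<And>x. x \<in> S \<Longrightarrow> f x \<noteq> 0) \<Longrightarrow> smooth_on S (\<lambda>x. inverse (f x))"
  by (simp add: smooth_on_def Ck_on_inverse)

lemma smooth_on_sum:
  assumes "open S" "\<And>a. a \<in> A \<Longrightarrow> smooth_on S (f a)"
  shows "smooth_on S (\<lambda>x. \<Sum>a\<in>A. f a x)"
  using assms(2)
  by (induction A rule: infinite_finite_induct) (auto intro: smooth_on_const smooth_on_add[OF assms(1)])

lemma smooth_on_prod:
  fixes f :: "'a \<Rightarrow> real^'n::finite \<Rightarrow> real"
  assumes "open S" "\<And>a. a \<in> A \<Longrightarrow> smooth_on S (f a)"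
  shows "smooth_on S (\<lambda>x. \<Prod>a\<in>A. f a x)"
  using assms(2)
  by (induction A rule: infinite_finite_induct) (auto intro: smooth_on_const smooth_on_mult[OF assms(1)])

lemma smooth_on_component2:
  fixes F :: "real^'n::finite \<Rightarrow> real^'m::finite^'l::finite"
  assumes "open S" "smooth_on S F"
  shows "smooth_on S (\<lambda>x. F x $ i $ j)"
proof -
  have "bounded_linear (\<lambda>A::real^'m^'l. A $ i $ j)"
    by (intro bounded_linear_compose[OF bounded_linear_vec_nth bounded_linear_vec_nth])
  then show ?thesis using assms Ck_on_bounded_linear unfolding smooth_on_def by blast
qed

lemma pderivative_along_line:
  fixes f :: "real^'n::finite \<Rightarrow> real"
  assumes "f differentiable (at (c + s *\<^sub>R axis i 1))"
  shows "((\<lambda>s. f (c + s *\<^sub>R axis i 1)) has_real_derivative pderivative i f (c + s *\<^sub>R axis i 1)) (at s)"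
proof -
  let ?y = "c + s *\<^sub>R axis i (1::real)"
  have f: "(f has_derivative frechet_derivative f (at ?y)) (at ?y)"
    using assms by (simp add: frechet_derivative_works)
  have l: "((\<lambda>s. c + s *\<^sub>R axis i 1) has_derivative (\<lambda>t. t *\<^sub>R axis i (1::real))) (at s)"
    by (auto intro!: derivative_eq_intros)
  have "((\<lambda>s. f (c + s *\<^sub>R axis i 1)) has_derivative (\<lambda>t. frechet_derivative f (at ?y) (t *\<^sub>R axis i 1))) (at s)"
    using has_derivative_compose[OF l f] .
  moreover have "frechet_derivative f (at ?y) (t *\<^sub>R axis i 1) = pderivative i f ?y * t" for t
    using linear_frechet_derivative[OF assms] by (simp add: pderivative_def linear_cmul)
  ultimately show ?thesis by (simp add: has_field_derivative_def)
qed

text \<open>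
  Two applications of the mean value theorem to a second difference, which is symmetric in \<open>i\<close> and
  \<open>j\<close>; this yields the symmetry of second derivatives.
\<close>

lemma second_difference_mvt:
  fixes f :: "real^'n::finite \<Rightarrow> real"
  assumes sm: "smooth_on S f" and t: "0 < t" and ball: "ball x (3 * t) \<subseteq> S"
  shows "\<exists>y \<in> ball x (3 * t). f (x + t *\<^sub>R axis i 1 + t *\<^sub>R axis j 1) - f (x + t *\<^sub>R axis i 1)
      - f (x + t *\<^sub>R axis j 1) + f x = t * t * pderivative j (pderivative i f) y"
proof -
  let ?u = "axis i (1::real)" and ?v = "axis j (1::real)"
  have inb: "x + a *\<^sub>R ?u + b *\<^sub>R ?v \<in> ball x (3 * t)" if "0 \<le> a" "a \<le> t" "0 \<le> b" "b \<le> t" for a b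
  proof -
    have "norm (a *\<^sub>R ?u + b *\<^sub>R ?v) \<le> a + b"
      using norm_triangle_ineq[of "a *\<^sub>R ?u" "b *\<^sub>R ?v"] that by (simp add: norm_axis_1)
    moreover have "dist x (x + (a *\<^sub>R ?u + b *\<^sub>R ?v)) = norm (a *\<^sub>R ?u + b *\<^sub>R ?v)"
      by (simp only: dist_norm minus_diff_eq diff_add_cancel norm_minus_commute[of x] add_diff_cancel_left')
    ultimately show ?thesis using that t by (simp add: add.assoc)
  qed
  have d1: "f differentiable (at y)" "pderivative i f differentiable (at y)" if "y \<in> ball x (3 * t)" for y
    using that ball smooth_on_differentiable[OF sm] smooth_on_differentiable[OF smooth_on_pderivative[OF sm]] by auto
  define \<phi> where "\<phi> s = f ((x + t *\<^sub>R ?v) + s *\<^sub>R ?u) - f (x + s *\<^sub>R ?u)" for s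
  have "\<exists>\<xi>>0. \<xi> < t \<and> \<phi> t - \<phi> 0 = (t - 0) * (pderivative i f ((x + t *\<^sub>R ?v) + \<xi> *\<^sub>R ?u) - pderivative i f (x + \<xi> *\<^sub>R ?u))"
  proof (rule MVT2[OF t])
    fix s assume s: "0 \<le> s" "s \<le> t"
    have "(x + t *\<^sub>R ?v) + s *\<^sub>R ?u \<in> ball x (3 * t)" "x + s *\<^sub>R ?u \<in> ball x (3 * t)"
      using inb[of s t] inb[of s 0] s t by (simp_all add: algebra_simps)
    then show "(\<phi> has_real_derivative
        (pderivative i f ((x + t *\<^sub>R ?v) + s *\<^sub>R ?u) - pderivative i f (x + s *\<^sub>R ?u))) (at s)"
      unfolding \<phi>_def by (intro DERIV_diff pderivative_along_line d1)
  qed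
  then obtain \<xi> where \<xi>: "0 < \<xi>" "\<xi> < t"
    "\<phi> t - \<phi> 0 = t * (pderivative i f ((x + t *\<^sub>R ?v) + \<xi> *\<^sub>R ?u) - pderivative i f (x + \<xi> *\<^sub>R ?u))" by auto
  define \<psi> where "\<psi> s = pderivative i f ((x + \<xi> *\<^sub>R ?u) + s *\<^sub>R ?v)" for s
  have "\<exists>\<eta>>0. \<eta> < t \<and> \<psi> t - \<psi> 0 = (t - 0) * pderivative j (pderivative i f) ((x + \<xi> *\<^sub>R ?u) + \<eta> *\<^sub>R ?v)"
  proof (rule MVT2[OF t])
    fix s assume s: "0 \<le> s" "s \<le> t"
    have "(x + \<xi> *\<^sub>R ?u) + s *\<^sub>R ?v \<in> ball x (3 * t)" using inb[of \<xi> s] s \<xi> by simp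
    then show "(\<psi> has_real_derivative pderivative j (pderivative i f) ((x + \<xi> *\<^sub>R ?u) + s *\<^sub>R ?v)) (at s)"
      unfolding \<psi>_def by (intro pderivative_along_line d1)
  qed
  then obtain \<eta> where \<eta>: "0 < \<eta>" "\<eta> < t"
    "\<psi> t - \<psi> 0 = t * pderivative j (pderivative i f) (x + \<xi> *\<^sub>R ?u + \<eta> *\<^sub>R ?v)" by auto
  have "pderivative i f ((x + t *\<^sub>R ?v) + \<xi> *\<^sub>R ?u) - pderivative i f (x + \<xi> *\<^sub>R ?u) = \<psi> t - \<psi> 0"
    by (simp add: \<psi>_def algebra_simps)
  then have "\<phi> t - \<phi> 0 = t * t * pderivative j (pderivative i f) (x + \<xi> *\<^sub>R ?u + \<eta> *\<^sub>R ?v)"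
    using \<xi>(3) \<eta>(3) by simp
  moreover have "\<phi> t - \<phi> 0 = f (x + t *\<^sub>R ?u + t *\<^sub>R ?v) - f (x + t *\<^sub>R ?u) - f (x + t *\<^sub>R ?v) + f x"
    by (simp add: \<phi>_def algebra_simps)
  moreover have "x + \<xi> *\<^sub>R ?u + \<eta> *\<^sub>R ?v \<in> ball x (3 * t)" using inb \<xi> \<eta> by simp
  ultimately show ?thesis by metis
qed

lemma pderivative_commute:
  fixes f :: "real^'n::finite \<Rightarrow> real"
  assumes S: "open S" "x \<in> S" and sm: "smooth_on S f"
  shows "pderivative i (pderivative j f) x = pderivative j (pderivative i f) x"
proof (rule ccontr)
  let ?A = "pderivative i (pderivative j f)" and ?B = "pderivative j (pderivative i f)"
  assume "?A x \<noteq> ?B x"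
  define e where "e = \<bar>?A x - ?B x\<bar> / 2"
  have e: "e > 0" using \<open>?A x \<noteq> ?B x\<close> by (simp add: e_def)
  have cont: "continuous_on S ?A" "continuous_on S ?B"
    using smooth_on_continuous[OF smooth_on_pderivative[OF smooth_on_pderivative[OF sm]]] by auto
  have near: "\<exists>d>0. \<forall>y. dist y x < d \<longrightarrow> y \<in> S \<and> dist (h y) (h x) < e" if h: "continuous_on S h" for h :: "real^'n \<Rightarrow> real"
  proof -
    obtain d1 where "d1 > 0" "\<forall>y. dist y x < d1 \<longrightarrow> y \<in> S" using S unfolding open_dist by blast
    moreover obtain d2 where "d2 > 0" "\<forall>y\<in>S. dist y x < d2 \<longrightarrow> dist (h y) (h x) < e"
      using h S(2) e unfolding continuous_on_iff by blast
    ultimately show ?thesis by (intro exI[of _ "min d1 d2"]) auto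
  qed
  obtain d1 where d1: "d1 > 0" "\<And>y. dist y x < d1 \<Longrightarrow> y \<in> S \<and> dist (?A y) (?A x) < e" using near[OF cont(1)] by blast
  obtain d2 where d2: "d2 > 0" "\<And>y. dist y x < d2 \<Longrightarrow> y \<in> S \<and> dist (?B y) (?B x) < e" using near[OF cont(2)] by blast
  define t where "t = min d1 d2 / 3"
  have t: "t > 0" "3 * t \<le> d1" "3 * t \<le> d2" using d1 d2 by (auto simp: t_def)
  have ball: "ball x (3 * t) \<subseteq> S" using d1 t by (force simp: dist_commute)
  obtain y where y: "y \<in> ball x (3 * t)" "f (x + t *\<^sub>R axis i 1 + t *\<^sub>R axis j 1) - f (x + t *\<^sub>R axis i 1)
      - f (x + t *\<^sub>R axis j 1) + f x = t * t * ?B y"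
    using second_difference_mvt[OF sm t(1) ball] by blast
  obtain z where z: "z \<in> ball x (3 * t)" "f (x + t *\<^sub>R axis j 1 + t *\<^sub>R axis i 1) - f (x + t *\<^sub>R axis j 1)
      - f (x + t *\<^sub>R axis i 1) + f x = t * t * ?A z"
    using second_difference_mvt[OF sm t(1) ball] by blast
  have "t * t * ?B y = t * t * ?A z" using y(2) z(2) by (simp add: algebra_simps)
  then have "?B y = ?A z" using t by simp
  moreover have "dist (?B y) (?B x) < e" "dist (?A z) (?A x) < e"
    using d1(2)[of z] d2(2)[of y] y(1) z(1) t by (auto simp: dist_commute)
  ultimately show False unfolding e_def dist_real_def by (smt (verit) field_sum_of_halves)
qed

lemma matrix_inv_invertible:
  assumes "invertible (A :: real^'n::finite^'n)"
  shows "A ** matrix_inv A = mat 1" "matrix_inv A ** A = mat 1"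
  using someI_ex[OF assms[unfolded invertible_def]] unfolding matrix_inv_def by auto

lemma matrix_inv_entry_cramer:
  fixes A :: "real^'n::finite^'n"
  assumes "invertible A"
  shows "matrix_inv A $ i $ j = det (\<chi> r s. if s = i then axis j 1 $ r else A $ r $ s) * inverse (det A)"
proof -
  have "A ** matrix_inv A = mat 1" by (rule matrix_inv_invertible[OF assms])
  moreover have "A *v column j (matrix_inv A) = column j (A ** matrix_inv A)"
    by (simp add: vec_eq_iff column_def matrix_vector_mult_def matrix_matrix_mult_def)
  ultimately have "A *v column j (matrix_inv A) = axis j 1"
    by (simp add: vec_eq_iff column_def mat_def axis_def)
  moreover have "det A \<noteq> 0" using assms invertible_det_nz by blast
  ultimately have "column j (matrix_inv A) = (\<chi> k. det (\<chi> r s. if s = k then axis j 1 $ r else A $ r $ s) / det A)"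
    using cramer by blast
  then have "column j (matrix_inv A) $ i = det (\<chi> r s. if s = i then axis j 1 $ r else A $ r $ s) / det A" by simp
  then show ?thesis by (simp add: column_def divide_inverse)
qed

lemma smooth_on_det:
  fixes F :: "real^'m::finite \<Rightarrow> real^'n::finite^'n"
  assumes "open S" "\<And>i j. smooth_on S (\<lambda>x. F x $ i $ j)"
  shows "smooth_on S (\<lambda>x. det (F x))"
  unfolding det_def by (intro smooth_on_sum smooth_on_mult smooth_on_prod smooth_on_const assms)

lemma smooth_on_metric_up:
  assumes "open S" "smooth_on S G" "\<And>x. x \<in> S \<Longrightarrow> invertible (G x)"
  shows "smooth_on S (\<lambda>x. metric_up G x i j)"
proof (rule smooth_on_cong[OF assms(1)])
  show "smooth_on S (\<lambda>x. det (\<chi> r s. if s = i then axis j 1 $ r else G x $ r $ s) * inverse (det (G x)))"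
  proof (intro smooth_on_mult[OF assms(1)] smooth_on_inverse[OF assms(1)] smooth_on_det[OF assms(1)])
    fix r s
    show "smooth_on S (\<lambda>x. (\<chi> r s. if s = i then axis j 1 $ r else G x $ r $ s) $ r $ s)"
      by (cases "s = i") (simp_all add: smooth_on_const smooth_on_component2[OF assms(1,2)])
  qed (use assms smooth_on_component2[OF assms(1,2)] invertible_det_nz in auto)
qed (use assms in \<open>simp add: metric_up_def matrix_inv_entry_cramer\<close>)

section \<open>Matrix-valued functions\<close>

text \<open>
  The entrywise partial derivative of a matrix-valued function.
\<close>

definition matrix_pd :: "'n::finite \<Rightarrow> (real^'n \<Rightarrow> real^'p::finite^'q::finite) \<Rightarrow> real^'n \<Rightarrow> real^'p^'q" where
  "matrix_pd m F x = (\<chi> i j. pderivative m (\<lambda>y. F y $ i $ j) x)"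

text \<open>
  Smoothness of all entries of a matrix-valued function.
\<close>

definition smooth_entries :: "(real^'n::finite) set \<Rightarrow> (real^'n \<Rightarrow> real^'p::finite^'q::finite) \<Rightarrow> bool" where
  "smooth_entries S F \<longleftrightarrow> (\<forall>i j. smooth_on S (\<lambda>x. F x $ i $ j))"

lemma smooth_entries_mult:
  assumes "open S" "smooth_entries S F" "smooth_entries S H"
  shows "smooth_entries S (\<lambda>x. F x ** H x)"
  using assms unfolding smooth_entries_def matrix_matrix_mult_def
  by (auto intro!: smooth_on_sum smooth_on_mult)

lemma smooth_entries_add:
  "open S \<Longrightarrow> smooth_entries S F \<Longrightarrow> smooth_entries S H \<Longrightarrow> smooth_entries S (\<lambda>x. F x + H x)"
  unfolding smooth_entries_def by (auto intro: smooth_on_add)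

lemma smooth_entries_diff:
  "open S \<Longrightarrow> smooth_entries S F \<Longrightarrow> smooth_entries S H \<Longrightarrow> smooth_entries S (\<lambda>x. F x - H x)"
  unfolding smooth_entries_def by (auto intro: smooth_on_diff)

lemma smooth_entries_transpose: "smooth_entries S F \<Longrightarrow> smooth_entries S (\<lambda>x. transpose (F x))"
  unfolding smooth_entries_def transpose_def by auto

lemma smooth_entries_pd: "smooth_entries S F \<Longrightarrow> smooth_entries S (\<lambda>x. matrix_pd m F x)"
  unfolding smooth_entries_def matrix_pd_def by (auto intro: smooth_on_pderivative)

lemma smooth_entries_differentiable:
  "smooth_entries S F \<Longrightarrow> x \<in> S \<Longrightarrow> (\<lambda>y. F y $ i $ j) differentiable (at x)"
  unfolding smooth_entries_def using smooth_on_differentiable by blast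

lemma matrix_pd_cong:
  assumes "open S" "x \<in> S" "\<And>y. y \<in> S \<Longrightarrow> F y = H y"
  shows "matrix_pd m F x = matrix_pd m H x"
  unfolding matrix_pd_def vec_eq_iff using assms by (auto intro!: pderivative_cong)

lemma matrix_pd_const [simp]: "matrix_pd m (\<lambda>y. C) x = 0"
  by (simp add: matrix_pd_def vec_eq_iff)

lemma matrix_pd_mult:
  assumes "smooth_entries S F" "smooth_entries S H" "x \<in> S"
  shows "matrix_pd m (\<lambda>y. F y ** H y) x = matrix_pd m F x ** H x + F x ** matrix_pd m H x"
proof -
  have "pderivative m (\<lambda>y. \<Sum>e\<in>UNIV. F y $ i $ e * H y $ e $ j) x =
     (\<Sum>e\<in>UNIV. pderivative m (\<lambda>y. F y $ i $ e) x * H x $ e $ j + F x $ i $ e * pderivative m (\<lambda>y. H y $ e $ j) x)" for i j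
    by (subst pderivative_sum) (auto intro!: sum.cong pderivative_mult differentiable_mult
        smooth_entries_differentiable[OF assms(1,3)] smooth_entries_differentiable[OF assms(2,3)])
  then show ?thesis by (simp add: vec_eq_iff matrix_pd_def matrix_matrix_mult_def sum.distrib)
qed

lemma matrix_pd_add:
  assumes "smooth_entries S F" "smooth_entries S H" "x \<in> S"
  shows "matrix_pd m (\<lambda>y. F y + H y) x = matrix_pd m F x + matrix_pd m H x"
  by (simp add: vec_eq_iff matrix_pd_def pderivative_add
      smooth_entries_differentiable[OF assms(1,3)] smooth_entries_differentiable[OF assms(2,3)])

lemma matrix_pd_diff:
  assumes "smooth_entries S F" "smooth_entries S H" "x \<in> S"
  shows "matrix_pd m (\<lambda>y. F y - H y) x = matrix_pd m F x - matrix_pd m H x"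
  by (simp add: vec_eq_iff matrix_pd_def pderivative_diff
      smooth_entries_differentiable[OF assms(1,3)] smooth_entries_differentiable[OF assms(2,3)])

lemma matrix_pd_transpose: "matrix_pd m (\<lambda>y. transpose (F y)) x = transpose (matrix_pd m F x)"
  by (simp add: vec_eq_iff matrix_pd_def transpose_def)

lemma matrix_pd_commute:
  assumes "open S" "x \<in> S" "smooth_entries S F"
  shows "matrix_pd a (matrix_pd b F) x = matrix_pd b (matrix_pd a F) x"
  using assms pderivative_commute[OF assms(1,2)]
  unfolding matrix_pd_def smooth_entries_def vec_eq_iff by auto

lemma matrix_diff_ldistrib: "(A::real^'n::finite^'m::finite) ** (B - C) = A ** B - A ** (C :: real^'p::finite^'n)"
  by (simp add: vec_eq_iff matrix_matrix_mult_def sum_subtractf right_diff_distrib)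

lemma matrix_diff_rdistrib: "((B::real^'n::finite^'m::finite) - C) ** A = B ** A - C ** (A :: real^'p::finite^'n)"
  by (simp add: vec_eq_iff matrix_matrix_mult_def sum_subtractf left_diff_distrib)

lemma matrix_add_rdistrib': "((B::real^'n::finite^'m::finite) + C) ** A = B ** A + C ** (A :: real^'p::finite^'n)"
  by (simp add: vec_eq_iff matrix_matrix_mult_def sum.distrib distrib_right)

lemma matrix_minus_left: "(- (B::real^'n::finite^'m::finite)) ** A = - (B ** (A :: real^'p::finite^'n))"
  by (simp add: vec_eq_iff matrix_matrix_mult_def sum_negf)

lemma matrix_minus_right: "(B::real^'n::finite^'m::finite) ** (- A) = - (B ** (A :: real^'p::finite^'n))"
  by (simp add: vec_eq_iff matrix_matrix_mult_def sum_negf)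

lemmas matrix_distribs = matrix_add_ldistrib matrix_add_rdistrib' matrix_diff_ldistrib matrix_diff_rdistrib
  matrix_minus_left matrix_minus_right

lemma transpose_add: "transpose (A + B) = transpose A + transpose (B :: real^'n::finite^'m::finite)"
  by (simp add: vec_eq_iff transpose_def)

lemma transpose_diff: "transpose (A - B) = transpose A - transpose (B :: real^'n::finite^'m::finite)"
  by (simp add: vec_eq_iff transpose_def)

section \<open>Connection and curvature in a chart\<close>

text \<open>
  The connection matrix \<open>\<Gamma>\<^sub>a\<close>, with row index the upper and column index the last lower index of the
  Christoffel symbol.
\<close>

definition gam :: "'n::finite metric \<Rightarrow> real^'n \<Rightarrow> 'n \<Rightarrow> real^'n^'n" where
  "gam G x a = (\<chi> c d. christoffel G x c a d)"

text \<open>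
  The curvature matrix \<open>R\<^sub>a\<^sub>b = \<partial>\<^sub>a\<Gamma>\<^sub>b - \<partial>\<^sub>b\<Gamma>\<^sub>a + [\<Gamma>\<^sub>a, \<Gamma>\<^sub>b]\<close>; its entry in row \<open>c\<close> and column \<open>d\<close>
  is \<open>R\<^sub>a\<^sub>b\<^sup>c\<^sub>d\<close>.
\<close>

definition curv :: "'n::finite metric \<Rightarrow> real^'n \<Rightarrow> 'n \<Rightarrow> 'n \<Rightarrow> real^'n^'n" where
  "curv G x a b = matrix_pd a (\<lambda>y. gam G y b) x - matrix_pd b (\<lambda>y. gam G y a) x
     + gam G x a ** gam G x b - gam G x b ** gam G x a"

lemma nabla_vector_axis: "nabla_vector G (\<lambda>y. axis l 1) y j k = christoffel G y k j l"
proof -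
  have "(\<Sum>m\<in>UNIV. christoffel G y k j m * axis l 1 $ m) = (\<Sum>m\<in>UNIV. if m = l then christoffel G y k j l else 0)"
    by (intro sum.cong refl) (auto simp: axis_def)
  then show ?thesis by (simp add: nabla_vector_def)
qed

lemma christoffel_swap:
  fixes G :: "'n::finite metric"
  assumes "\<And>m i j. pderivative m (\<lambda>y. G y $ i $ j) x = pderivative m (\<lambda>y. G y $ j $ i) x"
  shows "christoffel G x k i j = christoffel G x k j i"
  unfolding christoffel_def by (intro arg_cong2[where f="(*)"] sum.cong refl) (simp add: assms[of _ i j])

text \<open>
  The components of a metric in a single chart, on the open image \<open>S\<close> of that chart.
\<close>

locale chart_metric =
  fixes G :: "'n::finite metric" and S :: "(real^'n) set"
  assumes S_open: "open S"
    and G_smooth: "smooth_on S G"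
    and G_sym: "x \<in> S \<Longrightarrow> transpose (G x) = G x"
    and G_inv: "x \<in> S \<Longrightarrow> invertible (G x)"
begin

abbreviation "h x \<equiv> matrix_inv (G x)"

lemma G_entry_sym: "x \<in> S \<Longrightarrow> G x $ i $ j = G x $ j $ i"
  using arg_cong[OF G_sym[of x], of "\<lambda>A. A $ j $ i"] by (simp add: transpose_def)

lemma Gh: "x \<in> S \<Longrightarrow> G x ** h x = mat 1" and hG: "x \<in> S \<Longrightarrow> h x ** G x = mat 1"
  using matrix_inv_invertible[OF G_inv] by auto

lemma h_sym: assumes "x \<in> S" shows "transpose (h x) = h x"
proof -
  have "transpose (h x) ** G x = mat 1"
    using arg_cong[OF Gh[OF assms], of transpose] by (simp add: matrix_transpose_mul G_sym[OF assms])
  then have "transpose (h x) ** G x ** h x = h x" by simp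
  then show ?thesis by (simp add: Gh[OF assms] flip: matrix_mul_assoc)
qed

lemma h_entry_sym: "x \<in> S \<Longrightarrow> metric_up G x i j = metric_up G x j i"
  unfolding metric_up_def using arg_cong[OF h_sym[of x], of "\<lambda>A. A $ j $ i"] by (simp add: transpose_def)

lemma smooth_G: "smooth_on S (\<lambda>x. G x $ i $ j)"
  by (rule smooth_on_component2[OF S_open G_smooth])

lemma smooth_h: "smooth_on S (\<lambda>x. metric_up G x i j)"
  by (rule smooth_on_metric_up[OF S_open G_smooth G_inv])

lemma smooth_christoffel: "smooth_on S (\<lambda>x. christoffel G x c a d)"
  unfolding christoffel_def
  by (intro smooth_on_mult[OF S_open] smooth_on_const smooth_on_sum[OF S_open] smooth_h
      smooth_on_add[OF S_open] smooth_on_diff[OF S_open] smooth_on_pderivative smooth_G)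

lemma G_entries: "smooth_entries S G" using smooth_G by (simp add: smooth_entries_def)

lemma h_entries: "smooth_entries S h" using smooth_h by (simp add: smooth_entries_def metric_up_def)

lemma gam_entries: "smooth_entries S (\<lambda>y. gam G y a)"
  using smooth_christoffel by (simp add: smooth_entries_def gam_def)

lemma pderivative_G_sym: "x \<in> S \<Longrightarrow> pderivative m (\<lambda>y. G y $ i $ j) x = pderivative m (\<lambda>y. G y $ j $ i) x"
  by (rule pderivative_cong[OF S_open]) (auto simp: G_entry_sym)

lemma christoffel_sym: "x \<in> S \<Longrightarrow> christoffel G x k i j = christoffel G x k j i"
  by (rule christoffel_swap) (rule pderivative_G_sym)

lemma G_h_sum:
  assumes "x \<in> S"
  shows "(\<Sum>e\<in>UNIV. G x $ c $ e * (\<Sum>m\<in>UNIV. metric_up G x e m * v m)) = v c"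
proof -
  have "(\<Sum>e\<in>UNIV. G x $ c $ e * (\<Sum>m\<in>UNIV. metric_up G x e m * v m)) =
     (\<Sum>m\<in>UNIV. (G x ** h x) $ c $ m * v m)"
    unfolding sum_distrib_left sum_distrib_right matrix_matrix_mult_def metric_up_def vec_lambda_beta
    by (subst sum.swap) (simp add: mult.assoc)
  also have "\<dots> = (\<Sum>m\<in>UNIV. if m = c then v c else 0)"
    unfolding Gh[OF assms] by (intro sum.cong refl) (auto simp: mat_def)
  finally show ?thesis by simp
qed

lemma lower_christoffel:
  assumes "x \<in> S"
  shows "(G x ** gam G x a) $ c $ d = 1/2 * (pderivative a (\<lambda>y. G y $ d $ c) x + pderivative d (\<lambda>y. G y $ a $ c) x
      - pderivative c (\<lambda>y. G y $ a $ d) x)"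
proof -
  let ?v = "\<lambda>m. pderivative a (\<lambda>y. G y $ d $ m) x + pderivative d (\<lambda>y. G y $ a $ m) x
      - pderivative m (\<lambda>y. G y $ a $ d) x"
  have "(G x ** gam G x a) $ c $ d = (\<Sum>e\<in>UNIV. G x $ c $ e * (1/2 * (\<Sum>m\<in>UNIV. metric_up G x e m * ?v m)))"
    by (simp add: matrix_matrix_mult_def gam_def christoffel_def)
  also have "\<dots> = 1/2 * (\<Sum>e\<in>UNIV. G x $ c $ e * (\<Sum>m\<in>UNIV. metric_up G x e m * ?v m))"
    by (subst sum_distrib_left) (simp add: mult.left_commute)
  finally show ?thesis unfolding G_h_sum[OF assms] .
qed

lemma metric_compatible:
  assumes "x \<in> S"
  shows "matrix_pd a G x = G x ** gam G x a + transpose (gam G x a) ** G x"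
proof -
  have "transpose (gam G x a) ** G x = transpose (G x ** gam G x a)"
    by (simp add: matrix_transpose_mul G_sym[OF assms])
  then have "(G x ** gam G x a + transpose (gam G x a) ** G x) $ c $ d =
     (G x ** gam G x a) $ c $ d + (G x ** gam G x a) $ d $ c" for c d
    by (simp add: transpose_def)
  then show ?thesis
    unfolding vec_eq_iff lower_christoffel[OF assms]
    using pderivative_G_sym[OF assms] by (simp add: matrix_pd_def field_simps)
qed

lemma pd_inverse_metric:
  assumes "x \<in> S"
  shows "matrix_pd m h x = - (gam G x m ** h x) - h x ** transpose (gam G x m)"
proof -
  have "matrix_pd m (\<lambda>y. h y ** G y) x = matrix_pd m (\<lambda>y. mat 1) x"
    by (rule matrix_pd_cong[OF S_open assms hG])
  then have "matrix_pd m h x ** G x + h x ** matrix_pd m G x = 0"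
    unfolding matrix_pd_mult[OF h_entries G_entries assms] by simp
  then have "(matrix_pd m h x ** G x + h x ** matrix_pd m G x) ** h x = 0"
    by (simp add: matrix_matrix_mult_def vec_eq_iff)
  then have "matrix_pd m h x ** (G x ** h x) + (h x ** G x) ** gam G x m ** h x +
      h x ** transpose (gam G x m) ** (G x ** h x) = 0"
    unfolding metric_compatible[OF assms] matrix_distribs by (simp add: matrix_mul_assoc add.assoc)
  then show ?thesis unfolding Gh[OF assms] hG[OF assms] by (simp add: algebra_simps eq_neg_iff_add_eq_0)
qed

lemma riem_mixed_curv: "riem_mixed G x a b c d = curv G x a b $ c $ d"
  if "x \<in> S" for x
  using christoffel_sym[OF that]
  by (simp add: riem_mixed_def nabla_mixed_def nabla_vector_axis curv_def matrix_pd_def gam_def matrix_matrix_mult_def)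

lemma curv_entries: "smooth_entries S (\<lambda>y. curv G y a b)"
  unfolding curv_def
  by (intro smooth_entries_add[OF S_open] smooth_entries_diff[OF S_open] smooth_entries_mult[OF S_open]
      smooth_entries_pd gam_entries)

lemma curv_antisym: "curv G x b a = - curv G x a b"
  by (simp add: curv_def)

lemma pd_curv:
  assumes "x \<in> S"
  shows "matrix_pd m (\<lambda>y. curv G y a b) x =
    matrix_pd m (matrix_pd a (\<lambda>y. gam G y b)) x - matrix_pd m (matrix_pd b (\<lambda>y. gam G y a)) x
    + (matrix_pd m (\<lambda>y. gam G y a) x ** gam G x b + gam G x a ** matrix_pd m (\<lambda>y. gam G y b) x)
    - (matrix_pd m (\<lambda>y. gam G y b) x ** gam G x a + gam G x b ** matrix_pd m (\<lambda>y. gam G y a) x)"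
proof -
  note e = smooth_entries_pd[OF gam_entries] smooth_entries_mult[OF S_open gam_entries gam_entries]
  show ?thesis unfolding curv_def
    by (simp add: matrix_pd_diff[OF _ _ assms] matrix_pd_add[OF _ _ assms] e smooth_entries_add[OF S_open]
        smooth_entries_diff[OF S_open] matrix_pd_mult[OF gam_entries gam_entries assms])
qed

text \<open>
  The sum expands to a Jacobi identity for the matrices \<open>\<Gamma>\<close>, after the second derivatives have
  cancelled in pairs.
\<close>

lemma second_bianchi_curv:
  assumes "x \<in> S"
  defines "D \<equiv> \<lambda>m a b. matrix_pd m (\<lambda>y. curv G y a b) x + gam G x m ** curv G x a b - curv G x a b ** gam G x m"
  shows "D m a b + D a b m + D b m a = 0"
  unfolding D_def pd_curv[OF assms(1)]
    matrix_pd_commute[OF S_open assms(1) gam_entries, of a m]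
    matrix_pd_commute[OF S_open assms(1) gam_entries, of b m]
    matrix_pd_commute[OF S_open assms(1) gam_entries, of b a]
  unfolding curv_def by (simp add: matrix_distribs matrix_mul_assoc algebra_simps)

lemma riem_lower: "x \<in> S \<Longrightarrow> riem G x a b c d = (G x ** curv G x a b) $ c $ d"
  by (simp add: riem_def riem_mixed_curv matrix_matrix_mult_def)

text \<open>
  The skew-symmetry of the curvature follows from the symmetry of the second derivatives of the
  metric, expressed through metric compatibility.
\<close>

lemma curv_skew:
  assumes "x \<in> S"
  shows "G x ** curv G x b a + transpose (curv G x b a) ** G x = 0"
proof -
  let ?g = "gam G x" and ?dg = "\<lambda>b a. matrix_pd b (\<lambda>y. gam G y a) x"
  have dd: "matrix_pd b (matrix_pd a G) x =
     (G x ** ?g b + transpose (?g b) ** G x) ** ?g a + G x ** ?dg b a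
     + (transpose (?dg b a) ** G x
        + transpose (?g a) ** (G x ** ?g b + transpose (?g b) ** G x))" for a b
  proof -
    have "matrix_pd b (matrix_pd a G) x = matrix_pd b (\<lambda>y. G y ** gam G y a + transpose (gam G y a) ** G y) x"
      by (rule matrix_pd_cong[OF S_open assms metric_compatible])
    also have "\<dots> = matrix_pd b (\<lambda>y. G y ** gam G y a) x + matrix_pd b (\<lambda>y. transpose (gam G y a) ** G y) x"
      by (intro matrix_pd_add[OF _ _ assms] smooth_entries_mult[OF S_open] smooth_entries_transpose
          gam_entries G_entries)
    finally show ?thesis
      unfolding matrix_pd_mult[OF G_entries gam_entries assms]
        matrix_pd_mult[OF smooth_entries_transpose[OF gam_entries] G_entries assms]
        matrix_pd_transpose metric_compatible[OF assms] .
  qed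
  have "matrix_pd b (matrix_pd a G) x - matrix_pd a (matrix_pd b G) x = 0"
    using matrix_pd_commute[OF S_open assms G_entries, of a b] by simp
  then show ?thesis unfolding dd curv_def
    by (simp add: matrix_distribs matrix_mul_assoc transpose_add transpose_diff matrix_transpose_mul algebra_simps)
qed

end

section \<open>Covariant derivatives and the Bianchi identity for mixed tensors\<close>

text \<open>
  The covariant derivative \<open>\<nabla>\<^sub>mT\<^sub>a\<^sup>c\<close> of a mixed tensor.
\<close>

definition cov2 :: "'n::finite metric \<Rightarrow> 'n tensor2 \<Rightarrow> real^'n \<Rightarrow> 'n \<Rightarrow> 'n array2" where
  "cov2 G T x m a c = pderivative m (\<lambda>y. T y a c) x + act2 (\<lambda>c e. christoffel G x c m e) (T x) a c"

text \<open>
  The covariant derivative \<open>\<nabla>\<^sub>mT\<^sub>a\<^sub>b\<^sup>c\<^sup>d\<close>.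
\<close>

definition cov4 :: "'n::finite metric \<Rightarrow> 'n tensor4 \<Rightarrow> real^'n \<Rightarrow> 'n \<Rightarrow> 'n array4" where
  "cov4 G T x m a b c d = pderivative m (\<lambda>y. T y a b c d) x + act4 (\<lambda>c e. christoffel G x c m e) (T x) a b c d"

lemma act4_add: "act4 B (\<lambda>a b c d. T a b c d + U a b c d) a b c d = act4 B T a b c d + act4 B U a b c d"
  by (simp add: act4_def sum.distrib sum_subtractf algebra_simps)

lemma act2_kron: "act2 B kron a c = 0"
  by (simp add: act2_def kron_def sum_subtractf if_distrib[of "\<lambda>x. _ * x"] cong: if_cong)

lemma act4_otimes_kron: "act4 B (otimes U kron) a b c d = otimes (act2 B U) kron a b c d"
  by (simp add: act4_otimes act2_kron[abs_def] otimes_def)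

lemma act4_kn_id: "act4 B (kn_id U) a b c d = kn_id (act2 B U) a b c d"
proof -
  let ?T = "otimes U kron"
  have e: "kn_id V a b c d = otimes V kron a b c d - otimes V kron a b d c + otimes V kron b a d c - otimes V kron b a c d"
    for V :: "'a \<Rightarrow> 'a \<Rightarrow> real" and a b c d
    by (simp add: kn_id_def otimes_def)
  have "act4 B (kn_id U) a b c d = act4 B ?T a b c d - act4 B ?T a b d c + act4 B ?T b a d c - act4 B ?T b a c d"
    unfolding act4_def e by (simp add: sum.distrib sum_subtractf algebra_simps)
  then show ?thesis unfolding act4_otimes_kron e .
qed

lemma matrix_mult_entry: "(A ** B) $ i $ j = (\<Sum>k\<in>UNIV. A $ i $ k * B $ k $ j)"
  by (simp add: matrix_matrix_mult_def)

context chart_metric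
begin

lemma riem_skew_first: "x \<in> S \<Longrightarrow> riem G x b a c d = - riem G x a b c d"
  by (simp add: riem_lower curv_antisym[of x b a] matrix_minus_right)

lemma riem_skew_last:
  assumes "x \<in> S" shows "riem G x a b d c = - riem G x a b c d"
proof -
  have "transpose (curv G x a b) ** G x = transpose (G x ** curv G x a b)"
    by (simp add: matrix_transpose_mul G_sym[OF assms])
  then have "(G x ** curv G x a b) $ c $ d + (G x ** curv G x a b) $ d $ c = 0"
    using arg_cong[OF curv_skew[OF assms, of a b], of "\<lambda>A. A $ c $ d"] by (simp add: transpose_def)
  then show ?thesis by (simp add: riem_lower[OF assms])
qed

lemma first_bianchi_curv:
  assumes "x \<in> S"
  shows "curv G x a b $ c $ d + curv G x b d $ c $ a + curv G x d a $ c $ b = 0"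
proof -
  have p: "pderivative m (\<lambda>y. christoffel G y c i j) x = pderivative m (\<lambda>y. christoffel G y c j i) x" for m i j
    by (rule pderivative_cong[OF S_open assms christoffel_sym])
  have q: "(\<Sum>e\<in>UNIV. christoffel G x c u e * christoffel G x e i j) = (\<Sum>e\<in>UNIV. christoffel G x c u e * christoffel G x e j i)" for u i j
    by (simp add: christoffel_sym[OF assms, of _ i j])
  show ?thesis
    using p[of a b d] p[of b d a] p[of d a b] q[of a b d] q[of b d a] q[of d a b]
    by (simp add: curv_def matrix_pd_def gam_def matrix_matrix_mult_def)
qed

lemma first_bianchi:
  assumes "x \<in> S"
  shows "riem G x a b c d + riem G x b d c a + riem G x d a c b = 0"
proof -
  have "riem G x a b c d + riem G x b d c a + riem G x d a c b =
     (\<Sum>m\<in>UNIV. G x $ c $ m * (curv G x a b $ m $ d + curv G x b d $ m $ a + curv G x d a $ m $ b))"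
    by (simp add: riem_def riem_mixed_curv[OF assms] sum.distrib distrib_left)
  then show ?thesis by (simp add: first_bianchi_curv[OF assms])
qed

text \<open>
  The usual octahedron argument: the four instances of the first Bianchi identity on \<open>a, b, c, d\<close>
  combined with the two skew-symmetries.
\<close>

lemma riem_pair_sym:
  assumes "x \<in> S"
  shows "riem G x a b c d = riem G x c d a b"
proof -
  note bi = first_bianchi[OF assms] and sf = riem_skew_first[OF assms] and sl = riem_skew_last[OF assms]
  show ?thesis
  using bi[of a b c d] bi[of b c d a]
    bi[of c d a b] bi[of d a b c]
    sf[of b a c d] sf[of d b c a]
    sf[of a d c b] sf[of c b d a] sf[of a c d b]
    sf[of b a d c] sf[of d c a b] sf[of b d a c]
    sf[of c b a d] sf[of a d b c] sf[of c a b d]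
    sf[of d c b a]
    sl[of a b c d] sl[of c d a b] sl[of a c b d]
    sl[of a d b c] sl[of b c a d] sl[of b d a c]
  by linarith
qed

lemma riem_mixed_raise:
  assumes "x \<in> S"
  shows "riem_mixed G x a b c d = (\<Sum>m\<in>UNIV. metric_up G x c m * riem G x a b m d)"
proof -
  have "(h x ** (G x ** curv G x a b)) $ c $ d = curv G x a b $ c $ d"
    by (simp add: matrix_mul_assoc hG[OF assms])
  then show ?thesis
    by (simp add: riem_mixed_curv[OF assms] riem_lower[OF assms] matrix_matrix_mult_def[of "h x"] metric_up_def)
qed

lemma ricci_sym:
  assumes "x \<in> S"
  shows "ricci G x i j = ricci G x j i"
proof -
  have "ricci G x i j = (\<Sum>k\<in>UNIV. \<Sum>m\<in>UNIV. metric_up G x k m * riem G x k i m j)" for i j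
    by (simp add: ricci_def riem_mixed_raise[OF assms])
  moreover have "(\<Sum>k\<in>UNIV. \<Sum>m\<in>UNIV. metric_up G x k m * riem G x k i m j) =
     (\<Sum>k\<in>UNIV. \<Sum>m\<in>UNIV. metric_up G x k m * riem G x k j m i)"
    by (subst sum.swap) (simp only: riem_pair_sym[OF assms, of _ i _ j] h_entry_sym[OF assms, of _ _])
  ultimately show ?thesis by simp
qed

lemma schouten_sym: "x \<in> S \<Longrightarrow> schouten G x i j = schouten G x j i"
  by (simp add: schouten_def ricci_sym[of x i j] G_entry_sym[of x i j])

lemma weyl_pair_sym:
  assumes "x \<in> S"
  shows "weyl G x a b c d = weyl G x c d a b"
proof -
  note ps = schouten_sym[OF assms] and gs = G_entry_sym[OF assms]
  show ?thesis
  unfolding weyl_def riem_pair_sym[OF assms, of a b c d]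
  by (simp add: ps[of a c] ps[of a d] ps[of b c]
      ps[of b d] gs[of a c] gs[of a d]
      gs[of b c] gs[of b d])
qed

lemma smooth_riem_mixed: "smooth_on S (\<lambda>x. riem_mixed G x a b c d)"
proof (rule smooth_on_cong[OF S_open])
  show "smooth_on S (\<lambda>x. curv G x a b $ c $ d)" using curv_entries by (simp add: smooth_entries_def)
qed (simp add: riem_mixed_curv)

lemma smooth_riem: "smooth_on S (\<lambda>x. riem G x a b c d)"
  unfolding riem_def by (intro smooth_on_sum smooth_on_mult smooth_G smooth_riem_mixed S_open)

lemma smooth_ricci: "smooth_on S (\<lambda>x. ricci G x a b)"
  unfolding ricci_def by (intro smooth_on_sum smooth_riem_mixed S_open)

lemma smooth_schouten: "smooth_on S (\<lambda>x. schouten G x a b)"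
  unfolding schouten_def schouten_trace_def scalar_curv_def divide_inverse
  by (intro smooth_on_sum smooth_on_mult smooth_on_diff smooth_on_const smooth_G smooth_h smooth_ricci S_open)

lemma smooth_weyl: "smooth_on S (\<lambda>x. weyl G x a b c d)"
  unfolding weyl_def
  by (intro smooth_on_mult smooth_on_diff smooth_on_add smooth_G smooth_riem smooth_schouten S_open)

lemma smooth_raise_last:
  "(\<And>a b. smooth_on S (\<lambda>x. T x a b)) \<Longrightarrow> smooth_on S (\<lambda>x. raise_last G T x a b)"
  unfolding raise_last_def by (intro smooth_on_sum smooth_on_mult smooth_h S_open)

lemma smooth_raise_last_two:
  "(\<And>a b c d. smooth_on S (\<lambda>x. T x a b c d)) \<Longrightarrow> smooth_on S (\<lambda>x. raise_last_two G T x a b c d)"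
  unfolding raise_last_two_def by (intro smooth_on_sum smooth_on_mult smooth_h S_open)

text \<open>The Schouten, Weyl and Riemann tensors in the forms \<open>P\<^sub>a\<^sup>c\<close>, \<open>W\<^sub>a\<^sub>b\<^sup>c\<^sup>d\<close> and \<open>R\<^sub>a\<^sub>b\<^sup>c\<^sup>d\<close>.\<close>

abbreviation "P_mix \<equiv> raise_last G (schouten G)"
abbreviation "W_mix \<equiv> raise_last_two G (weyl G)"
abbreviation "R_mix \<equiv> raise_last_two G (riem G)"

lemma h_G_sum:
  assumes "x \<in> S"
  shows "(\<Sum>q\<in>UNIV. metric_up G x d q * G x $ b $ q) = kron b d"
proof -
  have "(\<Sum>q\<in>UNIV. metric_up G x d q * G x $ b $ q) = (G x ** h x) $ b $ d"
    by (simp add: matrix_matrix_mult_def h_entry_sym[OF assms, of d] mult.commute flip: metric_up_def)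
  then show ?thesis by (simp add: Gh[OF assms] mat_def kron_def)
qed

lemma raise_product_metric:
  assumes "x \<in> S"
  shows "(\<Sum>p\<in>UNIV. \<Sum>q\<in>UNIV. metric_up G x c p * metric_up G x d q * (T x a p * G x $ b $ q)) =
    raise_last G T x a c * kron b d"
proof -
  have "(\<Sum>p\<in>UNIV. \<Sum>q\<in>UNIV. metric_up G x c p * metric_up G x d q * (T x a p * G x $ b $ q)) =
     (\<Sum>p\<in>UNIV. metric_up G x c p * T x a p) * (\<Sum>q\<in>UNIV. metric_up G x d q * G x $ b $ q)"
    by (simp add: sum_product mult_ac)
  then show ?thesis unfolding h_G_sum[OF assms] raise_last_def .
qed

lemma raise_kulkarni:
  assumes "x \<in> S"
  shows "raise_last_two G (\<lambda>x i j k l. T x i k * G x $ j $ l - T x i l * G x $ j $ k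
      + T x j l * G x $ i $ k - T x j k * G x $ i $ l) x a b c d = kn_id (raise_last G T x) a b c d"
proof -
  have 1: "(\<Sum>p\<in>UNIV. \<Sum>q\<in>UNIV. metric_up G x c p * metric_up G x d q * (T x a q * G x $ b $ p)) =
    raise_last G T x a d * kron b c" for a b c d
    unfolding raise_product_metric[OF assms, symmetric] by (subst sum.swap) (simp add: mult_ac)
  show ?thesis
    by (simp only: raise_last_two_def kn_id_def sum.distrib sum_subtractf distrib_left right_diff_distrib
        raise_product_metric[OF assms] 1)
qed

text \<open>
  The defining relation between the Riemann, Weyl and Schouten tensors, with two indices raised.
\<close>

lemma riem_decomposition:
  assumes "x \<in> S"
  shows "R_mix x a b c d = W_mix x a b c d + kn_id (P_mix x) a b c d"
  unfolding raise_kulkarni[OF assms, symmetric]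
  by (simp add: raise_last_two_def weyl_def sum.distrib[symmetric] distrib_left[symmetric])

lemma riem_raised:
  assumes "x \<in> S"
  shows "R_mix x a b c d = (curv G x a b ** h x) $ c $ d"
proof -
  have "R_mix x a b c d = (\<Sum>q\<in>UNIV. metric_up G x d q * (\<Sum>p\<in>UNIV. metric_up G x c p * riem G x a b p q))"
    unfolding raise_last_two_def by (subst sum.swap) (simp add: sum_distrib_left mult_ac)
  also have "\<dots> = (\<Sum>q\<in>UNIV. curv G x a b $ c $ q * metric_up G x q d)"
    unfolding riem_mixed_raise[OF assms, symmetric] riem_mixed_curv[OF assms] h_entry_sym[OF assms, of d]
    by (simp add: mult.commute)
  finally show ?thesis by (simp add: matrix_matrix_mult_def metric_up_def)
qed

text \<open>
  The correction terms for \<open>c\<close> and \<open>d\<close> and the derivative of the inverse metric combine to a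
  commutator with \<open>\<Gamma>\<^sub>m\<close>; those for \<open>a\<close> and
  \<open>b\<close> are left in a form that cancels in a cyclic sum because the connection is torsion-free.
\<close>

lemma cov4_riem:
  assumes "x \<in> S"
  shows "cov4 G R_mix x m a b c d =
    ((matrix_pd m (\<lambda>y. curv G y a b) x + gam G x m ** curv G x a b - curv G x a b ** gam G x m) ** h x) $ c $ d
    - (\<Sum>e\<in>UNIV. christoffel G x e m a * R_mix x e b c d) - (\<Sum>e\<in>UNIV. christoffel G x e m b * R_mix x a e c d)"
proof -
  let ?R = "curv G x a b" and ?dR = "matrix_pd m (\<lambda>y. curv G y a b) x" and ?g = "gam G x m"
  have "pderivative m (\<lambda>y. R_mix y a b c d) x = pderivative m (\<lambda>y. (curv G y a b ** h y) $ c $ d) x"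
    by (rule pderivative_cong[OF S_open assms riem_raised])
  also have "\<dots> = matrix_pd m (\<lambda>y. curv G y a b ** h y) x $ c $ d" by (simp add: matrix_pd_def)
  also have "matrix_pd m (\<lambda>y. curv G y a b ** h y) x = (?dR - ?R ** ?g) ** h x
      - ?R ** h x ** transpose (?g)"
    unfolding matrix_pd_mult[OF curv_entries h_entries assms] pd_inverse_metric[OF assms]
    by (simp add: matrix_distribs matrix_mul_assoc)
  finally have 1: "pderivative m (\<lambda>y. R_mix y a b c d) x = ((?dR - ?R ** ?g) ** h x) $ c $ d
      - (?R ** h x ** transpose (?g)) $ c $ d" by simp
  have 2: "(\<Sum>e\<in>UNIV. christoffel G x c m e * R_mix x a b e d) = (?g ** ?R ** h x) $ c $ d"
    unfolding riem_raised[OF assms] matrix_mul_assoc[symmetric]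
    by (subst matrix_mult_entry) (simp add: gam_def)
  have 3: "(\<Sum>e\<in>UNIV. christoffel G x d m e * R_mix x a b c e) = (?R ** h x ** transpose (?g)) $ c $ d"
    unfolding riem_raised[OF assms]
    by (subst matrix_mult_entry) (simp add: transpose_def gam_def mult.commute)
  show ?thesis unfolding cov4_def act4_def sum_subtractf 1 2 3
    by (simp add: matrix_distribs)
qed

lemma second_bianchi:
  assumes "x \<in> S"
  shows "cov4 G R_mix x m a b c d + cov4 G R_mix x a b m c d + cov4 G R_mix x b m a c d = 0"
proof -
  let ?D = "\<lambda>m a b. matrix_pd m (\<lambda>y. curv G y a b) x + gam G x m ** curv G x a b - curv G x a b ** gam G x m"
  have "(?D m a b ** h x) $ c $ d + (?D a b m ** h x) $ c $ d + (?D b m a ** h x) $ c $ d =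
     ((?D m a b + ?D a b m + ?D b m a) ** h x) $ c $ d"
    by (simp only: matrix_add_rdistrib' vector_add_component)
  also have "\<dots> = 0" unfolding second_bianchi_curv[OF assms] by (simp add: matrix_matrix_mult_def)
  finally have D: "(?D m a b ** h x) $ c $ d + (?D a b m ** h x) $ c $ d + (?D b m a ** h x) $ c $ d = 0" .
  have sk: "(\<Sum>e\<in>UNIV. christoffel G x e i j * R_mix x v e c d) = - (\<Sum>e\<in>UNIV. christoffel G x e j i * R_mix x e v c d)" for i j v
  proof -
    have "R_mix x v e c d = - R_mix x e v c d" for e
      by (simp add: riem_raised[OF assms] curv_antisym[of x v e] matrix_minus_left)
    then show ?thesis by (simp add: christoffel_sym[OF assms, of _ i j] sum_negf)
  qed
  show ?thesis
    unfolding cov4_riem[OF assms] using D sk[of m b a] sk[of a m b] sk[of b a m] by linarith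
qed

lemma smooth_P_mix: "smooth_on S (\<lambda>y. P_mix y a c)"
  by (rule smooth_raise_last) (rule smooth_schouten)

lemma smooth_W_mix: "smooth_on S (\<lambda>y. W_mix y a b c d)"
  by (rule smooth_raise_last_two) (rule smooth_weyl)

lemma cov4_decomposition:
  assumes "x \<in> S"
  shows "cov4 G R_mix x m a b c d = cov4 G W_mix x m a b c d + kn_id (cov2 G P_mix x m) a b c d"
proof -
  have P: "(\<lambda>y. P_mix y a c) differentiable (at x)" for a c
    by (rule smooth_on_differentiable[OF smooth_P_mix assms])
  have W: "(\<lambda>y. W_mix y a b c d) differentiable (at x)"
    by (rule smooth_on_differentiable[OF smooth_W_mix assms])
  have cP: "(\<lambda>y. P_mix y a c * r) differentiable (at x)" for a c r
    using P by (intro differentiable_mult) auto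
  have pP: "pderivative m (\<lambda>y. P_mix y a c * r) x = pderivative m (\<lambda>y. P_mix y a c) x * r" for a c r
    using pderivative_mult[OF P, of "\<lambda>_. r"] by simp
  have kP: "(\<lambda>y. kn_id (P_mix y) a b c d) differentiable (at x)"
    unfolding kn_id_def by (intro differentiable_add differentiable_diff cP)
  have "pderivative m (\<lambda>y. R_mix y a b c d) x = pderivative m (\<lambda>y. W_mix y a b c d + kn_id (P_mix y) a b c d) x"
    by (rule pderivative_cong[OF S_open assms riem_decomposition])
  also have "\<dots> = pderivative m (\<lambda>y. W_mix y a b c d) x + pderivative m (\<lambda>y. kn_id (P_mix y) a b c d) x"
    by (rule pderivative_add[OF W kP])
  also have "pderivative m (\<lambda>y. kn_id (P_mix y) a b c d) x = kn_id (\<lambda>a c. pderivative m (\<lambda>y. P_mix y a c) x) a b c d"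
    unfolding kn_id_def
    by (simp only: pderivative_diff[OF differentiable_add[OF differentiable_diff[OF cP cP] cP] cP]
        pderivative_add[OF differentiable_diff[OF cP cP] cP] pderivative_diff[OF cP cP] pP)
  finally have 1: "pderivative m (\<lambda>y. R_mix y a b c d) x = pderivative m (\<lambda>y. W_mix y a b c d) x +
     kn_id (\<lambda>a c. pderivative m (\<lambda>y. P_mix y a c) x) a b c d" .
  have R: "R_mix x = (\<lambda>a b c d. W_mix x a b c d + kn_id (P_mix x) a b c d)"
    by (simp add: fun_eq_iff riem_decomposition[OF assms])
  have 2: "act4 B (R_mix x) a b c d = act4 B (W_mix x) a b c d + kn_id (act2 B (P_mix x)) a b c d" for B
    unfolding R act4_add act4_kn_id ..
  show ?thesis unfolding cov4_def 1 2 by (simp add: kn_id_def cov2_def algebra_simps)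
qed

lemma cov2_raise:
  assumes "x \<in> S" and T: "\<And>a b. smooth_on S (\<lambda>y. T y a b)"
  shows "cov2 G (raise_last G T) x m a c = (\<Sum>q\<in>UNIV. metric_up G x c q * nabla_cov G T x m a q)"
proof -
  let ?T = "\<lambda>y. \<chi> a b. T y a b" and ?g = "gam G x m"
  have Te: "smooth_entries S ?T" using T by (simp add: smooth_entries_def)
  have e: "raise_last G T y a c = (?T y ** h y) $ a $ c" if "y \<in> S" for y a c
    by (simp add: raise_last_def matrix_matrix_mult_def h_entry_sym[OF that, of c] mult.commute flip: metric_up_def)
  let ?dT = "matrix_pd m (\<lambda>y. \<chi> a b. T y a b) x"
  have "pderivative m (\<lambda>y. raise_last G T y a c) x = pderivative m (\<lambda>y. (?T y ** h y) $ a $ c) x"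
    by (rule pderivative_cong[OF S_open assms(1) e])
  also have "\<dots> = matrix_pd m (\<lambda>y. ?T y ** h y) x $ a $ c" by (simp add: matrix_pd_def)
  also have "matrix_pd m (\<lambda>y. ?T y ** h y) x = (?dT - ?T x ** ?g) ** h x - ?T x ** h x ** transpose ?g"
    unfolding matrix_pd_mult[OF Te h_entries assms(1)] pd_inverse_metric[OF assms(1)]
    by (simp add: matrix_distribs matrix_mul_assoc)
  finally have 1: "pderivative m (\<lambda>y. raise_last G T y a c) x =
     ((?dT - ?T x ** ?g) ** h x) $ a $ c - (?T x ** h x ** transpose ?g) $ a $ c" by simp
  have 2: "(\<Sum>e\<in>UNIV. christoffel G x c m e * raise_last G T x a e) = (?T x ** h x ** transpose ?g) $ a $ c"
    unfolding e[OF assms(1)]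
    by (subst matrix_mult_entry) (simp add: transpose_def gam_def mult.commute)
  have 3: "(\<Sum>e\<in>UNIV. christoffel G x e m a * raise_last G T x e c) = (transpose ?g ** ?T x ** h x) $ a $ c"
    unfolding e[OF assms(1)] matrix_mul_assoc[symmetric]
    by (subst matrix_mult_entry) (simp add: transpose_def gam_def)
  have "cov2 G (raise_last G T) x m a c = ((?dT - ?T x ** ?g - transpose ?g ** ?T x) ** h x) $ a $ c"
    unfolding cov2_def act2_def sum_subtractf 1 2 3 by (simp add: matrix_distribs)
  also have "\<dots> = (\<Sum>q\<in>UNIV. nabla_cov G T x m a q * metric_up G x q c)"
    by (simp add: matrix_matrix_mult_def[of _ "h x"] metric_up_def nabla_cov_def)
       (simp add: matrix_matrix_mult_def matrix_pd_def transpose_def gam_def mult.commute algebra_simps)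
  finally show ?thesis by (simp add: h_entry_sym[OF assms(1), of c] mult.commute)
qed

lemma cotton_up_eq:
  assumes "x \<in> S"
  shows "cotton_up G x a b d = cov2 G P_mix x a b d - cov2 G P_mix x b a d"
  unfolding cov2_raise[OF assms smooth_schouten]
  by (simp add: cotton_up_def cotton_def sum_subtractf right_diff_distrib)

text \<open>
  The connection being metric, the divergence may be computed before lowering the index.
\<close>

lemma divergence_lowered:
  assumes "x \<in> S" and T: "\<And>a b. smooth_on S (\<lambda>y. T y a b)"
  shows "divergence G (\<lambda>y i j. \<Sum>m\<in>UNIV. G y $ j $ m * T y i m) x i = (\<Sum>j\<in>UNIV. cov2 G T x j i j)"
proof -
  let ?L = "\<lambda>y i j. \<Sum>m\<in>UNIV. G y $ j $ m * T y i m"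
  have L: "smooth_on S (\<lambda>y. ?L y a b)" for a b
    by (intro smooth_on_sum smooth_on_mult smooth_G T S_open)
  have r: "raise_last G ?L y a c = T y a c" if "y \<in> S" for y a c
  proof -
    have "raise_last G ?L y a c = (\<Sum>m\<in>UNIV. (\<Sum>e\<in>UNIV. metric_up G y c e * G y $ m $ e) * T y a m)"
      unfolding raise_last_def sum_distrib_left sum_distrib_right
      by (subst sum.swap) (simp add: G_entry_sym[OF that] mult.assoc)
    also have "\<dots> = T y a c" unfolding h_G_sum[OF that]
      by (simp add: kron_def if_distrib[of "\<lambda>x. x * _"] cong: if_cong)
    finally show ?thesis .
  qed
  have "cov2 G T x m i j = cov2 G (raise_last G ?L) x m i j" for m j
  proof -
    have "pderivative m (\<lambda>y. T y i j) x = pderivative m (\<lambda>y. raise_last G ?L y i j) x"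
      by (rule pderivative_cong[OF S_open assms(1)]) (simp add: r)
    moreover have "raise_last G ?L x = T x" by (simp add: fun_eq_iff r[OF assms(1)])
    ultimately show ?thesis unfolding cov2_def by simp
  qed
  then have "(\<Sum>j\<in>UNIV. cov2 G T x j i j) = (\<Sum>j\<in>UNIV. \<Sum>q\<in>UNIV. metric_up G x j q * nabla_cov G ?L x j i q)"
    by (simp add: cov2_raise[OF assms(1) L])
  also have "\<dots> = (\<Sum>q\<in>UNIV. \<Sum>j\<in>UNIV. metric_up G x q j * nabla_cov G ?L x j i q)"
    by (subst sum.swap) (simp add: h_entry_sym[OF assms(1)])
  finally show ?thesis by (simp add: divergence_def)
qed

end

section \<open>Divergence, trace and symmetry of \<open>\<Omega>\<close>\<close>

lemma pderivative_prod:
  fixes f :: "'a \<Rightarrow> real^'n::finite \<Rightarrow> real"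
  assumes "\<And>s. s \<in> A \<Longrightarrow> f s differentiable (at x)"
  shows "pderivative m (\<lambda>y. \<Prod>s\<in>A. f s y) x = (\<Sum>s\<in>A. pderivative m (f s) x * (\<Prod>t\<in>A - {s}. f t x))"
  using pderivative_eq[OF has_derivative_prod[of A f "\<lambda>s. frechet_derivative (f s) (at x)"]]
    assms[unfolded frechet_derivative_works] by (simp add: pderivative_def)

lemma smooth_on_pol_pf:
  assumes "open S" "\<And>s a b c d. smooth_on S (\<lambda>y. X y s a b c d)"
  shows "smooth_on S (\<lambda>y. pol_pf k (X y))"
  unfolding pol_pf_def contraction_def
  by (intro smooth_on_sum smooth_on_mult smooth_on_prod smooth_on_const assms)

lemma pderivative_pol_pf:
  assumes S: "open S" "x \<in> S" and X: "\<And>s a b c d. smooth_on S (\<lambda>y. X y s a b c d)"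
  shows "pderivative m (\<lambda>y. pol_pf k (X y)) x =
    (\<Sum>s=1..k. pol_pf k ((X x)(s := \<lambda>a b c d. pderivative m (\<lambda>y. X y s a b c d) x)))"
proof -
  let ?M = "multi_indices {1..2 * k} :: 'b multi_index set"
  let ?e = "\<lambda>I J s y. slot_at s (X y s) I J"
  let ?d = "\<lambda>I J s. pderivative m (\<lambda>y. ?e I J s y) x * slots_off ({1..k} - {s}) (X x) I J"
  have sm: "smooth_on S (\<lambda>y. \<Prod>s=1..k. ?e I J s y)" for I J :: "'b multi_index"
    by (intro smooth_on_prod S X)
  have d: "pderivative m (\<lambda>y. \<Prod>s=1..k. ?e I J s y) x = (\<Sum>s=1..k. ?d I J s)" for I J :: "'b multi_index"
    unfolding slots_off_def
    by (rule pderivative_prod) (rule smooth_on_differentiable[OF X S(2)])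
  have "pderivative m (\<lambda>y. pol_pf k (X y)) x =
    (\<Sum>I\<in>?M. pderivative m (\<lambda>y. \<Sum>J\<in>?M. gdelta {1..2 * k} I J * (\<Prod>s=1..k. ?e I J s y)) x)"
    unfolding pol_pf_def contraction_def
    by (rule pderivative_sum, rule smooth_on_differentiable[OF _ S(2)], intro smooth_on_sum smooth_on_mult smooth_on_const S sm)
  also have "\<dots> = (\<Sum>I\<in>?M. \<Sum>J\<in>?M. pderivative m (\<lambda>y. gdelta {1..2 * k} I J * (\<Prod>s=1..k. ?e I J s y)) x)"
    by (rule sum.cong[OF refl], rule pderivative_sum, rule smooth_on_differentiable[OF _ S(2)],
        intro smooth_on_mult smooth_on_const S sm)
  also have "\<dots> = (\<Sum>I\<in>?M. \<Sum>J\<in>?M. gdelta {1..2 * k} I J * (\<Sum>s=1..k. ?d I J s))"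
    by (intro sum.cong refl, subst pderivative_cmult) (use smooth_on_differentiable[OF sm S(2)] d in auto)
  also have "\<dots> = contraction {1..2 * k} (\<lambda>I J. \<Sum>s=1..k. ?d I J s)" by (simp add: contraction_def)
  also have "\<dots> = (\<Sum>s=1..k. contraction {1..2 * k} (\<lambda>I J. ?d I J s))" by (rule contraction_sum)
  also have "\<dots> = (\<Sum>s=1..k. pol_pf k ((X x)(s := \<lambda>a b c d. pderivative m (\<lambda>y. X y s a b c d) x)))"
    by (rule sum.cong[OF refl], subst pol_pf_update) auto
  finally show ?thesis .
qed

lemma act2_elem2:
  "act2 B (elem2 i j) a c = (\<Sum>e\<in>UNIV. B e i * elem2 e j a c) - (\<Sum>e\<in>UNIV. B j e * elem2 i e a c)"
proof -
  have 1: "(\<Sum>e\<in>UNIV. B c e * elem2 i j a e) = (if a = j then B c i else 0)"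
    by (simp add: elem2_def if_distrib[of "\<lambda>x. _ * x"] cong: if_cong)
  have 2: "(\<Sum>e\<in>UNIV. B e a * elem2 i j e c) = (if c = i then B j a else 0)"
    by (simp add: elem2_def if_distrib[of "\<lambda>x. _ * x"] cong: if_cong)
  have 3: "(\<Sum>e\<in>UNIV. B e i * elem2 e j a c) = (if a = j then B c i else 0)"
    by (simp add: elem2_def if_distrib[of "\<lambda>x. _ * x"] cong: if_cong)
  have 4: "(\<Sum>e\<in>UNIV. B j e * elem2 i e a c) = (if c = i then B j a else 0)"
    by (simp add: elem2_def if_distrib[of "\<lambda>x. _ * x"] cong: if_cong)
  show ?thesis unfolding act2_def sum_subtractf 1 2 3 4 ..
qed

text \<open>
  The action of \<open>B\<close> on the elementary endomorphism is transferred to the free indices.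
\<close>

lemma pol_pf_act_elem2:
  assumes "s \<in> {1..k}"
  shows "pol_pf k (X(s := otimes (act2 B (elem2 i j)) V)) =
    (\<Sum>e\<in>UNIV. B e i * pol_pf k (X(s := otimes (elem2 e j) V))) - (\<Sum>e\<in>UNIV. B j e * pol_pf k (X(s := otimes (elem2 i e) V)))"
proof -
  have "otimes (act2 B (elem2 i j)) V = (\<lambda>a b c d. (\<Sum>e\<in>UNIV. B e i * otimes (elem2 e j) V a b c d)
      - (\<Sum>e\<in>UNIV. B j e * otimes (elem2 i e) V a b c d))"
    by (simp add: fun_eq_iff otimes_def act2_elem2 left_diff_distrib sum_distrib_right mult.assoc)
  then show ?thesis
    by (simp only: pol_pf_diff[OF assms] pol_pf_sum[OF assms] pol_pf_scale[OF assms])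
qed

context chart_metric
begin

abbreviation "\<Gamma> x m \<equiv> \<lambda>c e. christoffel G x c m e"

abbreviation "p_mix y \<equiv> otimes (P_mix y) kron"

text \<open>
  The arguments of the polarized Pfaffian for the term of index \<open>l\<close> in \<open>\<Omega>\<^sub>i\<^sup>j\<close> at the point \<open>y\<close>.
\<close>

definition Omega_slots :: "nat \<Rightarrow> nat \<Rightarrow> 'n \<Rightarrow> 'n \<Rightarrow> real^'n \<Rightarrow> nat \<Rightarrow> 'n array4" where
  "Omega_slots k l i j y s = (if s \<in> {2..l + 1} then W_mix y else if s \<in> {2..k} then p_mix y
     else otimes (elem2 i j) (P_mix y))"

text \<open>
  The covariant derivatives of these arguments in the direction \<open>m\<close>, with the elementary
  endomorphism treated as constant.
\<close>

definition cov_Omega_slots :: "nat \<Rightarrow> nat \<Rightarrow> 'n \<Rightarrow> 'n \<Rightarrow> 'n \<Rightarrow> real^'n \<Rightarrow> nat \<Rightarrow> 'n array4" where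
  "cov_Omega_slots k l i j m y s = (if s \<in> {2..l + 1} then cov4 G W_mix y m
     else if s \<in> {2..k} then otimes (cov2 G P_mix y m) kron
     else otimes (elem2 i j) (cov2 G P_mix y m))"

lemma smooth_Omega_slots: "smooth_on S (\<lambda>y. Omega_slots k l i j y s a b c d)"
proof -
  have "smooth_on S (\<lambda>y. p_mix y a b c d)" "smooth_on S (\<lambda>y. otimes (elem2 i j) (P_mix y) a b c d)"
    unfolding otimes_def by (intro smooth_on_mult S_open smooth_P_mix smooth_on_const)+
  then show ?thesis
    using smooth_W_mix by (cases "s \<in> {2..l + 1}"; cases "s \<in> {2..k}") (simp_all only: Omega_slots_def if_True if_False)
qed

text \<open>
  The Leibniz rule for the covariant derivative.  The partial derivatives differ from the covariant
  ones by the action of the Christoffel symbols, which cancels by invariance of the delta, except on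
  the elementary endomorphism, where it supplies the correction terms for the indices \<open>i\<close> and \<open>j\<close>.
\<close>

lemma cov2_pol_pf_Omega_slots:
  assumes x: "x \<in> S" and k: "1 \<le> k" and l: "l < k"
  shows "cov2 G (\<lambda>y i j. pol_pf k (Omega_slots k l i j y)) x m i j =
    (\<Sum>s=1..k. pol_pf k ((Omega_slots k l i j x)(s := cov_Omega_slots k l i j m x s)))"
proof -
  let ?X = "Omega_slots k l i j x"
  let ?F = "\<lambda>i j. pol_pf k (Omega_slots k l i j x)"
  have one: "1 \<in> {1..k}" using k by simp
  have P: "(\<lambda>y. P_mix y a c) differentiable (at x)" for a c
    by (rule smooth_on_differentiable[OF smooth_P_mix x])
  have pP: "pderivative m (\<lambda>y. P_mix y a c * r) x = pderivative m (\<lambda>y. P_mix y a c) x * r" for a c r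
    using pderivative_mult[OF P, of "\<lambda>_. r"] by simp
  have pP': "pderivative m (\<lambda>y. r * P_mix y a c) x = r * pderivative m (\<lambda>y. P_mix y a c) x" for a c r
    by (rule pderivative_cmult[OF P])
  have slot: "(\<lambda>a b c d. pderivative m (\<lambda>y. Omega_slots k l i j y s a b c d) x) =
      (\<lambda>a b c d. (cov_Omega_slots k l i j m x s a b c d - act4 (\<Gamma> x m) (?X s) a b c d)
        + (if s = 1 then otimes (act2 (\<Gamma> x m) (elem2 i j)) (P_mix x) a b c d else 0))" if s: "s \<in> {1..k}" for s
  proof -
    consider "s = 1" | "s \<in> {2..l+1}" | "s \<in> {l+2..k}" using s by force
    then show ?thesis
    proof cases
      case 1
      then have e: "Omega_slots k l i j y s = otimes (elem2 i j) (P_mix y)" "cov_Omega_slots k l i j m x s = otimes (elem2 i j) (cov2 G P_mix x m)" for y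
        by (auto simp: Omega_slots_def cov_Omega_slots_def)
      show ?thesis unfolding e fun_eq_iff act4_otimes using 1
        by (simp add: otimes_def pP' cov2_def algebra_simps)
    next
      case 2
      then have e: "Omega_slots k l i j y s = W_mix y" "cov_Omega_slots k l i j m x s = cov4 G W_mix x m" "s \<noteq> 1" for y
        by (auto simp: Omega_slots_def cov_Omega_slots_def)
      show ?thesis unfolding e fun_eq_iff using e(3) by (simp add: cov4_def)
    next
      case 3
      then have e: "Omega_slots k l i j y s = p_mix y" "cov_Omega_slots k l i j m x s = otimes (cov2 G P_mix x m) kron" "s \<noteq> 1" for y
        by (auto simp: Omega_slots_def cov_Omega_slots_def)
      show ?thesis unfolding e fun_eq_iff act4_otimes_kron using e(3)
        by (simp add: otimes_def pP cov2_def distrib_right)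
    qed
  qed
  have Z: "pol_pf k (V(s := \<lambda>a b c d. 0)) = 0" if "s \<in> {1..k}" for V s
    using pol_pf_scale[OF that, of V 0 "\<lambda>a b c d. 0"] by simp
  have act: "pol_pf k (?X(s := \<lambda>a b c d. if s = 1 then otimes (act2 (\<Gamma> x m) (elem2 i j)) (P_mix x) a b c d else 0)) =
     (if s = 1 then (\<Sum>e\<in>UNIV. christoffel G x e m i * ?F e j) - (\<Sum>e\<in>UNIV. christoffel G x j m e * ?F i e) else 0)"
    if s: "s \<in> {1..k}" for s
  proof (cases "s = 1")
    case True
    have "pol_pf k (?X(1 := otimes (elem2 i' j') (P_mix x))) = ?F i' j'" for i' j'
      by (intro pol_pf_cong) (use k in \<open>auto simp: Omega_slots_def\<close>)
    then show ?thesis using pol_pf_act_elem2[OF one, of ?X "\<Gamma> x m" i j "P_mix x"] True by simp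
  next
    case False
    then show ?thesis using Z[OF s] by simp
  qed
  have "pderivative m (\<lambda>y. pol_pf k (Omega_slots k l i j y)) x =
    (\<Sum>s=1..k. pol_pf k (?X(s := \<lambda>a b c d. pderivative m (\<lambda>y. Omega_slots k l i j y s a b c d) x)))"
    by (rule pderivative_pol_pf[OF S_open x smooth_Omega_slots])
  also have "\<dots> = (\<Sum>s=1..k. (pol_pf k (?X(s := cov_Omega_slots k l i j m x s)) - pol_pf k (?X(s := act4 (\<Gamma> x m) (?X s)))) +
     (if s = 1 then (\<Sum>e\<in>UNIV. christoffel G x e m i * ?F e j) - (\<Sum>e\<in>UNIV. christoffel G x j m e * ?F i e) else 0))"
    by (rule sum.cong[OF refl], subst slot, assumption, subst pol_pf_add, assumption, subst pol_pf_diff, assumption,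
        subst act, assumption) (rule refl)
  also have "\<dots> = (\<Sum>s=1..k. pol_pf k (?X(s := cov_Omega_slots k l i j m x s))) +
     ((\<Sum>e\<in>UNIV. christoffel G x e m i * ?F e j) - (\<Sum>e\<in>UNIV. christoffel G x j m e * ?F i e))"
    unfolding sum.distrib sum_subtractf pol_pf_derivation using k by simp
  finally show ?thesis unfolding cov2_def act2_def sum_subtractf by simp
qed

text \<open>
  The coefficient of \<open>pol_pf k (Omega_slots k l i j y)\<close> in \<open>\<Omega>\<^sub>i\<^sup>j\<close>.  It differs from the one in
  \<open>Omega_mixed\<close> by the factor \<open>1 / (k - l - 1)!\<close>, due to the added identities.
\<close>

definition Omega_coef :: "nat \<Rightarrow> nat \<Rightarrow> real" where
  "Omega_coef k l = 4^(k-l) / (fact l * fact (k-l))"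

lemma Omega_mixed_eq:
  assumes "1 \<le> k" "CARD('n) = 2 * k"
  shows "Omega_mixed k G y i j = (\<Sum>l=0..k-1. Omega_coef k l * pol_pf k (Omega_slots k l i j y))"
  unfolding Omega_mixed_def
proof (rule sum.cong[OF refl])
  fix l assume "l \<in> {0..k-1}"
  then have l: "l < k" using assms(1) by auto
  have f: "fact (k - l) = real (k - l) * fact (k - l - 1)" using l by (subst fact_reduce) auto
  have "pol_pf k (Omega_slots k l i j y) = mixed_pf k l (otimes (elem2 i j) (P_mix y)) (W_mix y) (p_mix y)"
    by (simp add: mixed_pf_def Omega_slots_def[abs_def])
  then show "4^(k-l) * (1 / (fact l * real (k-l))) *
        (\<Sum>I\<in>multi_indices {1..k+l}. \<Sum>J\<in>multi_indices {1..k+l}.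
           gdelta {0..k+l} (I(0 := i)) (J(0 := j)) *
           (\<Prod>s=1..l. slot_at s (W_mix y) I J) *
           (\<Prod>s=2 * l+1..k+l. P_mix y (J s) (I s))) = Omega_coef k l * pol_pf k (Omega_slots k l i j y)"
    unfolding Omega_term_eq_mixed_pf[OF l assms(2)] Omega_coef_def f using l by (simp add: field_simps)
qed

lemma smooth_Omega_mixed:
  assumes "1 \<le> k" "CARD('n) = 2 * k"
  shows "smooth_on S (\<lambda>y. Omega_mixed k G y i j)"
  unfolding Omega_mixed_eq[OF assms]
  by (intro smooth_on_sum smooth_on_mult smooth_on_const smooth_on_pol_pf smooth_Omega_slots S_open)

lemma cov2_sum_scale:
  assumes "x \<in> S" "\<And>l i j. l \<in> A \<Longrightarrow> smooth_on S (\<lambda>y. T l y i j)"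
  shows "cov2 G (\<lambda>y i j. \<Sum>l\<in>A. r l * T l y i j) x m i j = (\<Sum>l\<in>A. r l * cov2 G (T l) x m i j)"
proof -
  have d: "(\<lambda>y. T l y i j) differentiable (at x)" if "l \<in> A" for l
    using smooth_on_differentiable[OF assms(2) assms(1)] that by blast
  have "pderivative m (\<lambda>y. \<Sum>l\<in>A. r l * T l y i j) x = (\<Sum>l\<in>A. r l * pderivative m (\<lambda>y. T l y i j) x)"
    by (subst pderivative_sum) (auto simp: pderivative_cmult d intro!: differentiable_mult d)
  moreover have "act2 B (\<lambda>i j. \<Sum>l\<in>A. r l * T l x i j) i j = (\<Sum>l\<in>A. r l * act2 B (T l x) i j)" for B
    unfolding act2_def sum_distrib_left sum_subtractf[symmetric] by (subst sum.swap) (simp add: algebra_simps)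
  ultimately show ?thesis by (simp add: cov2_def sum.distrib distrib_left)
qed

lemma cov2_diff_scale:
  assumes "x \<in> S" "\<And>i j. smooth_on S (\<lambda>y. T y i j)" "\<And>i j. smooth_on S (\<lambda>y. U y i j)"
  shows "cov2 G (\<lambda>y i j. T y i j - r * U y i j) x m i j = cov2 G T x m i j - r * cov2 G U x m i j"
proof -
  have d: "(\<lambda>y. T y i j) differentiable (at x)" "(\<lambda>y. U y i j) differentiable (at x)"
    using smooth_on_differentiable[OF assms(2,1)] smooth_on_differentiable[OF assms(3,1)] by blast+
  have "(\<lambda>y. r * U y i j) differentiable (at x)"
    by (intro differentiable_mult d differentiable_const)
  then have "pderivative m (\<lambda>y. T y i j - r * U y i j) x = pderivative m (\<lambda>y. T y i j) x - r * pderivative m (\<lambda>y. U y i j) x"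
    using pderivative_diff[OF d(1)] pderivative_cmult[OF d(2)] by simp
  moreover have "act2 B (\<lambda>i j. T x i j - r * U x i j) i j = act2 B (T x) i j - r * act2 B (U x) i j" for B
    unfolding act2_def sum_distrib_left sum_subtractf[symmetric] by (simp add: algebra_simps)
  ultimately show ?thesis by (simp add: cov2_def algebra_simps)
qed

lemma divergence_Omega_mixed:
  assumes x: "x \<in> S" and k: "1 \<le> k" "CARD('n) = 2 * k"
  shows "(\<Sum>j\<in>UNIV. cov2 G (Omega_mixed k G) x j i j) = 2 / fact (k - 1) *
    mixed_pf k (k - 1) (\<lambda>a b c d. (if c = i then 1 else 0) * cotton_up G x a b d) (W_mix x) (p_mix x)"
proof -
  have O: "Omega_mixed k G = (\<lambda>y i j. \<Sum>l=0..k-1. Omega_coef k l * pol_pf k (Omega_slots k l i j y))"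
    by (simp add: fun_eq_iff Omega_mixed_eq[OF k])
  have "cov2 G (Omega_mixed k G) x m i j = (\<Sum>l=0..k-1. Omega_coef k l *
      (\<Sum>s=1..k. pol_pf k ((Omega_slots k l i j x)(s := cov_Omega_slots k l i j m x s))))" for m j
  proof -
    have "cov2 G (Omega_mixed k G) x m i j = (\<Sum>l=0..k-1. Omega_coef k l * cov2 G (\<lambda>y i j. pol_pf k (Omega_slots k l i j y)) x m i j)"
      unfolding O by (rule cov2_sum_scale[OF x]) (intro smooth_on_pol_pf smooth_Omega_slots S_open)
    also have "\<dots> = (\<Sum>l=0..k-1. Omega_coef k l * (\<Sum>s=1..k. pol_pf k ((Omega_slots k l i j x)(s := cov_Omega_slots k l i j m x s))))"
      by (rule sum.cong[OF refl], subst cov2_pol_pf_Omega_slots[OF x k(1)]) (use k in auto)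
    finally show ?thesis .
  qed
  then have "(\<Sum>j\<in>UNIV. cov2 G (Omega_mixed k G) x j i j) = (\<Sum>l=0..k-1. Omega_coef k l *
      (\<Sum>j\<in>UNIV. \<Sum>s=1..k. pol_pf k ((Omega_slots k l i j x)(s := cov_Omega_slots k l i j j x s))))"
    unfolding sum_distrib_left by (simp only:) (rule sum.swap)
  also have "\<dots> = 2 / fact (k - 1) *
      mixed_pf k (k - 1) (\<lambda>a b c d. (if c = i then 1 else 0) * (cov2 G P_mix x a b d - cov2 G P_mix x b a d)) (W_mix x) (p_mix x)"
    unfolding Omega_coef_def Omega_slots_def[abs_def] cov_Omega_slots_def[abs_def]
    by (rule divergence_telescope[OF k(1)]) (use second_bianchi[OF x] in \<open>simp add: cov4_decomposition[OF x]\<close>)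
  finally show ?thesis by (simp only: cotton_up_eq[OF x])
qed

lemma trace_Omega_mixed:
  assumes x: "x \<in> S" and k: "1 \<le> k" "CARD('n) = 2 * k"
  shows "(\<Sum>a\<in>UNIV. Omega_mixed k G x a a) = pf_riem k G x - pf_weyl k G x"
proof -
  have pf: "pfaffian k T x = 1 / fact k * pol_pf k (\<lambda>s. T x)" for T :: "'n tensor4"
    by (simp add: pfaffian_def pol_pf_def contraction_def)
  have "R_mix x = (\<lambda>a b c d. W_mix x a b c d + kn_id (P_mix x) a b c d)"
    by (simp add: fun_eq_iff riem_decomposition[OF x])
  then have "pf_riem k G x = 1 / fact k * pol_pf k (\<lambda>s a b c d. W_mix x a b c d + kn_id (P_mix x) a b c d)"
    by (simp add: pf_riem_def pf)
  then show ?thesis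
    unfolding Omega_mixed_eq[OF k] Omega_coef_def
    using trace_mixed_pf[OF k(1), where W="W_mix x" and P="P_mix x"]
    by (simp add: pf_weyl_def pf mixed_pf_def Omega_slots_def[abs_def])
qed

lemma smooth_pfaffian:
  "(\<And>a b c d. smooth_on S (\<lambda>y. T y a b c d)) \<Longrightarrow> smooth_on S (pfaffian k T)"
  unfolding pfaffian_def[abs_def]
  by (intro smooth_on_mult smooth_on_const smooth_on_sum smooth_on_prod S_open)

text \<open>
  The tensor \<open>Q\<close> is arbitrary because no slot is left for it.
\<close>

lemma xi_eq:
  assumes "1 \<le> k"
  shows "xi k G x i = 1 / fact k * mixed_pf k (k - 1)
      (\<lambda>a b c d. (if c = i then 1 else 0) * cotton_up G x a b d) (W_mix x) Q
    + 1 / (2 * real CARD('n) * real k) * pderivative i (pf_weyl k G) x"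
proof -
  let ?Z = "\<lambda>a b c d. (if c = i then 1 else 0) * cotton_up G x a b d"
  let ?M = "multi_indices {2..2 * k} :: 'n multi_index set"
  define R where "R I J = (\<Prod>s=2..k. slot_at s (W_mix x) I J)" for I J
  have ins: "{1..2 * k} = insert 1 {2..2 * k}" using assms by auto
  have R: "R (I(1 := a)) (J(1 := b)) = R I J" for I J a b
    unfolding R_def
  proof (rule prod.cong[OF refl])
    fix s assume "s \<in> {2..k}"
    then have "2 * s - 1 \<noteq> 1" "2 * s \<noteq> 1" by auto
    then show "slot_at s (W_mix x) (I(1 := a)) (J(1 := b)) =
       slot_at s (W_mix x) I J" by simp
  qed
  let ?s = "\<lambda>I J j. gdelta {1..2 * k} (I(1 := i)) (J(1 := j)) * cotton_up G x j (J 2) (I 2) * R I J"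
  have "mixed_pf k (k - 1) ?Z (W_mix x) Q = contraction {1..2 * k} (\<lambda>I J. ?Z (J 1) (J 2) (I 1) (I 2) * R I J)"
    unfolding mixed_pf_def pol_pf_def
  proof (rule contraction_cong)
    fix I J :: "'n multi_index"
    let ?X = "\<lambda>s. if s \<in> {2..k - 1 + 1} then W_mix x else if s \<in> {2..k} then Q else ?Z"
    let ?f = "\<lambda>s. slot_at s (?X s) I J"
    have "{1..k} = insert 1 {2..k}" using assms by auto
    then have "prod ?f {1..k} = ?f 1 * prod ?f {2..k}" by simp
    also have "?f 1 = ?Z (J 1) (J 2) (I 1) (I 2)" by simp
    also have "prod ?f {2..k} = R I J" unfolding R_def by (rule prod.cong) auto
    finally show "prod ?f {1..k} = ?Z (J 1) (J 2) (I 1) (I 2) * R I J" .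
  qed
  also have "\<dots> = (\<Sum>I\<in>?M. \<Sum>a\<in>UNIV. \<Sum>J\<in>?M. \<Sum>j\<in>UNIV.
      gdelta {1..2 * k} (I(1 := a)) (J(1 := j)) * ((if a = i then 1 else 0) * cotton_up G x j (J 2) (I 2) * R I J))"
    unfolding contraction_def ins by (simp add: sum_multi_indices_insert R[unfolded One_nat_def])
  also have "\<dots> = (\<Sum>I\<in>?M. \<Sum>a\<in>UNIV. if a = i then (\<Sum>J\<in>?M. \<Sum>j\<in>UNIV.
      ?s I J j) else 0)"
    by (intro sum.cong refl) (simp add: mult.assoc)
  also have "\<dots> = (\<Sum>I\<in>?M. \<Sum>J\<in>?M. \<Sum>j\<in>UNIV.
      ?s I J j)" by simp
  also have "\<dots> = (\<Sum>I\<in>?M. \<Sum>j\<in>UNIV. \<Sum>J\<in>?M.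
      ?s I J j)"
    by (rule sum.cong[OF refl], rule sum.swap)
  also have "\<dots> = (\<Sum>j\<in>UNIV. \<Sum>I\<in>?M. \<Sum>J\<in>?M.
      ?s I J j)"
    by (rule sum.swap)
  finally show ?thesis unfolding xi_def R_def by simp
qed

lemma xi_eq_divergence_tf_Omega:
  assumes x: "x \<in> S" and k: "1 \<le> k" "CARD('n) = 2 * k"
  shows "2 * real k * xi k G x i =
           divergence G (tf_Omega k G) x i + 1 / (2 * real k) * pderivative i (pf_riem k G) x"
proof -
  let ?tr = "\<lambda>y. \<Sum>a\<in>UNIV. Omega_mixed k G y a a"
  let ?T = "\<lambda>y i j. Omega_mixed k G y i j - 1 / (2 * real k) * (?tr y * kron i j)"
  have smtr: "smooth_on S (\<lambda>y. ?tr y * kron i j)" for i j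
    by (intro smooth_on_mult smooth_on_sum smooth_Omega_mixed[OF k] smooth_on_const S_open)
  have lin: "cov2 G ?T x m i j = cov2 G (Omega_mixed k G) x m i j - 1 / (2 * real k) * cov2 G (\<lambda>y i j. ?tr y * kron i j) x m i j" for m j
    by (rule cov2_diff_scale[OF x smooth_Omega_mixed[OF k] smtr])
  have dtr: "cov2 G (\<lambda>y i j. ?tr y * kron i j) x m i j = pderivative m ?tr x * kron i j" for m j
  proof -
    have "?tr differentiable (at x)"
      by (rule smooth_on_differentiable[OF _ x]) (intro smooth_on_sum smooth_Omega_mixed[OF k] S_open)
    then have "pderivative m (\<lambda>y. ?tr y * kron i j) x = pderivative m ?tr x * kron i j"
      using pderivative_mult[of ?tr x "\<lambda>_. kron i j" m] by simp
    moreover have "act2 B (\<lambda>i j. ?tr x * kron i j) i j = ?tr x * act2 B kron i j" for B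
      unfolding act2_def sum_distrib_left by (rule sum.cong) (auto simp: algebra_simps)
    ultimately show ?thesis by (simp add: cov2_def act2_kron)
  qed
  have "divergence G (tf_Omega k G) x i = divergence G (\<lambda>y i j. \<Sum>m\<in>UNIV. G y $ j $ m * ?T y i m) x i"
  proof -
    have "tf_Omega k G y i j = (\<Sum>m\<in>UNIV. G y $ j $ m * ?T y i m)" if "y \<in> S" for y i j
    proof -
      have "(\<Sum>m\<in>UNIV. G y $ j $ m * ?T y i m) = (\<Sum>m\<in>UNIV. G y $ j $ m * Omega_mixed k G y i m)
          - (\<Sum>m\<in>UNIV. if m = i then 1 / (2 * real k) * ?tr y * G y $ j $ i else 0)"
        unfolding sum_subtractf[symmetric] by (rule sum.cong) (auto simp: kron_def algebra_simps)
      then show ?thesis by (simp add: tf_Omega_def Omega_def G_entry_sym[OF that, of i j])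
    qed
    then have "nabla_cov G (tf_Omega k G) x m i j = nabla_cov G (\<lambda>y i j. \<Sum>m\<in>UNIV. G y $ j $ m * ?T y i m) x m i j" for m i j
      unfolding nabla_cov_def using x by (simp add: pderivative_cong[OF S_open x, of "\<lambda>y. tf_Omega k G y i j"])
    then show ?thesis unfolding divergence_def by simp
  qed
  also have "\<dots> = (\<Sum>j\<in>UNIV. cov2 G ?T x j i j)"
    by (rule divergence_lowered[OF x]) (intro smooth_on_diff smooth_on_mult smooth_on_const smtr smooth_Omega_mixed[OF k] S_open)
  also have "\<dots> = (\<Sum>j\<in>UNIV. cov2 G (Omega_mixed k G) x j i j) - 1 / (2 * real k) * pderivative i ?tr x"
    unfolding lin dtr sum_subtractf by (simp add: kron_def if_distrib[of "\<lambda>x. _ * x"] cong: if_cong)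
  also have "pderivative i ?tr x = pderivative i (\<lambda>y. pf_riem k G y - pf_weyl k G y) x"
    by (rule pderivative_cong[OF S_open x trace_Omega_mixed[OF _ k]])
  also have "\<dots> = pderivative i (pf_riem k G) x - pderivative i (pf_weyl k G) x"
    unfolding pf_riem_def pf_weyl_def
    by (intro pderivative_diff smooth_on_differentiable[OF _ x] smooth_pfaffian smooth_raise_last_two smooth_weyl smooth_riem)
  finally have D: "divergence G (tf_Omega k G) x i = (\<Sum>j\<in>UNIV. cov2 G (Omega_mixed k G) x j i j)
     - 1 / (2 * real k) * (pderivative i (pf_riem k G) x - pderivative i (pf_weyl k G) x)" .
  have f: "fact k = real k * fact (k - 1)" using k by (subst fact_reduce) auto
  have c: "2 * real k * (1 / fact k * M + 1 / (2 * real CARD('n) * real k) * w) = 2 / fact (k - 1) * M + 1 / (2 * real k) * w" for M w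
    using k unfolding f by (simp add: field_simps)
  show ?thesis
    unfolding D divergence_Omega_mixed[OF x k] xi_eq[OF k(1), where Q="p_mix x"] c by (simp add: right_diff_distrib)
qed

lemma Omega_sym:
  assumes x: "x \<in> S" and k: "1 \<le> k" "CARD('n) = 2 * k"
  shows "Omega k G x i j = Omega k G x j i"
proof -
  define up where "up T a b c d = (\<Sum>p\<in>UNIV. \<Sum>q\<in>UNIV. metric_up G x c p * metric_up G x d q * T a b p q)"
    for T :: "'n array4" and a b c d
  \<comment> \<open>The slots with all indices lowered.  The index \<open>j\<close> of \<open>\<Omega>\<close> is lowered as well, so that the first
    slot contains \<open>g\<^sub>j\<^sub>a g\<^sub>i\<^sub>p\<close>; exchanging the index pairs then amounts to exchanging \<open>i\<close> and \<open>j\<close>.\<close>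
  define L where "L l i j s = (if s \<in> {2..l + 1} then weyl G x else if s \<in> {2..k} then (\<lambda>a b p q. schouten G x a p * G x $ b $ q)
     else (\<lambda>a b p q. G x $ j $ a * G x $ i $ p * schouten G x b q))" for l i j and s :: nat
  have one: "1 \<in> {1..k}" using k by simp
  have *: "(\<Sum>m\<in>UNIV. G x $ j $ m * pol_pf k (Omega_slots k l i m x)) = pol_pf k (\<lambda>s. up (L l i j s))" if l: "l < k" for l i j
  proof -
    let ?Y = "\<lambda>s. if s \<in> {2..l + 1} then W_mix x else p_mix x"
    let ?E = "\<lambda>a b c d. (if c = i then G x $ j $ a else 0) * P_mix x b d"
    have s: "pol_pf k (Omega_slots k l i m x) = pol_pf k (?Y(1 := otimes (elem2 i m) (P_mix x)))" for m
      by (intro pol_pf_cong) (auto simp: Omega_slots_def)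
    have E: "(\<Sum>m\<in>UNIV. G x $ j $ m * otimes (elem2 i m) (P_mix x) a b c d) = ?E a b c d" for a b c d
    proof -
      have "(\<Sum>m\<in>UNIV. G x $ j $ m * otimes (elem2 i m) (P_mix x) a b c d) = (\<Sum>m\<in>UNIV. if m = a then ?E a b c d else 0)"
        by (intro sum.cong refl) (auto simp: otimes_def elem2_def)
      then show ?thesis by simp
    qed
    have "(\<Sum>m\<in>UNIV. G x $ j $ m * pol_pf k (Omega_slots k l i m x)) = pol_pf k (?Y(1 := ?E))"
      unfolding s pol_pf_scale[OF one, symmetric] pol_pf_sum[OF one, symmetric] E ..
    also have "\<dots> = pol_pf k (\<lambda>s. up (L l i j s))"
    proof (rule pol_pf_cong)
      fix s assume s: "s \<in> {1..k}"
      consider "s = 1" | "s \<in> {2..l+1}" | "s \<in> {l+2..k}" using s by force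
      then show "(?Y(1 := ?E)) s = up (L l i j s)"
      proof cases
        case 1
        have "up (\<lambda>a b p q. G x $ j $ a * G x $ i $ p * schouten G x b q) a b c d =
            G x $ j $ a * (\<Sum>p\<in>UNIV. metric_up G x c p * G x $ i $ p) * (\<Sum>q\<in>UNIV. metric_up G x d q * schouten G x b q)" for a b c d
          by (simp add: up_def sum_distrib_left sum_distrib_right sum_product mult_ac)
        then have "up (\<lambda>a b p q. G x $ j $ a * G x $ i $ p * schouten G x b q) a b c d = ?E a b c d" for a b c d
          unfolding h_G_sum[OF x] by (simp add: raise_last_def kron_def)
        then show ?thesis using 1 by (simp add: L_def fun_eq_iff)
      next
        case 2
        then show ?thesis by (auto simp: L_def fun_eq_iff up_def raise_last_two_def)
      next
        case 3
        then show ?thesis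
          by (auto simp: L_def fun_eq_iff up_def raise_product_metric[OF x] otimes_def)
      qed
    qed
    finally show ?thesis .
  qed
  have sym: "pol_pf k (\<lambda>s. up (L l i j s)) = pol_pf k (\<lambda>s. up (L l j i s))" for l
  proof -
    have "(\<lambda>a b c d. L l i j s c d a b) = L l j i s" for s
    proof -
      have 1: "(\<lambda>a b c d. weyl G x c d a b) = weyl G x"
        by (intro ext) (rule weyl_pair_sym[OF x])
      have 2: "(\<lambda>a b c d. schouten G x c a * G x $ d $ b) = (\<lambda>a b p q. schouten G x a p * G x $ b $ q)"
        by (intro ext arg_cong2[where f="(*)"] schouten_sym[OF x] G_entry_sym[OF x])
      have 3: "(\<lambda>a b c d. G x $ j $ c * G x $ i $ a * schouten G x d b) = (\<lambda>a b p q. G x $ i $ a * G x $ j $ p * schouten G x b q)"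
        by (intro ext arg_cong2[where f="(*)"] schouten_sym[OF x] mult.commute)
      show ?thesis unfolding L_def
        by (cases "s \<in> {2..l + 1}"; cases "s \<in> {2..k}") (simp_all only: if_True if_False 1 2 3)
    qed
    moreover have "pol_pf k (\<lambda>s. up (L l i j s)) = pol_pf k (\<lambda>s. up (\<lambda>a b c d. L l i j s c d a b))"
      unfolding up_def[abs_def] by (rule pol_pf_pair_symmetric[OF h_entry_sym[OF x]])
    ultimately show ?thesis by (simp only:)
  qed
  have "Omega k G x i j = (\<Sum>l=0..k-1. Omega_coef k l * pol_pf k (\<lambda>s. up (L l i j s)))" for i j
  proof -
    have "Omega k G x i j = (\<Sum>l=0..k-1. Omega_coef k l * (\<Sum>m\<in>UNIV. G x $ j $ m * pol_pf k (Omega_slots k l i m x)))"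
      unfolding Omega_def Omega_mixed_eq[OF k] sum_distrib_left by (subst sum.swap) (simp add: mult_ac)
    also have "\<dots> = (\<Sum>l=0..k-1. Omega_coef k l * pol_pf k (\<lambda>s. up (L l i j s)))"
      by (rule sum.cong[OF refl], subst *) (use k in auto)
    finally show ?thesis .
  qed
  then show ?thesis by (simp only: sym)
qed

end

theorem theorem1p4:
  fixes M :: "'a topology" and charts :: "('a, 'n::finite) chart set"
    and g :: "('a, 'n) chart \<Rightarrow> real^'n \<Rightarrow> real^'n^'n" and k :: nat
  assumes "k \<ge> 2"
    and "CARD('n) = 2 * k"
    and "pseudo_riemannian_manifold M charts g"
  shows "\<forall>c\<in>charts. \<forall>p\<in>fst c.
      (\<forall>i j. Omega k (g c) (snd c p) i j = Omega k (g c) (snd c p) j i) \<and>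
      (\<forall>i. 2 * real k * xi k (g c) (snd c p) i =
           divergence (g c) (tf_Omega k (g c)) (snd c p) i
           + 1 / (2 * real k) * pderivative i (pf_riem k (g c)) (snd c p))"
proof (intro ballI)
  fix c p assume c: "c \<in> charts" and p: "p \<in> fst c"
  interpret pseudo_riemannian_manifold M charts g by fact
  interpret chart_metric "g c" "snd c ` fst c"
  proof
    show "open (snd c ` fst c)" by (rule chart_image_open[OF c])
    show "smooth_on (snd c ` fst c) (g c)" by (rule metric_smooth[OF c])
    fix x assume "x \<in> snd c ` fst c"
    then show "transpose (g c x) = g c x" "invertible (g c x)"
      using metric_symmetric[OF c] metric_nondegenerate[OF c] by auto
  qed
  have x: "snd c p \<in> snd c ` fst c" using p by simp
  have k: "1 \<le> k" using assms(1) by simp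
  show "(\<forall>i j. Omega k (g c) (snd c p) i j = Omega k (g c) (snd c p) j i) \<and>
      (\<forall>i. 2 * real k * xi k (g c) (snd c p) i =
           divergence (g c) (tf_Omega k (g c)) (snd c p) i
           + 1 / (2 * real k) * pderivative i (pf_riem k (g c)) (snd c p))"
    using Omega_sym[OF x k assms(2)] xi_eq_divergence_tf_Omega[OF x k assms(2)] by blast
qed

end
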